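(* Let $\tau\in\mathbb{H}$, $q=e^{2\pi i\tau}$, and let $\alpha$ be any complex number with $\alpha\neq 3n\tau+m$ for all $m,n\in\mathbb{Z}$. Put $w=e^{2\pi i\alpha}$, $w^{3/2}:=e^{3\pi i\alpha}$ and $\zeta_3=e^{2\pi i/3}$. Then $$w^{3/2}q^{-1/24}\bigl(g_3(w;q)+g_3(\zeta_3w;q)+g_3(\zeta_3^2w;q)\bigr)=\frac{3\eta^3(3\tau)}{\eta(\tau)\,\vartheta(3\alpha;3\tau)},$$ a meromorphic Jacobi form. If $\alpha=r\tau+s$ with $r,s\in\mathbb{Q}$, then this function multiplied by $q^{-3r^2/2}$ is a weakly holomorphic modular form of weight $1/2$ on a subgroup of $SL_2(\mathbb{Z})$ depending on $r$.
   Context: Notation: for $\lambda\in\mathbb{Q}$, $q^\lambda:=e^{2\pi i\lambda\tau}$. $(a;q)_0=1$, $(a;q)_n=\prod_{j=0}^{n-1}(1-aq^j)$. The universal mock theta function is $g_3(w;q)=\sum_{n\ge0}\frac{q^{n(n+1)}}{(w;q)_{n+1}(q/w;q)_{n+1}}$. $\eta(\tau)=q^{1/24}\prod_{n\ge1}(1-q^n)$. $\vartheta(z;\tau)=\sum_{n\in\mathbb{Z}}(-1)^n e^{\pi i(2n+1)z}q^{n(n+1)/2+1/8}$.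
   Formalization: With the given theta the identity holds with a minus sign on the right; where 3α = 3nτ+m both sides have poles instead of being equal; the pairs with r and 3s both integers (identically a pole) are excluded; the subgroup depends on r and s. *)

theory Defs
  imports "HOL-Complex_Analysis.Complex_Analysis" "HOL-Algebra.Coset"
begin

section \<open>The functions in the identity\<close>

text \<open>Rational powers of \<open>q\<close> are functions of \<open>\<tau>\<close>, not of the number \<open>q\<close>.\<close>

definition qpow :: "real \<Rightarrow> complex \<Rightarrow> complex" where
  "qpow l \<tau> = exp (2 * of_real pi * \<i> * of_real l * \<tau>)"

definition qpoch :: "complex \<Rightarrow> complex \<Rightarrow> nat \<Rightarrow> complex" where
  "qpoch a q n = (\<Prod>j<n. 1 - a * q ^ j)"

definition g3 :: "complex \<Rightarrow> complex \<Rightarrow> complex" where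
  "g3 w q = (\<Sum>n. q ^ (n * (n + 1)) / (qpoch w q (n + 1) * qpoch (q / w) q (n + 1)))"

definition dedekind_eta :: "complex \<Rightarrow> complex" where
  "dedekind_eta \<tau> = qpow (1 / 24) \<tau> * (\<Prod>n. 1 - qpow 1 \<tau> ^ (n + 1))"

definition jacobi_theta :: "complex \<Rightarrow> complex \<Rightarrow> complex" where
  "jacobi_theta z \<tau> =
     (\<Sum>\<^sub>\<infinity>n\<in>(UNIV :: int set). (-1) powi n * exp (of_real pi * \<i> * (2 * of_int n + 1) * z)
        * qpow (of_int n * (of_int n + 1) / 2 + 1 / 8) \<tau>)"

definition zeta3 :: complex where
  "zeta3 = exp (2 * of_real pi * \<i> / 3)"

definition g3_trisum :: "complex \<Rightarrow> complex \<Rightarrow> complex" where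
  "g3_trisum \<alpha> \<tau> =
     (let w = exp (2 * of_real pi * \<i> * \<alpha>); q = qpow 1 \<tau>
      in exp (3 * of_real pi * \<i> * \<alpha>) * qpow (- 1 / 24) \<tau>
           * (g3 w q + g3 (zeta3 * w) q + g3 (zeta3\<^sup>2 * w) q))"

text \<open>At the zeros of the theta function the value is \<open>0\<close>.\<close>

definition theta_quotient :: "complex \<Rightarrow> complex \<Rightarrow> complex" where
  "theta_quotient \<alpha> \<tau> =
     3 * dedekind_eta (3 * \<tau>) ^ 3 / (dedekind_eta \<tau> * jacobi_theta (3 * \<alpha>) (3 * \<tau>))"

text \<open>
  As \<open>q\<close> tends to \<open>0\<close>, the leading term of \<open>g3_trisum\<close> is \<open>3 w^(3/2) q^(-1/24) / (1 - w^3)\<close>,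
  while \<open>jacobi_theta z \<tau>\<close> starts with \<open>q^(1/8) (exp (\<pi> i z) - exp (- \<pi> i z))\<close>, so the leading
  term of \<open>theta_quotient\<close> is \<open>- 3 w^(3/2) q^(-1/24) / (1 - w^3)\<close>. With this normalisation of the
  theta function it is therefore \<open>- theta_quotient\<close> that \<open>g3_trisum\<close> is to be compared with.
\<close>


section \<open>The modular group\<close>

definition upper_half_plane :: "complex set" where
  "upper_half_plane = {\<tau>. Im \<tau> > 0}"

definition SL2Z :: "(int ^ 2 ^ 2) monoid" where
  "SL2Z = \<lparr>carrier = {A. det A = 1}, mult = (\<lambda>A B. A ** B), one = mat 1\<rparr>"

lemma group_SL2Z: "group SL2Z"
proof (rule groupI)
  fix A assume "A \<in> carrier SL2Z"
  then have A: "A $ 1 $ 1 * A $ 2 $ 2 - A $ 1 $ 2 * A $ 2 $ 1 = 1"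
    by (simp add: SL2Z_def det_2)
  define B :: "int ^ 2 ^ 2" where
    "B = (\<chi> i j. if i = 1 then (if j = 1 then A $ 2 $ 2 else - A $ 1 $ 2)
                 else (if j = 1 then - A $ 2 $ 1 else A $ 1 $ 1))"
  have "det B = 1"
    using A by (simp add: B_def det_2 algebra_simps)
  moreover have "B ** A = mat 1"
    using A by (simp add: B_def matrix_matrix_mult_def mat_def vec_eq_iff sum_2 forall_2
        algebra_simps)
  ultimately show "\<exists>B\<in>carrier SL2Z. B \<otimes>\<^bsub>SL2Z\<^esub> A = \<one>\<^bsub>SL2Z\<^esub>"
    by (intro bexI[of _ B]) (simp_all add: SL2Z_def)
qed (simp_all add: SL2Z_def det_mul matrix_mul_assoc)

definition finite_index_subgroup :: "(int ^ 2 ^ 2) set \<Rightarrow> bool" where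
  "finite_index_subgroup \<Gamma> \<longleftrightarrow> subgroup \<Gamma> SL2Z \<and> finite (rcosets\<^bsub>SL2Z\<^esub> \<Gamma>)"

definition aut_denom :: "int ^ 2 ^ 2 \<Rightarrow> complex \<Rightarrow> complex" where
  "aut_denom A \<tau> = of_int (A $ 2 $ 1) * \<tau> + of_int (A $ 2 $ 2)"

definition mob :: "int ^ 2 ^ 2 \<Rightarrow> complex \<Rightarrow> complex" where
  "mob A \<tau> = (of_int (A $ 1 $ 1) * \<tau> + of_int (A $ 1 $ 2)) / aut_denom A \<tau>"

text \<open>
  Non-integral powers of \<open>c \<tau> + d\<close> are principal values. The multiplier systems considered here
  have finite order.
\<close>

definition multiplier_system ::
  "real \<Rightarrow> (int ^ 2 ^ 2) set \<Rightarrow> (int ^ 2 ^ 2 \<Rightarrow> complex) \<Rightarrow> bool" where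
  "multiplier_system k \<Gamma> \<nu> \<longleftrightarrow>
     (\<exists>N::nat. N > 0 \<and> (\<forall>A\<in>\<Gamma>. \<nu> A ^ N = 1)) \<and>
     (\<forall>A\<in>\<Gamma>. \<forall>B\<in>\<Gamma>. \<forall>\<tau>\<in>upper_half_plane.
        \<nu> (A ** B) * aut_denom (A ** B) \<tau> powr of_real k =
        \<nu> A * aut_denom A (mob B \<tau>) powr of_real k * (\<nu> B * aut_denom B \<tau> powr of_real k))"


section \<open>Weakly holomorphic modular forms\<close>

text \<open>
  \<open>F\<close> is, near \<open>\<i>\<infinity>\<close>, a Laurent series in \<open>q^(1/N)\<close> with finite principal part.
\<close>

definition meromorphic_at_ii_inf :: "(complex \<Rightarrow> complex) \<Rightarrow> bool" where
  "meromorphic_at_ii_inf F \<longleftrightarrow>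
     (\<exists>(N::nat) (n0::int) (a :: nat \<Rightarrow> complex) (Y::real). N > 0 \<and>
        (\<forall>\<tau>\<in>upper_half_plane. Im \<tau> > Y \<longrightarrow>
           (\<lambda>n. a n * qpow ((of_int n0 + of_nat n) / of_nat N) \<tau>) sums F \<tau>))"

definition modular_slash ::
  "real \<Rightarrow> int ^ 2 ^ 2 \<Rightarrow> (complex \<Rightarrow> complex) \<Rightarrow> complex \<Rightarrow> complex" where
  "modular_slash k A f \<tau> = aut_denom A \<tau> powr (- of_real k) * f (mob A \<tau>)"

definition weakly_holomorphic_modular_form ::
  "real \<Rightarrow> (int ^ 2 ^ 2) set \<Rightarrow> (complex \<Rightarrow> complex) \<Rightarrow> bool" where
  "weakly_holomorphic_modular_form k \<Gamma> f \<longleftrightarrow>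
     f holomorphic_on upper_half_plane \<and>
     (\<exists>\<nu>. multiplier_system k \<Gamma> \<nu> \<and>
        (\<forall>A\<in>\<Gamma>. \<forall>\<tau>\<in>upper_half_plane.
           f (mob A \<tau>) = \<nu> A * aut_denom A \<tau> powr of_real k * f \<tau>)) \<and>
     (\<forall>A\<in>carrier SL2Z. meromorphic_at_ii_inf (modular_slash k A f))"


section \<open>Meromorphic Jacobi forms\<close>

definition holomorphic2_on ::
  "(complex \<times> complex \<Rightarrow> complex) \<Rightarrow> (complex \<times> complex) set \<Rightarrow> bool" where
  "holomorphic2_on f U \<longleftrightarrow>
     (\<forall>p\<in>U. \<exists>a b. (f has_derivative (\<lambda>(u, v). a * u + b * v)) (at p))"

text \<open>
  For an open set \<open>U\<close>: locally a quotient of holomorphic functions whose denominator does not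
  vanish identically on any nonempty open set. As in \<^const>\<open>nicely_meromorphic_on\<close>, polar
  points carry the value \<open>0\<close>, so that functional equations can be stated at all points.
\<close>

definition meromorphic2_on ::
  "(complex \<times> complex \<Rightarrow> complex) \<Rightarrow> (complex \<times> complex) set \<Rightarrow> bool" where
  "meromorphic2_on f U \<longleftrightarrow>
     (\<forall>p\<in>U.
        (\<exists>V g h. open V \<and> p \<in> V \<and> V \<subseteq> U \<and> holomorphic2_on g V \<and> holomorphic2_on h V \<and>
           (\<forall>W. open W \<and> W \<subseteq> V \<and> W \<noteq> {} \<longrightarrow> (\<exists>x\<in>W. h x \<noteq> 0)) \<and>
           (\<forall>x\<in>V. h x \<noteq> 0 \<longrightarrow> f x = g x / h x)) \<and>
        ((\<exists>V. open V \<and> p \<in> V \<and> holomorphic2_on f V) \<or> f p = 0))"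

definition jacobi_slash ::
  "real \<Rightarrow> real \<Rightarrow> int ^ 2 ^ 2 \<Rightarrow> (complex \<Rightarrow> complex \<Rightarrow> complex) \<Rightarrow>
   complex \<Rightarrow> complex \<Rightarrow> complex" where
  "jacobi_slash k m A \<phi> z \<tau> =
     aut_denom A \<tau> powr (- of_real k)
       * exp (- 2 * of_real pi * \<i> * of_real m * of_int (A $ 2 $ 1) * z\<^sup>2 / aut_denom A \<tau>)
       * \<phi> (z / aut_denom A \<tau>) (mob A \<tau>)"

text \<open>
  Weight \<open>k\<close>, index \<open>m\<close>, group \<open>\<Gamma>\<close>, for the lattice \<open>\<int>\<tau> + \<int>\<close>. For half-integral weight and index
  both transformation laws involve multipliers, which are required to be of finite order.
  Meromorphy at the cusps is imposed on the restrictions to all torsion sections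
  \<open>z = r \<tau> + s\<close>.
\<close>

definition meromorphic_jacobi_form ::
  "real \<Rightarrow> real \<Rightarrow> (int ^ 2 ^ 2) set \<Rightarrow> (complex \<Rightarrow> complex \<Rightarrow> complex) \<Rightarrow> bool" where
  "meromorphic_jacobi_form k m \<Gamma> \<phi> \<longleftrightarrow>
     meromorphic2_on (\<lambda>(z, \<tau>). \<phi> z \<tau>) (UNIV \<times> upper_half_plane) \<and>
     (\<exists>\<nu>. multiplier_system k \<Gamma> \<nu> \<and>
        (\<forall>A\<in>\<Gamma>. \<forall>z. \<forall>\<tau>\<in>upper_half_plane.
           \<phi> (z / aut_denom A \<tau>) (mob A \<tau>) =
             \<nu> A * aut_denom A \<tau> powr of_real k
               * exp (2 * of_real pi * \<i> * of_real m * of_int (A $ 2 $ 1) * z\<^sup>2 / aut_denom A \<tau>)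
               * \<phi> z \<tau>)) \<and>
     (\<exists>\<psi> :: int \<Rightarrow> int \<Rightarrow> complex.
        (\<exists>N::nat. N > 0 \<and> (\<forall>l \<mu>. \<psi> l \<mu> ^ N = 1)) \<and>
        (\<forall>l \<mu> z. \<forall>\<tau>\<in>upper_half_plane.
           \<phi> (z + of_int l * \<tau> + of_int \<mu>) \<tau> =
             \<psi> l \<mu> * exp (- 2 * of_real pi * \<i> * of_real m * ((of_int l)\<^sup>2 * \<tau> + 2 * of_int l * z))
               * \<phi> z \<tau>)) \<and>
     (\<forall>A\<in>carrier SL2Z. \<forall>r\<in>\<rat>. \<forall>s\<in>\<rat>.
        meromorphic_at_ii_inf
          (\<lambda>\<tau>. qpow (m * r\<^sup>2) \<tau> * jacobi_slash k m A \<phi> (of_real r * \<tau> + of_real s) \<tau>))"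

end

theory Submission
  imports Defs
begin

text \<open>
  Write \<open>(a)\<close> for the infinite product of the \<open>1 - a q^j\<close> and \<open>\<theta>(w) = (w) (q/w)\<close>. Telescoping gives
  \<open>g\<^sub>3(q w) = - w\<^sup>3 g\<^sub>3(w) - w - w\<^sup>2\<close>, and the inhomogeneous terms cancel in the sum over the cube
  roots of unity. That sum times \<open>\<theta>(w\<^sup>3; q\<^sup>3)\<close> is therefore an entire elliptic function of \<open>\<alpha>\<close>, hence
  constant, and at \<open>w = 1\<close> its value follows from Durfee's identity.

  The quotient \<open>\<Phi>\<close> of the theta function by \<open>\<eta>\<^sup>3\<close> is determined by its zeros, its quasi-periods and
  its derivative at \<open>0\<close>; comparing these data for \<open>\<tau>\<close> and \<open>A \<tau>\<close> proves the transformation law of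
  \<open>\<Phi>\<close> for every \<open>A\<close> in \<open>SL\<^sub>2(\<int>)\<close> at once, without generators and without Poisson summation. As
  \<open>\<eta>^(-6)\<close> is essentially the product of \<open>\<Phi>\<close> over the three half periods, \<open>\<eta>\<close> is modular as well.
  Everything else is read off from \<open>theta_quotient \<alpha> \<tau> = 3 / (\<eta>(\<tau>) \<Phi>(3 \<alpha>, 3 \<tau>))\<close>.
\<close>

section \<open>Infinite \<open>q\<close>-products\<close>

text \<open>The factor -w^3 does not change under w -> zeta3 w, while w + w^2 sums to zero over the
  three arguments; this singles out the sum over all cube roots. As division by zero yields 0 and
  \<open>g3\<close> has poles, functional equations are proved for numerators
  (\<open>g3_num\<close>, \<open>trisum_num\<close>), holomorphic for all w other than 0; quotients
  return only where the theta factors are nonzero. The theta function is given as a series, so the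
  triple product is needed to reach its zeros, and Durfee's identity serves a second time there.
  Half-integral powers are principal values, which are not multiplicative. Hence eta is treated
  through its 24th power, and continuity on the half plane then yields one 24th root of unity for
  each matrix. Weight: 1 / eta gives -1/2 and 1 / \<open>Phi\<close> gives 1. Index:
  \<open>Phi\<close> has index 1/2, and passing to (3 z, 3 \<tau>) multiplies it by 3. At torsion
  points \<open>Phi\<close> becomes a Klein form, whose exponential factor is q^(3 r^2 / 2) up to a
  constant; this is the origin of the normalising power in the theorem.\<close>

definition qinf :: "complex \<Rightarrow> complex \<Rightarrow> complex" where
  "qinf a q = (\<Prod>j. 1 - a * q ^ j)"

lemma abs_convergent_prod_qinf:
  assumes "norm q < 1"
  shows "abs_convergent_prod (\<lambda>j. 1 - a * q ^ j :: complex)"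
  unfolding abs_convergent_prod_conv_summable
  using assms by (auto simp: norm_mult norm_power intro!: summable_mult summable_geometric)

lemma has_prod_qinf:
  assumes "norm q < 1"
  shows "(\<lambda>j. 1 - a * q ^ j) has_prod qinf a q"
  unfolding qinf_def using abs_convergent_prod_qinf[OF assms]
  by (intro convergent_prod_has_prod abs_convergent_prod_imp_convergent_prod)

lemma qpoch_tendsto_qinf:
  assumes "norm q < 1"
  shows "(\<lambda>n. qpoch a q n) \<longlonglongrightarrow> qinf a q"
  using has_prod_imp_tendsto'[OF has_prod_qinf[OF assms, of a]] by (simp add: qpoch_def)

lemma qinf_0 [simp]: "qinf 0 q = 1"
  by (simp add: qinf_def)

lemma qpoch_Suc_shift: "qpoch a q (Suc n) = (1 - a) * qpoch (a * q) q n"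
  by (simp add: qpoch_def prod.lessThan_Suc_shift mult_ac del: prod.lessThan_Suc)

lemma qinf_rec:
  assumes "norm q < 1"
  shows "qinf a q = (1 - a) * qinf (a * q) q"
proof (rule LIMSEQ_unique)
  show "(\<lambda>n. qpoch a q (Suc n)) \<longlonglongrightarrow> qinf a q"
    using qpoch_tendsto_qinf[OF assms] by (rule LIMSEQ_Suc)
  show "(\<lambda>n. qpoch a q (Suc n)) \<longlonglongrightarrow> (1 - a) * qinf (a * q) q"
    unfolding qpoch_Suc_shift by (intro tendsto_intros qpoch_tendsto_qinf assms)
qed

lemma qinf_split:
  assumes "norm q < 1"
  shows "qinf a q = qpoch a q n * qinf (a * q ^ n) q"
proof (induction n)
  case 0
  show ?case by (simp add: qpoch_def)
next
  case (Suc n)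
  have "qinf (a * q ^ n) q = (1 - a * q ^ n) * qinf (a * q ^ Suc n) q"
    using qinf_rec[OF assms, of "a * q ^ n"] by (simp add: mult_ac)
  thus ?case using Suc by (simp add: qpoch_def mult_ac)
qed

text \<open>A convergent product in the sense of \<open>has_prod\<close> vanishes only through one
  of its factors. All zeros of theta functions below come from here.\<close>

lemma qinf_eq_0_iff:
  assumes "norm q < 1"
  shows "qinf a q = 0 \<longleftrightarrow> (\<exists>j. a * q ^ j = 1)"
  unfolding has_prod_eq_0_iff[OF has_prod_qinf[OF assms, of a]] image_iff
  by (metis UNIV_I right_minus_eq)

lemma qinf_nonzero:
  assumes "norm q < 1" "norm a < 1"
  shows "qinf a q \<noteq> 0"
proof
  assume "qinf a q = 0"
  then obtain j where "a * q ^ j = 1" by (auto simp: qinf_eq_0_iff assms)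
  hence "norm a * norm q ^ j = 1" by (metis norm_mult norm_one norm_power)
  moreover have "norm a * norm q ^ j \<le> norm a * 1"
    using assms by (intro mult_left_mono power_le_one) auto
  ultimately show False using assms by simp
qed

text \<open>From 1 + x <= exp x and the geometric series. Depending on a only through its norm, the
  bound is a uniform majorant for the terms of \<open>g3_num\<close> and of the Durfee sum.\<close>

lemma norm_qinf_le:
  assumes "norm q \<le> \<rho>" "\<rho> < 1"
  shows "norm (qinf a q) \<le> exp (norm a / (1 - \<rho>))"
proof -
  have q: "norm q < 1" and \<rho>: "0 \<le> \<rho>" using assms norm_ge_zero[of q] by linarith+
  show ?thesis
  proof (rule Lim_bounded[OF tendsto_norm[OF qpoch_tendsto_qinf[OF q]]])
    show "\<forall>n\<ge>0. norm (qpoch a q n) \<le> exp (norm a / (1 - \<rho>))"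
    proof (intro allI impI)
      fix n
      have "norm (qpoch a q n) = (\<Prod>j<n. norm (1 - a * q ^ j))"
        by (simp add: qpoch_def prod_norm)
      also have "\<dots> \<le> (\<Prod>j<n. 1 + norm a * \<rho> ^ j)"
      proof (intro prod_mono conjI norm_ge_zero)
        fix j
        have "norm (1 - a * q ^ j) \<le> 1 + norm a * norm q ^ j"
          using norm_triangle_ineq4[of 1 "a * q ^ j"] by (simp add: norm_mult norm_power)
        also have "\<dots> \<le> 1 + norm a * \<rho> ^ j"
          using assms by (intro add_left_mono mult_left_mono power_mono) auto
        finally show "norm (1 - a * q ^ j) \<le> 1 + norm a * \<rho> ^ j" .
      qed
      also have "\<dots> \<le> exp (\<Sum>j<n. norm a * \<rho> ^ j)"
        using \<rho> by (intro prod_le_exp_sum) auto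
      also have "(\<Sum>j<n. norm a * \<rho> ^ j) \<le> (\<Sum>j. norm a * \<rho> ^ j)"
        using \<rho> assms by (intro sum_le_suminf summable_mult summable_geometric) auto
      also have "\<dots> = norm a / (1 - \<rho>)"
        using \<rho> assms by (subst suminf_mult) (auto simp: suminf_geometric summable_geometric)
      finally show "norm (qpoch a q n) \<le> exp (norm a / (1 - \<rho>))" by simp
    qed
  qed
qed

text \<open>Argument and base may both vary: compactness bounds u and keeps the norm of v below a
  fixed \<rho> < 1, so B \<rho>^n is a majorant for the Weierstrass test. Holomorphy and joint
  continuity of \<open>qinf\<close> both rest on this.\<close>

lemma uniform_limit_qinf:
  assumes K: "compact K" and cu: "continuous_on K u" and cv: "continuous_on K v"
    and v: "\<And>x. x \<in> K \<Longrightarrow> norm (v x) < 1"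
  shows "uniform_limit K (\<lambda>N x. qpoch (u x) (v x) N) (\<lambda>x. qinf (u x) (v x)) sequentially"
proof (cases "K = {}")
  case False
  have "bounded (u ` K)"
    by (intro compact_imp_bounded compact_continuous_image cu K)
  then obtain B where B: "\<And>y. y \<in> K \<Longrightarrow> norm (u y) \<le> B"
    unfolding bounded_iff by blast
  obtain y0 where y0: "y0 \<in> K" "\<And>y. y \<in> K \<Longrightarrow> norm (v y) \<le> norm (v y0)"
    using continuous_attains_sup[OF K False continuous_on_norm[OF cv]] by blast
  define \<rho> where "\<rho> = norm (v y0)"
  have \<rho>: "0 \<le> \<rho>" "\<rho> < 1" using y0 v by (auto simp: \<rho>_def)
  have "uniformly_convergent_on K (\<lambda>N y. \<Prod>n<N. 1 - u y * v y ^ n)"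
  proof (rule uniformly_convergent_on_prod')
    show "uniformly_convergent_on K (\<lambda>N y. \<Sum>n<N. norm ((1 - u y * v y ^ n) - 1))"
    proof (rule Weierstrass_m_test')
      fix n y assume y: "y \<in> K"
      have "norm (u y) * norm (v y) ^ n \<le> B * \<rho> ^ n"
        using B[OF y] y0(2)[OF y] order_trans[OF norm_ge_zero B[OF y]] \<rho>
        by (intro mult_mono power_mono) (auto simp: \<rho>_def)
      thus "norm (norm (1 - u y * v y ^ n - 1)) \<le> B * \<rho> ^ n"
        by (simp add: norm_mult norm_power)
    qed (use \<rho> in \<open>auto intro!: summable_mult summable_geometric\<close>)
  qed (use K in \<open>auto intro!: continuous_intros cu cv\<close>)
  then obtain g where g: "uniform_limit K (\<lambda>N y. qpoch (u y) (v y) N) g sequentially"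
    by (auto simp: uniformly_convergent_on_def qpoch_def)
  have "g y = qinf (u y) (v y)" if "y \<in> K" for y
    using tendsto_uniform_limitI[OF g that] qpoch_tendsto_qinf[OF v[OF that], of "u y"]
      LIMSEQ_unique by blast
  thus ?thesis
    by (intro uniform_limit_cong'[THEN iffD1, OF refl _ g])
qed simp

lemma holomorphic_qinf [holomorphic_intros]:
  assumes "open D" "u holomorphic_on D" "v holomorphic_on D" "\<And>x. x \<in> D \<Longrightarrow> norm (v x) < 1"
  shows "(\<lambda>x. qinf (u x) (v x)) holomorphic_on D"
proof (rule holomorphic_uniform_sequence[OF assms(1)])
  show "(\<lambda>x. qpoch (u x) (v x) n) holomorphic_on D" for n
    unfolding qpoch_def by (intro holomorphic_intros assms)
  fix x assume x: "x \<in> D"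
  then obtain d where d: "d > 0" "cball x d \<subseteq> D"
    using assms(1) open_contains_cball by blast
  have "continuous_on (cball x d) u" and "continuous_on (cball x d) v"
    using assms d by (meson holomorphic_on_imp_continuous_on continuous_on_subset)+
  hence "uniform_limit (cball x d) (\<lambda>n x. qpoch (u x) (v x) n) (\<lambda>x. qinf (u x) (v x)) sequentially"
    using assms(4) d by (intro uniform_limit_qinf) auto
  with d show "\<exists>d>0. cball x d \<subseteq> D \<and>
      uniform_limit (cball x d) (\<lambda>n x. qpoch (u x) (v x) n) (\<lambda>x. qinf (u x) (v x)) sequentially"
    by blast
qed

text \<open>The type of x is general so that x may be a pair (z, \<tau>), as Osgood's lemma
  requires.\<close>

lemma continuous_on_qinf:
  fixes u v :: "'a :: heine_borel \<Rightarrow> complex"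
  assumes "open D" "continuous_on D u" "continuous_on D v" "\<And>x. x \<in> D \<Longrightarrow> norm (v x) < 1"
  shows "continuous_on D (\<lambda>x. qinf (u x) (v x))"
proof (rule continuous_at_imp_continuous_on, rule ballI)
  fix x assume x: "x \<in> D"
  then obtain d where d: "d > 0" "cball x d \<subseteq> D"
    using assms(1) open_contains_cball by blast
  have c: "continuous_on (cball x d) u" "continuous_on (cball x d) v"
    using assms d by (meson continuous_on_subset)+
  have "continuous_on (cball x d) (\<lambda>x. qinf (u x) (v x))"
  proof (rule uniform_limit_theorem)
    show "uniform_limit (cball x d) (\<lambda>n x. qpoch (u x) (v x) n) (\<lambda>x. qinf (u x) (v x)) sequentially"
      using assms(4) d c by (intro uniform_limit_qinf) auto
    show "\<forall>\<^sub>F n in sequentially. continuous_on (cball x d) (\<lambda>x. qpoch (u x) (v x) n)"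
      unfolding qpoch_def by (intro always_eventually allI continuous_intros c)
  qed simp
  hence "continuous_on (ball x d) (\<lambda>x. qinf (u x) (v x))"
    by (rule continuous_on_subset) auto
  thus "isCont (\<lambda>x. qinf (u x) (v x)) x"
    using d by (simp add: continuous_on_eq_continuous_at)
qed

lemma qinf_power_tendsto_1:
  assumes "norm q < 1"
  shows "(\<lambda>n. qinf (a * q ^ n) q) \<longlonglongrightarrow> 1"
proof -
  have "(\<lambda>a. qinf a q) holomorphic_on UNIV"
    using assms by (intro holomorphic_qinf holomorphic_intros) auto
  hence "isCont (\<lambda>a. qinf a q) 0"
    using continuous_on_eq_continuous_at[of UNIV] holomorphic_on_imp_continuous_on by auto
  moreover have "(\<lambda>n. a * q ^ n) \<longlonglongrightarrow> 0"
    using assms by (intro tendsto_mult_right_zero LIMSEQ_power_zero)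
  ultimately have "(\<lambda>n. qinf (a * q ^ n) q) \<longlonglongrightarrow> qinf 0 q"
    by (rule isCont_tendsto_compose)
  thus ?thesis by simp
qed

section \<open>The sum over the cube roots of unity\<close>

definition theta_prod :: "complex \<Rightarrow> complex \<Rightarrow> complex" where
  "theta_prod w q = qinf w q * qinf (q / w) q"

text \<open>Replacing w by q w removes the factor 1 - w from one product and adds 1 - 1/w to the
  other; the ratio of the two is -1/w.\<close>

lemma theta_prod_shift:
  assumes "norm q < 1" "q \<noteq> 0" "w \<noteq> 0"
  shows "theta_prod (q * w) q = - theta_prod w q / w"
proof -
  have "qinf w q = (1 - w) * qinf (q * w) q"
    using qinf_rec[OF assms(1), of w] by (simp add: mult_ac)
  hence 1: "theta_prod w q = (1 - w) * (qinf (q * w) q * qinf (q / w) q)"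
    by (simp add: theta_prod_def)
  have "q / (q * w) = 1 / w" using assms by simp
  hence 2: "theta_prod (q * w) q = (1 - 1 / w) * (qinf (q * w) q * qinf (q / w) q)"
    using qinf_rec[OF assms(1), of "1 / w"] by (simp add: theta_prod_def)
  show ?thesis
    unfolding 1 2 using assms by (simp add: field_simps)
qed

text \<open>The product of \<open>g3 w q\<close> and \<open>theta_prod w q\<close>, which has no poles for \<open>w \<noteq> 0\<close>.\<close>

definition g3_num :: "complex \<Rightarrow> complex \<Rightarrow> complex" where
  "g3_num w q = (\<Sum>n. q ^ (n * (n + 1)) * (qinf (w * q ^ (n + 1)) q * qinf (q / w * q ^ (n + 1)) q))"

lemma summable_norm_power_quadratic:
  fixes q :: "'a :: real_normed_div_algebra"
  assumes "norm q < 1"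
  shows "summable (\<lambda>n. norm q ^ (n * (n + 1)))"
proof (rule summable_comparison_test')
  show "summable (\<lambda>n. norm q ^ n)" using assms by (simp add: summable_geometric)
  show "norm (norm q ^ (n * (n + 1))) \<le> norm q ^ n" for n
    using assms by (auto intro!: power_decreasing)
qed

lemma norm_qinf_mult_power_le:
  assumes "norm q < 1" "norm a \<le> B"
  shows "norm (qinf (a * q ^ n) q) \<le> exp (B / (1 - norm q))"
proof -
  have "norm (a * q ^ n) \<le> norm a * 1"
    unfolding norm_mult norm_power using assms by (intro mult_left_mono power_le_one) auto
  hence "norm (a * q ^ n) / (1 - norm q) \<le> B / (1 - norm q)"
    using assms by (intro divide_right_mono) auto
  thus ?thesis using norm_qinf_le[of q "norm q" "a * q ^ n"] assms
    by (meson exp_le_cancel_iff order.trans order_refl)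
qed

lemma norm_g3_num_term_le:
  assumes "norm q < 1" "norm a \<le> A" "norm b \<le> B"
  shows "norm (q ^ (n * (n + 1)) * (qinf (a * q ^ (n + 1)) q * qinf (b * q ^ (n + 1)) q))
           \<le> exp (A / (1 - norm q)) * exp (B / (1 - norm q)) * norm q ^ (n * (n + 1))"
  unfolding norm_mult norm_power mult.commute[of "norm q ^ (n * (n + 1))"]
  by (intro mult_right_mono mult_mono norm_qinf_mult_power_le assms) auto

lemma summable_g3_num:
  assumes "norm q < 1"
  shows "summable (\<lambda>n. q ^ (n * (n + 1)) * (qinf (w * q ^ (n + 1)) q * qinf (q / w * q ^ (n + 1)) q))"
  by (rule summable_comparison_test'[OF _ norm_g3_num_term_le[OF assms order_refl order_refl]])
     (intro summable_mult summable_norm_power_quadratic assms)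

text \<open>By \<open>qinf_split\<close> each quotient by finite products turns into tails starting
  at q^(n+1). As the theta product is nonzero, no denominator of the series is zero.\<close>

lemma g3_times_theta_prod:
  assumes "norm q < 1" "theta_prod w q \<noteq> 0"
  shows "g3 w q * theta_prod w q = g3_num w q"
proof -
  let ?f = "\<lambda>n. q ^ (n * (n + 1)) * (qinf (w * q ^ (n + 1)) q * qinf (q / w * q ^ (n + 1)) q)"
  have "q ^ (n * (n + 1)) / (qpoch w q (n + 1) * qpoch (q / w) q (n + 1)) = ?f n / theta_prod w q" for n
    using assms(2) qinf_split[OF assms(1), of w "n + 1"] qinf_split[OF assms(1), of "q / w" "n + 1"]
    by (auto simp: theta_prod_def divide_simps)
  hence "g3 w q = (\<Sum>n. ?f n / theta_prod w q)" by (simp add: g3_def)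
  also have "\<dots> = g3_num w q / theta_prod w q"
    unfolding g3_num_def by (rule suminf_divide[OF summable_g3_num[OF assms(1)]])
  finally show ?thesis using assms by simp
qed

lemma holomorphic_g3_num:
  assumes q: "norm q < 1"
  shows "(\<lambda>w. g3_num w q) holomorphic_on - {0}"
proof (rule holomorphic_uniform_sequence)
  let ?f = "\<lambda>n w. q ^ (n * (n + 1)) * (qinf (w * q ^ (n + 1)) q * qinf (q / w * q ^ (n + 1)) q)"
  show "open (- {0::complex})" by auto
  show "(\<lambda>w. \<Sum>n<N. ?f n w) holomorphic_on - {0}" for N
    using q by (intro holomorphic_intros) auto
  fix w :: complex assume w: "w \<in> - {0}"
  \<comment> \<open>With this radius the closed disc avoids 0, and w and q / w stay bounded on it,
    by 3 d and norm q / d.\<close>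
  define d where "d = norm w / 2"
  have d: "d > 0" using w by (auto simp: d_def)
  have near: "norm y \<le> 3 * d \<and> norm y \<ge> d" if "y \<in> cball w d" for y
  proof -
    have "norm (w - y) \<le> d" using that by (simp add: dist_norm)
    thus ?thesis using norm_triangle_ineq2[of w y] norm_triangle_ineq3[of y w]
      by (auto simp: d_def norm_minus_commute)
  qed
  have bnd: "norm (?f n y) \<le> exp ((3 * d) / (1 - norm q)) * exp ((norm q / d) / (1 - norm q)) * norm q ^ (n * (n + 1))"
    if "y \<in> cball w d" for n y
    using near[OF that] d
    by (intro norm_g3_num_term_le q) (auto simp: norm_divide intro!: divide_left_mono mult_pos_pos)
  have "uniform_limit (cball w d) (\<lambda>N w. \<Sum>n<N. ?f n w) (\<lambda>w. \<Sum>n. ?f n w) sequentially"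
    by (rule Weierstrass_m_test, erule bnd) (intro summable_mult summable_norm_power_quadratic q)
  moreover have "cball w d \<subseteq> - {0}" using near[of 0] d by auto
  ultimately show "\<exists>d>0. cball w d \<subseteq> - {0} \<and>
      uniform_limit (cball w d) (\<lambda>N w. \<Sum>n<N. ?f n w) (\<lambda>w. g3_num w q) sequentially"
    unfolding g3_num_def using d by blast
qed

lemma power_quadratic_tendsto_0:
  fixes q :: complex
  assumes "norm q < 1"
  shows "(\<lambda>n. q ^ (n * (n + 1))) \<longlonglongrightarrow> 0"
  using summable_norm_power_quadratic[OF assms]
  by (intro summable_LIMSEQ_zero) (simp add: summable_norm_cancel norm_power)

text \<open>Division by \<open>theta_prod (q * w) q\<close> turns this into the functional equation
  of g3 quoted in the overview. The series telescopes term by term.\<close>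

lemma g3_num_shift:
  assumes q: "norm q < 1" "q \<noteq> 0" and w: "w \<noteq> 0"
  shows "g3_num (q * w) q = w\<^sup>2 * g3_num w q + (1 + w) * theta_prod w q"
proof -
  let ?f = "\<lambda>w n. q ^ (n * (n + 1)) * (qinf (w * q ^ (n + 1)) q * qinf (q / w * q ^ (n + 1)) q)"
  \<comment> \<open>The telescoping term mixes both sides: its first tail is that of
    \<open>?f w\<close>, its second that of \<open>?f (q * w)\<close>, and the factor 1 - w^2 makes
    \<open>step\<close> an identity. V tends to 0, and V 0 is the inhomogeneous term.\<close>
  define V where "V = (\<lambda>n. (1 - w\<^sup>2) * (q ^ (n * (n + 1)) * (qinf (w * q ^ (n + 1)) q * qinf (1 / w * q ^ (n + 1)) q)))"
  have step: "?f (q * w) n - w\<^sup>2 * ?f w n = V n - V (Suc n)" for n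
  proof -
    define x Q X Y where "x = q ^ (n + 1)" and "Q = q ^ (n * (n + 1))"
      and "X = qinf (w * (q * x)) q" and "Y = qinf (1 / w * (q * x)) q"
    have 1: "qinf (w * x) q = (1 - w * x) * X" "qinf (1 / w * x) q = (1 - 1 / w * x) * Y"
      using qinf_rec[OF q(1), of "w * x"] qinf_rec[OF q(1), of "1 / w * x"]
      by (simp_all add: X_def Y_def mult_ac)
    have 2: "q ^ (Suc n * (Suc n + 1)) = Q * x\<^sup>2"
      unfolding Q_def x_def power_mult[symmetric] power_add[symmetric]
      by (rule arg_cong[of _ _ "\<lambda>k. q ^ k"]) (simp add: algebra_simps)
    have 3: "q ^ (Suc n + 1) = q * x" by (simp add: x_def)
    have A: "?f (q * w) n = Q * (X * ((1 - 1 / w * x) * Y))"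
    proof -
      have "q * w * x = w * (q * x)" "q / (q * w) * x = 1 / w * x" using q by simp_all
      thus ?thesis unfolding x_def[symmetric] Q_def[symmetric] by (simp only: 1 X_def)
    qed
    have B: "?f w n = Q * ((1 - w * x) * X * Y)"
    proof -
      have "q / w * x = 1 / w * (q * x)" by simp
      thus ?thesis unfolding x_def[symmetric] Q_def[symmetric] by (simp only: 1 Y_def)
    qed
    have C: "V n = (1 - w\<^sup>2) * (Q * ((1 - w * x) * X * ((1 - 1 / w * x) * Y)))"
      unfolding V_def x_def[symmetric] Q_def[symmetric] 1 ..
    have D: "V (Suc n) = (1 - w\<^sup>2) * (Q * x\<^sup>2 * (X * Y))"
      unfolding V_def 2 3 X_def Y_def ..
    show ?thesis unfolding A B C D using w by (simp add: field_simps power2_eq_square)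
  qed
  have "V \<longlonglongrightarrow> (1 - w\<^sup>2) * (0 * (1 * 1))"
    unfolding V_def using q
    by (intro tendsto_intros power_quadratic_tendsto_0 LIMSEQ_Suc[OF qinf_power_tendsto_1, simplified Suc_eq_plus1])
  hence "(\<lambda>n. V n - V (Suc n)) sums (V 0 - 0)"
    by (intro telescope_sums') simp
  moreover have "(\<lambda>n. ?f (q * w) n - w\<^sup>2 * ?f w n) sums (g3_num (q * w) q - w\<^sup>2 * g3_num w q)"
    unfolding g3_num_def by (intro sums_diff sums_mult summable_sums summable_g3_num q)
  ultimately have "g3_num (q * w) q - w\<^sup>2 * g3_num w q = V 0"
    unfolding step using sums_unique2 by fastforce
  also have "V 0 = (1 + w) * theta_prod w q"
    unfolding V_def theta_prod_def qinf_rec[OF q(1), of w] by (simp add: power2_eq_square algebra_simps)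
  finally show ?thesis by (simp add: algebra_simps)
qed

text \<open>Dividing D z by (q) (z q) gives Cauchy's sum of q^(n^2) z^n / ((q)_n (z q)_n), whose
  value 1 / (z q) is classically obtained from Durfee squares. Here invariance under z -> z q takes
  the place of the partition count, and it follows by telescoping.\<close>

lemma qinf_durfee_shift:
  assumes q: "norm q < 1" and z: "norm z \<le> 1"
  defines "D \<equiv> (\<lambda>z. \<Sum>n. q ^ (n * n) * z ^ n * (qinf (q * q ^ n) q * qinf (z * q * q ^ n) q))"
  shows "summable (\<lambda>n. q ^ (n * n) * z ^ n * (qinf (q * q ^ n) q * qinf (z * q * q ^ n) q))" (is ?A)
    and "D z = D (z * q)"
proof -
  let ?f = "\<lambda>z n. q ^ (n * n) * z ^ n * (qinf (q * q ^ n) q * qinf (z * q * q ^ n) q)"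
  have sm: "summable (?f z)" if z: "norm z \<le> 1" for z
  proof (rule summable_comparison_test')
    have "summable (\<lambda>n. norm q ^ n)" using q by (simp add: summable_geometric)
    thus "summable (\<lambda>n. norm q ^ n * (exp (1 / (1 - norm q)) * exp (1 / (1 - norm q))))"
      by (rule summable_mult2)
    show "norm (?f z n) \<le> norm q ^ n * (exp (1 / (1 - norm q)) * exp (1 / (1 - norm q)))" for n
    proof -
      have "norm (q ^ (n * n) * z ^ n) \<le> norm q ^ n * 1"
        unfolding norm_mult norm_power using q z
        by (intro mult_mono power_decreasing power_le_one) auto
      moreover have "norm (z * q) \<le> 1 * 1"
        unfolding norm_mult using q z by (intro mult_mono) auto
      ultimately show ?thesis using q unfolding norm_mult[of "q ^ (n * n) * z ^ n"] norm_mult[of "qinf _ _"]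
        by (intro mult_mono norm_qinf_mult_power_le) auto
    qed
  qed
  show ?A using sm z .
  \<comment> \<open>W 0 vanishes because of the factor 1 - q^n, so the telescoped difference of D z
    and D (z q) is zero.\<close>
  define W where "W = (\<lambda>n. (1 - q ^ n) * ?f z n)"
  have step: "?f z n - ?f (z * q) n = W n - W (Suc n)" for n
  proof -
    define x c X Z where "x = q ^ n" and "c = q ^ (n * n) * z ^ n"
      and "X = qinf (q * (q * x)) q" and "Z = qinf (z * q * (q * x)) q"
    have 1: "qinf (q * x) q = (1 - q * x) * X" "qinf (z * q * x) q = (1 - z * q * x) * Z"
      using qinf_rec[OF q(1), of "q * x"] qinf_rec[OF q(1), of "z * q * x"]
      by (simp_all add: X_def Z_def mult_ac)
    have 2: "q ^ (Suc n * Suc n) * z ^ Suc n = c * q * x\<^sup>2 * z"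
      unfolding c_def x_def by (simp add: power_add power_mult power2_eq_square)
    have 3: "q ^ Suc n = q * x" by (simp add: x_def)
    have A: "?f z n = c * ((1 - q * x) * X * ((1 - z * q * x) * Z))"
      unfolding x_def[symmetric] c_def[symmetric] 1 ..
    have "q ^ (n * n) * (z * q) ^ n = c * x" by (simp add: c_def x_def power_mult_distrib)
    moreover have "z * q * q * x = z * q * (q * x)" by simp
    ultimately have B: "?f (z * q) n = c * x * ((1 - q * x) * X * Z)"
      unfolding x_def[symmetric] 1 Z_def by (simp only:)
    have C: "W n = (1 - x) * (c * ((1 - q * x) * X * ((1 - z * q * x) * Z)))"
      unfolding W_def x_def[symmetric] c_def[symmetric] 1 ..
    have D: "W (Suc n) = (1 - q * x) * (c * q * x\<^sup>2 * z * (X * Z))"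
      unfolding W_def 2 3 X_def Z_def by (simp add: mult_ac)
    show ?thesis unfolding A B C D by (simp add: algebra_simps power2_eq_square)
  qed
  have "W \<longlonglongrightarrow> (1 - 0) * 0"
    unfolding W_def using q z by (intro tendsto_intros summable_LIMSEQ_zero sm LIMSEQ_power_zero)
  hence "(\<lambda>n. W n - W (Suc n)) sums (W 0 - 0)"
    by (intro telescope_sums') simp
  moreover have "norm (z * q) \<le> 1"
    using mult_mono[of "norm z" 1 "norm q" 1] q z by (simp add: norm_mult)
  hence "(\<lambda>n. ?f z n - ?f (z * q) n) sums (D z - D (z * q))"
    unfolding D_def using z by (intro sums_diff summable_sums sm)
  ultimately have "D z - D (z * q) = W 0"
    unfolding step using sums_unique2 by fastforce
  thus "D z = D (z * q)" by (simp add: W_def)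
qed

text \<open>The sum does not depend on \<open>k\<close>; its value is the limit as \<open>k\<close> tends to infinity.\<close>

lemma qinf_durfee:
  assumes q: "norm q < 1"
  shows "(\<Sum>n. q ^ (n * n) * (q ^ k) ^ n * (qinf (q * q ^ n) q * qinf (q ^ k * q * q ^ n) q)) = qinf q q"
proof -
  define f where "f = (\<lambda>n k. q ^ (n * n) * (q ^ k) ^ n * (qinf (q * q ^ n) q * qinf (q ^ k * q * q ^ n) q))"
  have const: "(\<Sum>n. f n k) = (\<Sum>n. f n 0)" for k
  proof (induction k)
    case (Suc k)
    have "norm (q ^ k) \<le> 1" for k
      unfolding norm_power using q by (intro power_le_one) auto
    from qinf_durfee_shift(2)[OF q this[of k]] Suc show ?case
      by (simp add: f_def mult_ac)
  qed simp
  \<comment> \<open>A majorant free of k, as Tannery's theorem requires for k tending to infinity;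
    in the limit only the term n = 0 survives.\<close>
  define M where "M = (\<lambda>n. norm q ^ n * (exp (1 / (1 - norm q)) * exp (1 / (1 - norm q))))"
  have bnd: "norm (f n k) \<le> M n" for n k
  proof -
    have "norm (q ^ (n * n) * (q ^ k) ^ n) \<le> norm q ^ n * 1"
      unfolding norm_mult norm_power using q
      by (intro mult_mono power_decreasing power_le_one) auto
    moreover have "norm (q ^ k * q) \<le> 1 * 1"
      unfolding norm_mult norm_power using q by (intro mult_mono power_le_one) auto
    ultimately show ?thesis
      using q unfolding f_def M_def norm_mult[of "q ^ (n * n) * (q ^ k) ^ n"] norm_mult[of "qinf _ _"]
      by (intro mult_mono norm_qinf_mult_power_le) auto
  qed
  have lim: "(\<lambda>k. f n k) \<longlonglongrightarrow> (if n = 0 then qinf q q else 0)" for n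
  proof -
    have "(\<lambda>k. qinf (q * q ^ n * q ^ k) q) \<longlonglongrightarrow> 1"
      by (intro qinf_power_tendsto_1 q)
    hence 1: "(\<lambda>k. qinf (q ^ k * q * q ^ n) q) \<longlonglongrightarrow> 1" by (simp add: mult_ac)
    have 2: "(\<lambda>k. (q ^ k) ^ n) \<longlonglongrightarrow> (if n = 0 then 1 else 0)"
    proof (cases "n = 0")
      case False
      have "(\<lambda>k. (q ^ k) ^ n) \<longlonglongrightarrow> 0 ^ n"
        by (intro tendsto_power LIMSEQ_power_zero q)
      thus ?thesis using False by (simp add: power_0_left)
    qed simp
    have "(\<lambda>k. f n k) \<longlonglongrightarrow> q ^ (n * n) * (if n = 0 then 1 else 0) * (qinf (q * q ^ n) q * 1)"
      unfolding f_def by (intro tendsto_intros 1 2)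
    thus ?thesis by (auto split: if_splits)
  qed
  have "summable M" unfolding M_def using q by (intro summable_mult2 summable_geometric) auto
  hence "(\<lambda>k. \<Sum>n. f n k) \<longlonglongrightarrow> (\<Sum>n. if n = 0 then qinf q q else 0)"
    using tannerys_theorem[where a = f and M = M and F = sequentially, OF lim] bnd
    by (simp add: case_prod_unfold)
  moreover have "(\<lambda>k. \<Sum>n. f n k) = (\<lambda>k. \<Sum>n. f n 0)" using const by blast
  ultimately have "(\<Sum>n. f n 0) = (\<Sum>n. if n = 0 then qinf q q else 0)"
    by (simp add: LIMSEQ_const_iff)
  also have "\<dots> = qinf q q" by (subst suminf_finite[of "{0}"]) auto
  finally show ?thesis using const[of k] by (simp add: f_def)
qed

text \<open>The case k = 1 of the Durfee sum: q^(n^2) q^n is the power of q in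
  \<open>g3_num\<close>.\<close>

lemma g3_num_1:
  assumes "norm q < 1"
  shows "g3_num 1 q = qinf q q"
  using qinf_durfee[OF assms, of 1] by (simp add: g3_num_def power_add mult_ac)

section \<open>Symmetrisation over the cube roots of unity\<close>

lemma zeta3_facts: "zeta3 ^ 3 = 1" "zeta3\<^sup>2 + zeta3 + 1 = 0" "zeta3 \<noteq> 0" "1 / zeta3 = zeta3\<^sup>2"
proof -
  show 1: "zeta3 ^ 3 = 1"
    unfolding zeta3_def exp_of_nat_mult[symmetric] using exp_two_pi_i by (simp add: mult_ac)
  show 0: "zeta3 \<noteq> 0" by (simp add: zeta3_def)
  thus "1 / zeta3 = zeta3\<^sup>2" using 1 by (simp add: field_simps power3_eq_cube power2_eq_square)
  have "zeta3 \<noteq> 1"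
  proof
    assume "zeta3 = 1"
    hence "Re (exp (\<i> * of_real (2 * pi / 3))) = 1" by (simp add: zeta3_def mult_ac)
    hence "cos (2 * pi / 3) = 1" by (simp add: Re_exp)
    thus False using cos_120 by simp
  qed
  moreover have "(zeta3 - 1) * (zeta3\<^sup>2 + zeta3 + 1) = 0"
    using 1 by (simp add: algebra_simps power3_eq_cube power2_eq_square)
  ultimately show "zeta3\<^sup>2 + zeta3 + 1 = 0" by simp
qed

text \<open>Factor by factor, (1 - x) (1 - zeta3 x) (1 - zeta3^2 x) = 1 - x^3.\<close>

lemma qinf_cube:
  assumes q: "norm q < 1"
  shows "qinf a q * qinf (zeta3 * a) q * qinf (zeta3\<^sup>2 * a) q = qinf (a ^ 3) (q ^ 3)"
proof (rule LIMSEQ_unique)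
  have q3: "norm (q ^ 3) < 1" using q by (simp add: norm_power power_less_one_iff)
  show "(\<lambda>n. qpoch (a ^ 3) (q ^ 3) n) \<longlonglongrightarrow> qinf (a ^ 3) (q ^ 3)"
    by (rule qpoch_tendsto_qinf[OF q3])
  have cube: "(1 - x) * (1 - zeta3 * x) * (1 - zeta3\<^sup>2 * x) = 1 - x ^ 3" for x
    using zeta3_facts by algebra
  have "qpoch a q n * qpoch (zeta3 * a) q n * qpoch (zeta3\<^sup>2 * a) q n = qpoch (a ^ 3) (q ^ 3) n" for n
    unfolding qpoch_def prod.distrib[symmetric] using cube[of "a * q ^ _"]
    by (intro prod.cong) (simp_all add: mult_ac power_mult_distrib flip: power_mult)
  moreover have "(\<lambda>n. qpoch a q n * qpoch (zeta3 * a) q n * qpoch (zeta3\<^sup>2 * a) q n)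
      \<longlonglongrightarrow> qinf a q * qinf (zeta3 * a) q * qinf (zeta3\<^sup>2 * a) q"
    by (intro tendsto_intros qpoch_tendsto_qinf q)
  ultimately show "(\<lambda>n. qpoch (a ^ 3) (q ^ 3) n) \<longlonglongrightarrow> qinf a q * qinf (zeta3 * a) q * qinf (zeta3\<^sup>2 * a) q"
    by simp
qed

lemma theta_prod_cube:
  assumes q: "norm q < 1" and w: "w \<noteq> 0"
  shows "theta_prod w q * theta_prod (zeta3 * w) q * theta_prod (zeta3\<^sup>2 * w) q = theta_prod (w ^ 3) (q ^ 3)"
proof -
  have "q / (zeta3 * w) = zeta3\<^sup>2 * (q / w)" "q / (zeta3\<^sup>2 * w) = zeta3 * (q / w)"
    using w zeta3_facts by (simp_all add: field_simps power3_eq_cube power2_eq_square)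
  thus ?thesis
    unfolding theta_prod_def power_divide[symmetric] qinf_cube[OF q, symmetric] by (simp add: mult_ac)
qed

text \<open>The three values of \<open>g3\<close> over their common denominator, which by
  \<open>theta_prod_cube\<close> is \<open>theta_prod (w ^ 3) (q ^ 3)\<close>. Unlike the sum itself
  it is holomorphic for all w other than 0.\<close>

definition trisum_num :: "complex \<Rightarrow> complex \<Rightarrow> complex" where
  "trisum_num w q =
     g3_num w q * theta_prod (zeta3 * w) q * theta_prod (zeta3\<^sup>2 * w) q +
     g3_num (zeta3 * w) q * theta_prod (zeta3\<^sup>2 * w) q * theta_prod w q +
     g3_num (zeta3\<^sup>2 * w) q * theta_prod w q * theta_prod (zeta3 * w) q"

lemma trisum_num_shift:
  assumes q: "norm q < 1" "q \<noteq> 0" and w: "w \<noteq> 0"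
  shows "trisum_num (q * w) q = trisum_num w q"
proof -
  define z where "z = zeta3"
  have z: "z ^ 3 = 1" "z\<^sup>2 + z + 1 = 0" "z \<noteq> 0" using zeta3_facts by (simp_all add: z_def)
  have 1: "zeta3 * (q * w) = q * (z * w)" "zeta3\<^sup>2 * (q * w) = q * (z\<^sup>2 * w)" by (simp_all add: z_def)
  define k0 k1 k2 t0 t1 t2 where "k0 = g3_num w q" and "k1 = g3_num (z * w) q" and "k2 = g3_num (z\<^sup>2 * w) q"
    and "t0 = theta_prod w q" and "t1 = theta_prod (z * w) q" and "t2 = theta_prod (z\<^sup>2 * w) q"
  note kt = k0_def k1_def k2_def t0_def t1_def t2_def
  have L: "trisum_num (q * w) q = (w\<^sup>2 * k0 + (1 + w) * t0) * (- t1 / (z * w)) * (- t2 / (z\<^sup>2 * w)) +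
      ((z * w)\<^sup>2 * k1 + (1 + z * w) * t1) * (- t2 / (z\<^sup>2 * w)) * (- t0 / w) +
      ((z\<^sup>2 * w)\<^sup>2 * k2 + (1 + z\<^sup>2 * w) * t2) * (- t0 / w) * (- t1 / (z * w))"
    unfolding trisum_num_def 1
    using q w z by (simp add: g3_num_shift theta_prod_shift kt)
  have inv: "1 / z = z\<^sup>2" using z by (simp add: field_simps power3_eq_cube power2_eq_square)
  \<comment> \<open>Writing v for 1 / w makes the remaining identity polynomial, subject to v w =
    1.\<close>
  define v where "v = 1 / w"
  have v: "v * w = 1" using w by (simp add: v_def)
  have "t1 / (z * w) = z\<^sup>2 * v * t1" "t2 / (z\<^sup>2 * w) = z * v * t2" "t0 / w = v * t0"
    using z w by (simp_all add: v_def field_simps power3_eq_cube power2_eq_square)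
  hence "trisum_num (q * w) q = (w\<^sup>2 * k0 + (1 + w) * t0) * (- (z\<^sup>2 * v * t1)) * (- (z * v * t2)) +
      ((z * w)\<^sup>2 * k1 + (1 + z * w) * t1) * (- (z * v * t2)) * (- (v * t0)) +
      ((z\<^sup>2 * w)\<^sup>2 * k2 + (1 + z\<^sup>2 * w) * t2) * (- (v * t0)) * (- (z\<^sup>2 * v * t1))"
    unfolding L by (simp only: minus_divide_left[symmetric])
  also have "\<dots> = k0 * t1 * t2 + k1 * t2 * t0 + k2 * t0 * t1"
  proof -
    have "(w\<^sup>2 * k0 + (1 + w) * t0) * (- (z\<^sup>2 * v * t1)) * (- (z * v * t2)) +
        ((z * w)\<^sup>2 * k1 + (1 + z * w) * t1) * (- (z * v * t2)) * (- (v * t0)) +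
        ((z\<^sup>2 * w)\<^sup>2 * k2 + (1 + z\<^sup>2 * w) * t2) * (- (v * t0)) * (- (z\<^sup>2 * v * t1))
      = z ^ 3 * (v * w)\<^sup>2 * (k0 * t1 * t2 + k1 * t2 * t0 + z ^ 3 * (k2 * t0 * t1)) +
        v\<^sup>2 * (t0 * t1 * t2) * (z ^ 3 * (1 + w) + z + z\<^sup>2 * w + z\<^sup>2 + z ^ 3 * z * w)"
      by (simp add: algebra_simps power2_eq_square power3_eq_cube)
    \<comment> \<open>Every inhomogeneous term carries the same product t0 t1 t2; their coefficients
      add up to a multiple of 1 + z + z^2 = 0.\<close>
    also have "z ^ 3 * (1 + w) + z + z\<^sup>2 * w + z\<^sup>2 + z ^ 3 * z * w = (z\<^sup>2 + z + 1) * (1 + w)"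
      unfolding z(1) by (simp add: algebra_simps)
    finally show ?thesis unfolding z v by simp
  qed
  also have "\<dots> = trisum_num w q"
    unfolding trisum_num_def kt z_def ..
  finally show ?thesis .
qed

section \<open>Liouville's theorem for doubly periodic functions\<close>

lemma periodic_of_int:
  fixes f :: "complex \<Rightarrow> 'a"
  assumes "\<And>z. f (z + p) = f z"
  shows "f (z + of_int n * p) = f z"
proof (induction n rule: int_induct[where k = 0])
  case (step1 i)
  thus ?case using assms[of "z + of_int i * p"] by (simp add: algebra_simps)
next
  case (step2 i)
  thus ?case using assms[of "z + of_int (i - 1) * p"] by (simp add: algebra_simps)
qed simp

lemma lattice_coordinates:
  assumes "Im \<tau> > 0"
  obtains x y :: real where "z = of_real x + of_real y * \<tau>"
proof
  show "z = of_real (Re z - Im z / Im \<tau> * Re \<tau>) + of_real (Im z / Im \<tau>) * \<tau>"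
    using assms by (simp add: complex_eq_iff)
qed

text \<open>All values are already taken on the compact period parallelogram, so f is
  bounded.\<close>

lemma doubly_periodic_entire_constant:
  assumes \<tau>: "Im \<tau> > 0" and f: "f holomorphic_on UNIV"
    and per: "\<And>z. f (z + 1) = f z" "\<And>z. f (z + \<tau>) = f z"
  shows "f z = f 0"
proof -
  define P where "P = (\<lambda>(x, y). complex_of_real x + of_real y * \<tau>) ` ({0..1} \<times> {0..1})"
  have "compact P" unfolding P_def
    by (intro compact_continuous_image compact_Times)
       (auto intro!: continuous_intros simp: case_prod_unfold)
  moreover have "continuous_on P f"
    using f holomorphic_on_imp_continuous_on continuous_on_subset by blast
  ultimately have "bounded (f ` P)"
    by (intro compact_imp_bounded compact_continuous_image)
  moreover have "range f \<subseteq> f ` P"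
  proof safe
    fix z
    obtain x y where z: "z = of_real x + of_real y * \<tau>" using lattice_coordinates[OF \<tau>] .
    have "f z = f (of_real (frac x) + of_real (frac y) * \<tau> + of_int \<lfloor>y\<rfloor> * \<tau> + of_int \<lfloor>x\<rfloor> * 1)"
      by (rule arg_cong[of _ _ f]) (simp add: z frac_def algebra_simps)
    also have "\<dots> = f (of_real (frac x) + of_real (frac y) * \<tau>)"
      by (simp only: periodic_of_int[of f, OF per(1)] periodic_of_int[of f, OF per(2)])
    finally have "f z = f (of_real (frac x) + of_real (frac y) * \<tau>)" .
    moreover have "of_real (frac x) + of_real (frac y) * \<tau> \<in> P"
      unfolding P_def using frac_lt_1[of x] frac_lt_1[of y]
      by (intro image_eqI[of _ _ "(frac x, frac y)"]) auto
    ultimately show "f z \<in> f ` P" by blast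
  qed
  ultimately have "bounded (range f)" using bounded_subset by blast
  from Liouville_theorem[OF f this] show ?thesis
    unfolding constant_on_def by (metis UNIV_I)
qed

lemma holomorphic_theta_prod [holomorphic_intros]:
  assumes "open D" "u holomorphic_on D" "v holomorphic_on D"
    and "\<And>x. x \<in> D \<Longrightarrow> norm (v x) < 1" "\<And>x. x \<in> D \<Longrightarrow> u x \<noteq> 0"
  shows "(\<lambda>x. theta_prod (u x) (v x)) holomorphic_on D"
  unfolding theta_prod_def using assms by (intro holomorphic_intros) auto

text \<open>Constancy in w reduces the claim to w = 1. The extra factor \<open>qinf q q\<close>
  completes the square of the three products to which \<open>qinf_cube\<close> applies.\<close>

lemma trisum_num_eq:
  assumes \<tau>: "Im \<tau> > 0" and q: "q = exp (2 * of_real pi * \<i> * \<tau>)" and w: "w \<noteq> 0"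
  shows "trisum_num w q * qinf q q = 3 * (qinf (q ^ 3) (q ^ 3))\<^sup>2"
proof -
  have nq: "norm q < 1" using \<tau> by (simp add: q)
  have q0: "q \<noteq> 0" by (simp add: q)
  define f where "f = (\<lambda>z. trisum_num (exp (2 * of_real pi * \<i> * z)) q)"
  have hol: "(\<lambda>z. g3_num (c * exp (2 * of_real pi * \<i> * z)) q) holomorphic_on UNIV" if "c \<noteq> 0" for c
  proof -
    have "(\<lambda>w. g3_num w q) \<circ> (\<lambda>z. c * exp (2 * of_real pi * \<i> * z)) holomorphic_on UNIV"
      by (rule holomorphic_on_compose_gen[OF _ holomorphic_g3_num[OF nq]])
         (use that in \<open>auto intro!: holomorphic_intros\<close>)
    thus ?thesis by (simp add: o_def)
  qed
  have "f holomorphic_on UNIV"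
    unfolding f_def trisum_num_def using nq zeta3_facts hol[of 1] hol[of zeta3] hol[of "zeta3\<^sup>2"]
    by (intro holomorphic_intros) auto
  moreover have "f (z + 1) = f z" for z
    by (simp add: f_def ring_distribs exp_add exp_two_pi_i mult_ac)
  moreover have "f (z + \<tau>) = f z" for z
  proof -
    have "f (z + \<tau>) = trisum_num (q * exp (2 * of_real pi * \<i> * z)) q"
      by (simp add: f_def ring_distribs exp_add q mult_ac)
    thus ?thesis using trisum_num_shift[OF nq q0] by (simp add: f_def)
  qed
  ultimately have const: "f z = f 0" for z
    using doubly_periodic_entire_constant[OF \<tau>] by blast
  have "trisum_num w q = f (Ln w / (2 * of_real pi * \<i>))"
    using w by (simp add: f_def)
  also have "\<dots> = trisum_num 1 q" using const[of "Ln w / (2 * of_real pi * \<i>)"] by (simp add: f_def)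
  \<comment> \<open>Two of the three summands contain \<open>theta_prod 1 q\<close>, which is
    0.\<close>
  also have "trisum_num 1 q = qinf q q * (theta_prod zeta3 q * theta_prod (zeta3\<^sup>2) q)"
  proof -
    have "theta_prod 1 q = 0" using qinf_rec[OF nq, of 1] by (simp add: theta_prod_def)
    thus ?thesis by (simp add: trisum_num_def g3_num_1 nq)
  qed
  also have "theta_prod zeta3 q * theta_prod (zeta3\<^sup>2) q = 3 * (qinf (zeta3 * q) q * qinf (zeta3\<^sup>2 * q) q)\<^sup>2"
  proof -
    have "theta_prod zeta3 q = (1 - zeta3) * qinf (zeta3 * q) q * qinf (zeta3\<^sup>2 * q) q"
    proof -
      have e: "q / zeta3 = zeta3\<^sup>2 * q" using zeta3_facts(4) by (metis divide_inverse inverse_eq_divide mult.commute)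
      show ?thesis unfolding theta_prod_def e using qinf_rec[OF nq, of zeta3] by simp
    qed
    moreover have "q / zeta3\<^sup>2 = zeta3 * q"
      using zeta3_facts by (simp add: field_simps power2_eq_square power3_eq_cube)
    hence "theta_prod (zeta3\<^sup>2) q = (1 - zeta3\<^sup>2) * qinf (zeta3\<^sup>2 * q) q * qinf (zeta3 * q) q"
      using qinf_rec[OF nq, of "zeta3\<^sup>2"] by (simp add: theta_prod_def)
    ultimately have "theta_prod zeta3 q * theta_prod (zeta3\<^sup>2) q
        = ((1 - zeta3) * (1 - zeta3\<^sup>2)) * (qinf (zeta3 * q) q * qinf (zeta3\<^sup>2 * q) q)\<^sup>2"
      by (simp only: power2_eq_square mult_ac)
    \<comment> \<open>The origin of the 3 in the theorem: the value of x^2 + x + 1 = (x - zeta3) (x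
      - zeta3^2) at x = 1.\<close>
    also have "(1 - zeta3) * (1 - zeta3\<^sup>2) = 3" using zeta3_facts by algebra
    finally show ?thesis .
  qed
  finally have "trisum_num w q * qinf q q = 3 * (qinf q q * qinf (zeta3 * q) q * qinf (zeta3\<^sup>2 * q) q)\<^sup>2"
    by (simp add: power2_eq_square)
  thus ?thesis unfolding qinf_cube[OF nq] .
qed

lemma g3_trisum_product:
  assumes \<tau>: "Im \<tau> > 0" and q: "q = exp (2 * of_real pi * \<i> * \<tau>)" and w: "w \<noteq> 0"
    and nz: "theta_prod (w ^ 3) (q ^ 3) \<noteq> 0"
  shows "(g3 w q + g3 (zeta3 * w) q + g3 (zeta3\<^sup>2 * w) q) * (theta_prod (w ^ 3) (q ^ 3) * qinf q q)
           = 3 * (qinf (q ^ 3) (q ^ 3))\<^sup>2"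
proof -
  have nq: "norm q < 1" using \<tau> by (simp add: q)
  note cube = theta_prod_cube[OF nq w]
  have nz: "theta_prod w q \<noteq> 0" "theta_prod (zeta3 * w) q \<noteq> 0" "theta_prod (zeta3\<^sup>2 * w) q \<noteq> 0"
    using nz unfolding cube[symmetric] by auto
  have "(g3 w q + g3 (zeta3 * w) q + g3 (zeta3\<^sup>2 * w) q) * theta_prod (w ^ 3) (q ^ 3) = trisum_num w q"
    unfolding cube[symmetric] trisum_num_def using nz[THEN g3_times_theta_prod[OF nq], symmetric]
    by (simp add: algebra_simps)
  thus ?thesis using trisum_num_eq[OF \<tau> q w] by (simp add: mult_ac)
qed

section \<open>The Jacobi triple product\<close>

lemma Suc_choose_2: "Suc n choose 2 = (n choose 2) + n"
  by (simp add: numeral_2_eq_2)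

text \<open>Euler's coefficients of \<open>qinf w q\<close> as a power series in w. The recursion
  \<open>euler_coeff_Suc\<close> is what comparing coefficients in \<open>qinf_rec\<close>
  gives.\<close>

definition euler_coeff :: "complex \<Rightarrow> nat \<Rightarrow> complex" where
  "euler_coeff q n = (-1) ^ n * q ^ (n choose 2) / qpoch q q n"

lemma qpoch_self_nonzero:
  assumes "norm q < 1"
  shows "qpoch q q n \<noteq> 0"
  using qinf_split[OF assms, of q n] qinf_nonzero[OF assms assms] by auto

lemma euler_coeff_Suc:
  assumes "norm q < 1"
  shows "euler_coeff q (Suc n) * (1 - q ^ Suc n) = - euler_coeff q n * q ^ n"
proof -
  have 1: "qpoch q q (Suc n) = qpoch q q n * (1 - q ^ Suc n)"
    by (simp add: qpoch_def)
  have nz: "qpoch q q (Suc n) \<noteq> 0" "qpoch q q n \<noteq> 0" by (intro qpoch_self_nonzero assms)+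
  hence "1 - q ^ Suc n \<noteq> 0" unfolding 1 by auto
  with nz(2) show ?thesis
    unfolding euler_coeff_def 1 by (simp add: Suc_choose_2 power_add)
qed

lemma summable_norm_euler:
  assumes q: "norm q < 1"
  shows "summable (\<lambda>n. norm (euler_coeff q n * w ^ n))"
proof -
  \<comment> \<open>Up to sign the ratio of consecutive terms; it tends to 0, so the series
    converges for every w.\<close>
  define r where "r = (\<lambda>n. q ^ n * w / (1 - q ^ Suc n))"
  have "r \<longlonglongrightarrow> 0 * w / (1 - 0)"
    unfolding r_def using q by (intro tendsto_intros LIMSEQ_power_zero LIMSEQ_Suc[OF LIMSEQ_power_zero]) auto
  hence "(\<lambda>n. norm (r n)) \<longlonglongrightarrow> 0" by (intro tendsto_norm_zero) simp
  hence "eventually (\<lambda>n. norm (r n) < 1 / 2) sequentially"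
    by (rule order_tendstoD) simp
  then obtain N where N: "\<And>n. n \<ge> N \<Longrightarrow> norm (r n) < 1 / 2"
    by (auto simp: eventually_sequentially)
  show ?thesis
  proof (rule summable_norm_cancel, rule summable_ratio_test)
    show "(1 / 2 :: real) < 1" by simp
    fix n assume n: "n \<ge> N"
    have "norm (q ^ Suc n) < 1" unfolding norm_power
      using q power_decreasing[of 1 "Suc n" "norm q"] by simp
    hence "1 - q ^ Suc n \<noteq> 0" by auto
    hence "euler_coeff q (Suc n) * w ^ Suc n = - r n * (euler_coeff q n * w ^ n)"
      using euler_coeff_Suc[OF q, of n] by (simp add: r_def divide_simps) (simp add: mult_ac)
    hence "norm (euler_coeff q (Suc n) * w ^ Suc n) = norm (r n) * norm (euler_coeff q n * w ^ n)"
      by (simp only: norm_mult norm_minus_cancel)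
    also have "\<dots> \<le> 1 / 2 * norm (euler_coeff q n * w ^ n)"
      using N[OF n] by (intro mult_right_mono) auto
    finally show "norm (norm (norm (euler_coeff q (Suc n) * w ^ Suc n))) \<le> 1 / 2 * norm (norm (norm (euler_coeff q n * w ^ n)))"
      by simp
  qed
qed

text \<open>The series obeys the same functional equation as \<open>qinf\<close>. Iterating it sends
  the argument to 0, where the series is continuous with value 1.\<close>

lemma euler_qinf_sums:
  assumes q: "norm q < 1"
  shows "(\<lambda>n. euler_coeff q n * w ^ n) sums qinf w q"
proof -
  define E where "E = (\<lambda>w. \<Sum>n. euler_coeff q n * w ^ n)"
  have sm: "summable (\<lambda>n. euler_coeff q n * w ^ n)" for w
    using summable_norm_euler[OF q] by (rule summable_norm_cancel)
  have rec: "E w = (1 - w) * E (w * q)" for w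
  proof -
    have "(\<lambda>n. euler_coeff q n * w ^ n - euler_coeff q n * (w * q) ^ n) sums (E w - E (w * q))"
      unfolding E_def by (intro sums_diff summable_sums sm)
    hence "(\<lambda>n. euler_coeff q (Suc n) * w ^ Suc n - euler_coeff q (Suc n) * (w * q) ^ Suc n) sums (E w - E (w * q))"
      by (subst sums_Suc_iff) (simp add: euler_coeff_def)
    moreover have "euler_coeff q (Suc n) * w ^ Suc n - euler_coeff q (Suc n) * (w * q) ^ Suc n
        = - w * (euler_coeff q n * (w * q) ^ n)" for n
    proof -
      have "euler_coeff q (Suc n) * w ^ Suc n - euler_coeff q (Suc n) * (w * q) ^ Suc n
          = (euler_coeff q (Suc n) * (1 - q ^ Suc n)) * w ^ Suc n"
        by (simp add: algebra_simps power_mult_distrib)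
      thus ?thesis unfolding euler_coeff_Suc[OF q] by (simp add: power_mult_distrib)
    qed
    ultimately have "(\<lambda>n. - w * (euler_coeff q n * (w * q) ^ n)) sums (E w - E (w * q))" by simp
    moreover have "(\<lambda>n. - w * (euler_coeff q n * (w * q) ^ n)) sums (- w * E (w * q))"
      unfolding E_def by (intro sums_mult summable_sums sm)
    ultimately have "E w - E (w * q) = - w * E (w * q)" by (rule sums_unique2)
    thus ?thesis by (simp add: algebra_simps)
  qed
  have split: "E w = qpoch w q n * E (w * q ^ n)" for n
  proof (induction n)
    case (Suc n)
    thus ?case using rec[of "w * q ^ n"] by (simp add: qpoch_def mult_ac)
  qed (simp add: qpoch_def)
  have "isCont E 0"
    unfolding E_def by (intro isCont_powser_converges_everywhere sm)
  moreover have "(\<lambda>n. w * q ^ n) \<longlonglongrightarrow> 0"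
    using q by (intro tendsto_mult_right_zero LIMSEQ_power_zero)
  ultimately have "(\<lambda>n. E (w * q ^ n)) \<longlonglongrightarrow> E 0"
    by (rule isCont_tendsto_compose)
  moreover have "E 0 = 1" unfolding E_def powser_zero by (simp add: euler_coeff_def qpoch_def numeral_2_eq_2)
  ultimately have "(\<lambda>n. qpoch w q n * E (w * q ^ n)) \<longlonglongrightarrow> qinf w q * 1"
    by (intro tendsto_intros qpoch_tendsto_qinf q) simp
  hence "E w = qinf w q" unfolding split[symmetric] by (simp add: LIMSEQ_const_iff)
  thus ?thesis using sm[of w] by (simp add: E_def sums_iff)
qed

text \<open>Exponent bookkeeping, free of subtraction and halving: the powers of q in a product of
  two Euler coefficients become those of the Durfee sum.\<close>

lemma choose_2_add: "((j + k) choose 2) + (j choose 2) + j = j * j + j * k + (k choose 2)"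
  by (induction j) (simp_all add: Suc_choose_2)

lemma int_choose_2: "int n * (int n - 1) div 2 = int (n choose 2)"
proof -
  have "int n * (int n - 1) = 2 * int (n choose 2)"
    by (induction n) (auto simp: Suc_choose_2 algebra_simps)
  thus ?thesis by simp
qed

lemma neg_int_choose_2: "(- int n) * (- int n - 1) div 2 = int (n + (n choose 2))"
proof -
  have "int n * (int n - 1) = 2 * int (n choose 2)"
    by (induction n) (auto simp: Suc_choose_2 algebra_simps)
  hence "(- int n) * (- int n - 1) = 2 * int (n + (n choose 2))" by (simp add: algebra_simps)
  thus ?thesis by simp
qed

lemma has_sum_product_nat:
  fixes x y :: "nat \<Rightarrow> complex"
  assumes "summable (\<lambda>n. norm (x n))" "summable (\<lambda>n. norm (y n))" "x sums a" "y sums b"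
  shows "((\<lambda>(n, m). x n * y m) has_sum (a * b)) (UNIV \<times> UNIV)"
proof (rule has_sum_SigmaI)
  have x: "(x has_sum a) UNIV" and y: "(y has_sum b) UNIV"
    using assms by (auto intro: norm_summable_imp_has_sum)
  show "((\<lambda>m. case (n, m) of (n, m) \<Rightarrow> x n * y m) has_sum (x n * b)) UNIV" for n
    using has_sum_cmult_right[OF y] by simp
  show "((\<lambda>n. x n * b) has_sum (a * b)) UNIV"
    using has_sum_cmult_left[OF x] by simp
  have nx: "(\<lambda>n. norm (x n)) summable_on UNIV" and ny: "(\<lambda>n. norm (y n)) summable_on UNIV"
    using assms by (auto intro!: norm_summable_imp_summable_on)
  have "(\<lambda>p. norm ((\<lambda>(n, m). x n * y m) p)) summable_on UNIV \<times> UNIV"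
    unfolding Infinite_Sum.abs_summable_on_Sigma_iff using nx ny
    by (auto simp: norm_mult abs_mult infsum_cmult_right' intro!: summable_on_cmult_right summable_on_cmult_left)
  thus "(\<lambda>(n, m). x n * y m) summable_on UNIV \<times> UNIV" by (rule abs_summable_summable)
qed

text \<open>
  Multiplying the Euler expansions of the two factors of \<open>theta_prod\<close>, the coefficient of \<open>w^k\<close> is
  the sum in \<open>qinf_durfee\<close>.
\<close>

theorem jacobi_triple_product:
  assumes q: "norm q < 1" "q \<noteq> 0" and w: "w \<noteq> 0"
  shows "((\<lambda>k::int. (-1) powi k * q powi (k * (k - 1) div 2) * w powi k)
           has_sum (theta_prod w q * qinf q q)) UNIV"
proof -
  define F where "F = (\<lambda>(n, m). (euler_coeff q n * w ^ n) * (euler_coeff q m * (q / w) ^ m))"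
  \<comment> \<open>Pairs of exponents are regrouped by their difference k, which is the exponent of
    w, and their minimum j, which is the Durfee summation index.\<close>
  define h :: "int \<times> nat \<Rightarrow> nat \<times> nat" where
    "h = (\<lambda>(k, j). if k \<ge> 0 then (j + nat k, j) else (j, j + nat (- k)))"
  define g :: "int \<Rightarrow> complex" where "g = (\<lambda>k. (-1) powi k * q powi (k * (k - 1) div 2) * w powi k)"
  have "(F has_sum theta_prod w q) (UNIV \<times> UNIV)"
    unfolding F_def theta_prod_def
    by (intro has_sum_product_nat summable_norm_euler euler_qinf_sums q)
  moreover have "bij_betw h (UNIV \<times> UNIV) (UNIV \<times> UNIV)"
    by (rule bij_betwI[of _ _ _ "\<lambda>(n, m). (int n - int m, min n m)"])
       (auto simp: h_def split: prod.splits if_splits)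
  ultimately have *: "((\<lambda>x. F (h x)) has_sum theta_prod w q) (UNIV \<times> UNIV)"
    by (simp add: has_sum_reindex_bij_betw)
  have T: "qinf q q \<noteq> 0" using qinf_nonzero q by blast
  define d where "d = (\<lambda>k n. q ^ (n * n) * (q ^ k) ^ n * (qinf (q * q ^ n) q * qinf (q ^ k * q * q ^ n) q))"
  have "summable (\<lambda>n. norm (d k n))" for k
  proof (rule summable_comparison_test')
    show "summable (\<lambda>n. norm q ^ n * (exp (1 / (1 - norm q)) * exp (1 / (1 - norm q))))"
      using q by (intro summable_mult2 summable_geometric) auto
    fix n
    have "norm (q ^ (n * n) * (q ^ k) ^ n) \<le> norm q ^ n * 1"
      unfolding norm_mult norm_power using q
      by (intro mult_mono power_decreasing power_le_one) auto
    moreover have "norm (q ^ k * q) \<le> 1 * 1"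
      unfolding norm_mult norm_power using q by (intro mult_mono power_le_one) auto
    ultimately have "norm (d k n) \<le> norm q ^ n * (exp (1 / (1 - norm q)) * exp (1 / (1 - norm q)))"
      using q unfolding d_def norm_mult[of "q ^ (n * n) * (q ^ k) ^ n"] norm_mult[of "qinf _ _"]
      by (intro mult_mono norm_qinf_mult_power_le) auto
    thus "norm (norm (d k n)) \<le> norm q ^ n * (exp (1 / (1 - norm q)) * exp (1 / (1 - norm q)))"
      by simp
  qed
  moreover from this have "d k sums qinf q q" for k
    using qinf_durfee[OF q(1), of k] by (simp add: d_def sums_iff summable_norm_cancel)
  ultimately have d: "(d k has_sum qinf q q) UNIV" for k
    by (rule norm_summable_imp_has_sum)
  \<comment> \<open>Extending the fraction by the tails R turns its denominator into the square of
    \<open>qinf q q\<close> and exposes the Durfee term d k j.\<close>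
  have coeff: "euler_coeff q (j + k) * euler_coeff q j * q ^ j
      = (-1) ^ k * q ^ (k choose 2) * d k j / (qinf q q)\<^sup>2" for j k
  proof -
    have split: "qinf q q = qpoch q q (j + k) * qinf (q ^ k * q * q ^ j) q" "qinf q q = qpoch q q j * qinf (q * q ^ j) q"
      using qinf_split[OF q(1), of q "j + k"] qinf_split[OF q(1), of q j] by (simp_all add: power_add mult_ac)
    define P R where "P = qpoch q q (j + k) * qpoch q q j" and "R = qinf (q * q ^ j) q * qinf (q ^ k * q * q ^ j) q"
    have PR: "(qinf q q)\<^sup>2 = P * R"
      using split by (simp add: P_def R_def power2_eq_square mult_ac)
    hence R: "R \<noteq> 0" using T by auto
    have e: "q ^ ((j + k) choose 2) * q ^ (j choose 2) * q ^ j = q ^ (j * j) * (q ^ k) ^ j * q ^ (k choose 2)"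
      unfolding power_add[symmetric] power_mult[symmetric] choose_2_add by (simp add: mult_ac)
    have sgn: "(-1) ^ (j + k) * (-1) ^ j = ((-1) ^ k :: complex)"
      by (simp add: power_add)
    have "euler_coeff q (j + k) * euler_coeff q j * q ^ j
      = ((-1) ^ (j + k) * (-1) ^ j) * (q ^ ((j + k) choose 2) * q ^ (j choose 2) * q ^ j) / P"
      by (simp add: euler_coeff_def P_def)
    also have "\<dots> = (-1) ^ k * (q ^ (j * j) * (q ^ k) ^ j * q ^ (k choose 2)) * R / (P * R)"
      unfolding e sgn using R by simp
    also have "\<dots> = (-1) ^ k * q ^ (k choose 2) * d k j / (qinf q q)\<^sup>2"
      unfolding PR d_def R_def by (simp add: mult_ac)
    finally show ?thesis .
  qed
  have inner: "((\<lambda>j. F (h (k, j))) has_sum (g k / qinf q q)) UNIV" for k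
  proof (cases "k \<ge> 0")
    case True
    then obtain l where l: "k = int l" using nonneg_int_cases by blast
    have "F (h (k, j)) = (-1) ^ l * q ^ (l choose 2) * w ^ l / (qinf q q)\<^sup>2 * d l j" for j
    proof -
      have "F (h (k, j)) = euler_coeff q (j + l) * euler_coeff q j * q ^ j * (w ^ (j + l) * (1 / w) ^ j)"
        by (simp add: F_def h_def l power_divide)
      moreover have "w ^ (j + l) * (1 / w) ^ j = w ^ l" using w by (simp add: power_add power_divide)
      ultimately show ?thesis by (simp add: coeff)
    qed
    moreover have "g k / qinf q q = (-1) ^ l * q ^ (l choose 2) * w ^ l / (qinf q q)\<^sup>2 * qinf q q"
      unfolding g_def l int_choose_2 using T by (simp add: power2_eq_square)
    ultimately show ?thesis by (simp only: has_sum_cmult_right[OF d])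
  next
    case False
    define l where "l = nat (- k)"
    have l: "k = - int l" "l > 0" using False by (auto simp: l_def)
    have "F (h (k, j)) = (-1) ^ l * q ^ (l choose 2) * (q / w) ^ l / (qinf q q)\<^sup>2 * d l j" for j
    proof -
      have "F (h (k, j)) = euler_coeff q (j + l) * euler_coeff q j * q ^ j * (w ^ j * (1 / w) ^ j * (q / w) ^ l)"
        using l(2) by (simp add: F_def h_def l(1) power_divide power_add)
      moreover have "w ^ j * (1 / w) ^ j = 1" using w by (simp flip: power_mult_distrib)
      ultimately show ?thesis by (simp add: coeff)
    qed
    moreover have "g k / qinf q q = (-1) ^ l * q ^ (l choose 2) * (q / w) ^ l / (qinf q q)\<^sup>2 * qinf q q"
      unfolding g_def l(1) neg_int_choose_2 using T q w
      by (simp add: power2_eq_square power_int_minus power_int_add power_divide divide_inverse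
            power_mult_distrib power_inverse flip: power_add)
         (cases "even l"; simp add: add.commute)
    ultimately show ?thesis by (simp only: has_sum_cmult_right[OF d])
  qed
  have "((\<lambda>k. g k / qinf q q) has_sum theta_prod w q) UNIV"
    by (rule has_sum_SigmaD[OF *]) (rule inner)
  from has_sum_cmult_left[OF this, of "qinf q q"] show ?thesis
    using T by (simp add: g_def)
qed

section \<open>A Jacobi form of weight \<open>-1\<close> and index \<open>1/2\<close>\<close>

text \<open>The exponential of period 1, used at z for w and at \<tau> for q; the classical nome
  would be exp (pi i \<tau>). Keeping arguments additive reduces identities between exponential
  factors to field identities under \<open>arg_cong\<close>.\<close>

definition nome :: "complex \<Rightarrow> complex" where
  "nome z = exp (2 * of_real pi * \<i> * z)"

lemma nome_0 [simp]: "nome 0 = 1"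
  by (simp add: nome_def)

lemma nome_nonzero [simp]: "nome z \<noteq> 0"
  by (simp add: nome_def)

lemma nome_add: "nome (a + b) = nome a * nome b"
  by (simp add: nome_def exp_add ring_distribs)

lemma nome_diff: "nome (a - b) = nome a / nome b"
  by (simp add: nome_def exp_diff ring_distribs)

lemma nome_minus: "nome (- a) = inverse (nome a)"
  by (simp add: nome_def exp_minus)

lemma nome_power: "nome a ^ n = nome (of_nat n * a)"
  by (simp add: nome_def exp_of_nat_mult[symmetric] mult_ac)

lemma nome_eq_1_iff: "nome z = 1 \<longleftrightarrow> (\<exists>n::int. z = of_int n)"
proof
  assume "nome z = 1"
  then obtain n :: int where "Re (2 * of_real pi * \<i> * z) = 0" "Im (2 * of_real pi * \<i> * z) = of_int (2 * n) * pi"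
    unfolding nome_def exp_eq_1 by blast
  hence "z = of_int n" by (simp add: complex_eq_iff)
  thus "\<exists>n::int. z = of_int n" ..
qed (auto simp: nome_def exp_eq_1)

lemma nome_of_int [simp]: "nome (of_int n) = 1"
  using nome_eq_1_iff by blast

lemma nome_half: "nome (of_int n / 2) = (-1) powi n"
proof -
  have "nome (1 / 2) = -1" by (simp add: nome_def)
  moreover have "nome (of_int n * x) = nome x powi n" for x
    by (simp add: nome_def exp_power_int mult_ac)
  from this[of "1 / 2"] have "nome (of_int n / 2) = nome (1 / 2) powi n" by simp
  ultimately show ?thesis by simp
qed

lemma norm_nome_less_1: "Im \<tau> > 0 \<Longrightarrow> norm (nome \<tau>) < 1"
  by (simp add: nome_def)

lemma holomorphic_nome [holomorphic_intros]: "f holomorphic_on D \<Longrightarrow> (\<lambda>x. nome (f x)) holomorphic_on D"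
  unfolding nome_def by (intro holomorphic_intros)

lemma qpow_eq_nome: "qpow l \<tau> = nome (of_real l * \<tau>)"
  by (simp add: qpow_def nome_def mult_ac)

text \<open>
  This is \<open>jacobi_theta z \<tau> / dedekind_eta \<tau> ^ 3\<close>; unlike its numerator and denominator it
  transforms under the full modular group without a multiplier.
\<close>

definition Phi :: "complex \<Rightarrow> complex \<Rightarrow> complex" where
  "Phi z \<tau> = - nome (- z / 2) * theta_prod (nome z) (nome \<tau>) / (qinf (nome \<tau>) (nome \<tau>))\<^sup>2"

definition lattice_pts :: "complex \<Rightarrow> complex set" where
  "lattice_pts \<tau> = {of_int l * \<tau> + of_int m | l m. True}"

lemma Phi_plus_1: "Phi (z + 1) \<tau> = - Phi z \<tau>"
proof -
  have "nome (- (z + 1) / 2) = nome (- z / 2) * nome (of_int (-1) / 2)"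
    unfolding nome_add[symmetric] by (rule arg_cong[of _ _ nome]) (simp add: field_simps)
  also have "nome (of_int (-1) / 2) = -1" unfolding nome_half by simp
  finally have 1: "nome (- (z + 1) / 2) = - nome (- z / 2)" by simp
  have "nome (z + 1) = nome z" using nome_of_int[of 1] by (simp add: nome_add)
  with 1 show ?thesis by (simp add: Phi_def)
qed

lemma Phi_plus_tau:
  assumes "Im \<tau> > 0"
  shows "Phi (z + \<tau>) \<tau> = - nome (- \<tau> / 2 - z) * Phi z \<tau>"
proof -
  have "theta_prod (nome (z + \<tau>)) (nome \<tau>) = - theta_prod (nome z) (nome \<tau>) / nome z"
    using theta_prod_shift[OF norm_nome_less_1[OF assms], of "nome z"] by (simp add: nome_add mult_ac)
  moreover have "nome (- (z + \<tau>) / 2) = nome (- \<tau> / 2 - z) * nome (- z / 2) * nome z"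
    unfolding nome_add[symmetric]
    by (rule arg_cong[of _ _ nome]) (simp add: field_simps)
  ultimately show ?thesis unfolding Phi_def by simp
qed

lemma Phi_plus_int: "Phi (z + of_int m) \<tau> = (-1) powi m * Phi z \<tau>"
proof (induction m rule: int_induct[where k = 0])
  case (step1 i)
  have "Phi (z + of_int (i + 1)) \<tau> = - Phi (z + of_int i) \<tau>"
    using Phi_plus_1[of "z + of_int i"] by (simp add: add_ac)
  thus ?case using step1 by (simp add: power_int_add)
next
  case (step2 i)
  have "Phi (z + of_int i) \<tau> = - Phi (z + of_int (i - 1)) \<tau>"
    using Phi_plus_1[of "z + of_int (i - 1)"] by simp
  thus ?case using step2 by (simp add: power_int_diff)
qed simp

text \<open>The linear exponents of successive shifts add up to a quadratic one; negative l is
  reached by undoing a shift.\<close>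

lemma Phi_plus_int_tau:
  assumes \<tau>: "Im \<tau> > 0"
  shows "Phi (z + of_int l * \<tau>) \<tau> = (-1) powi l * nome (- (of_int l ^ 2 * \<tau> / 2 + of_int l * z)) * Phi z \<tau>"
proof (induction l rule: int_induct[where k = 0])
  case (step1 i)
  have "nome (- \<tau> / 2 - (z + of_int i * \<tau>)) * nome (- (of_int i ^ 2 * \<tau> / 2 + of_int i * z))
      = nome (- (of_int (i + 1) ^ 2 * \<tau> / 2 + of_int (i + 1) * z))"
    unfolding nome_add[symmetric] by (rule arg_cong[of _ _ nome]) (simp add: field_simps power2_eq_square)
  moreover have "Phi (z + of_int (i + 1) * \<tau>) \<tau> = - nome (- \<tau> / 2 - (z + of_int i * \<tau>)) * Phi (z + of_int i * \<tau>) \<tau>"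
    using Phi_plus_tau[OF \<tau>, of "z + of_int i * \<tau>"] by (simp add: algebra_simps)
  ultimately show ?case using step1 by (simp add: power_int_add mult_ac)
next
  case (step2 i)
  have n: "nome (- \<tau> / 2 - (z + of_int (i - 1) * \<tau>)) * nome (- (of_int (i - 1) ^ 2 * \<tau> / 2 + of_int (i - 1) * z))
      = nome (- (of_int i ^ 2 * \<tau> / 2 + of_int i * z))"
    unfolding nome_add[symmetric] by (rule arg_cong[of _ _ nome]) (simp add: field_simps power2_eq_square)
  have "Phi (z + of_int i * \<tau>) \<tau> = - nome (- \<tau> / 2 - (z + of_int (i - 1) * \<tau>)) * Phi (z + of_int (i - 1) * \<tau>) \<tau>"
    using Phi_plus_tau[OF \<tau>, of "z + of_int (i - 1) * \<tau>"] by (simp add: algebra_simps)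
  hence "nome (- \<tau> / 2 - (z + of_int (i - 1) * \<tau>)) * (- Phi (z + of_int (i - 1) * \<tau>) \<tau>)
      = nome (- \<tau> / 2 - (z + of_int (i - 1) * \<tau>)) *
        ((-1) powi i * nome (- (of_int (i - 1) ^ 2 * \<tau> / 2 + of_int (i - 1) * z)) * Phi z \<tau>)"
    using step2(2) unfolding n[symmetric] by (simp add: mult_ac)
  hence "Phi (z + of_int (i - 1) * \<tau>) \<tau> = - ((-1) powi i * nome (- (of_int (i - 1) ^ 2 * \<tau> / 2 + of_int (i - 1) * z)) * Phi z \<tau>)"
    unfolding mult_cancel_left using nome_nonzero by (metis minus_minus)
  thus ?case by (simp add: power_int_diff)
qed simp

lemma Phi_lattice_shift:
  assumes "Im \<tau> > 0"
  shows "Phi (z + of_int l * \<tau> + of_int m) \<tau>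
           = (-1) powi (l + m) * nome (- (of_int l ^ 2 * \<tau> / 2 + of_int l * z)) * Phi z \<tau>"
  unfolding Phi_plus_int Phi_plus_int_tau[OF assms] by (simp add: power_int_add)

text \<open>Isolates the simple zero at z = 0: the second factor has the value 1 there.\<close>

lemma Phi_factor:
  assumes "Im \<tau> > 0"
  shows "Phi z \<tau> = (nome z - 1) * (nome (- z / 2) *
            (qinf (nome z * nome \<tau>) (nome \<tau>) * qinf (nome \<tau> / nome z) (nome \<tau>)) / (qinf (nome \<tau>) (nome \<tau>))\<^sup>2)"
  unfolding Phi_def theta_prod_def qinf_rec[OF norm_nome_less_1[OF assms], of "nome z"]
  by (simp add: algebra_simps diff_divide_distrib)

lemma qinf_self_nonzero: "Im \<tau> > 0 \<Longrightarrow> qinf (nome \<tau>) (nome \<tau>) \<noteq> 0"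
  by (intro qinf_nonzero norm_nome_less_1)

text \<open>The zeros of the first product of \<open>theta_prod\<close> are the lattice points whose
  coefficient of \<tau> is at most 0; those of the second have positive coefficient.\<close>

lemma Phi_eq_0_iff:
  assumes \<tau>: "Im \<tau> > 0"
  shows "Phi z \<tau> = 0 \<longleftrightarrow> z \<in> lattice_pts \<tau>"
proof
  assume "Phi z \<tau> = 0"
  hence "theta_prod (nome z) (nome \<tau>) = 0"
    using qinf_self_nonzero[OF \<tau>] by (simp add: Phi_def)
  hence "qinf (nome z) (nome \<tau>) = 0 \<or> qinf (nome \<tau> / nome z) (nome \<tau>) = 0"
    by (simp add: theta_prod_def)
  then consider j where "nome z * nome \<tau> ^ j = 1" | j where "nome \<tau> / nome z * nome \<tau> ^ j = 1"
    unfolding qinf_eq_0_iff[OF norm_nome_less_1[OF \<tau>]] by blast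
  thus "z \<in> lattice_pts \<tau>"
  proof cases
    case 1
    then obtain n :: int where n: "z + of_nat j * \<tau> = of_int n"
      unfolding nome_power nome_add[symmetric] nome_eq_1_iff by blast
    hence "z = of_int (- int j) * \<tau> + of_int n" by (simp add: algebra_simps)
    thus ?thesis unfolding lattice_pts_def by blast
  next
    case 2
    then obtain n :: int where n: "\<tau> - z + of_nat j * \<tau> = of_int n"
      unfolding nome_power nome_add[symmetric] nome_diff[symmetric] nome_eq_1_iff by blast
    hence "z = of_int (int j + 1) * \<tau> + of_int (- n)" by (simp add: algebra_simps)
    thus ?thesis unfolding lattice_pts_def by blast
  qed
next
  assume "z \<in> lattice_pts \<tau>"
  then obtain l m :: int where "z = 0 + of_int l * \<tau> + of_int m" by (auto simp: lattice_pts_def)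
  moreover have "Phi 0 \<tau> = 0" using Phi_factor[OF \<tau>, of 0] by simp
  ultimately show "Phi z \<tau> = 0" by (simp only: Phi_lattice_shift[OF \<tau>]) simp
qed

lemma holomorphic_Phi [holomorphic_intros]:
  assumes "open D" "u holomorphic_on D" "v holomorphic_on D" "\<And>x. x \<in> D \<Longrightarrow> Im (v x) > 0"
  shows "(\<lambda>x. Phi (u x) (v x)) holomorphic_on D"
  unfolding Phi_def using assms qinf_self_nonzero
  by (intro holomorphic_intros norm_nome_less_1) auto

text \<open>The limit is the same for all \<tau>, which is the purpose of dividing by the square of
  \<open>qinf\<close> in \<open>Phi\<close>: it fixes the constant in \<open>Phi_modular\<close> and
  leaves no root of unity undetermined.\<close>

lemma Phi_div_tendsto:
  assumes \<tau>: "Im \<tau> > 0"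
  shows "((\<lambda>z. Phi z \<tau> / z) \<longlongrightarrow> 2 * of_real pi * \<i>) (at 0)"
proof -
  define G where "G = (\<lambda>z. nome (- z / 2) *
            (qinf (nome z * nome \<tau>) (nome \<tau>) * qinf (nome \<tau> / nome z) (nome \<tau>)) / (qinf (nome \<tau>) (nome \<tau>))\<^sup>2)"
  have "G holomorphic_on UNIV"
    unfolding G_def using qinf_self_nonzero[OF \<tau>] norm_nome_less_1[OF \<tau>]
    by (intro holomorphic_intros) auto
  hence "isCont G 0"
    using continuous_on_eq_continuous_at[of UNIV] holomorphic_on_imp_continuous_on by auto
  moreover have "G 0 = 1"
    using qinf_self_nonzero[OF \<tau>] by (simp add: G_def power2_eq_square)
  ultimately have G: "(G \<longlongrightarrow> 1) (at 0)" by (metis isCont_def)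
  have "((\<lambda>z. nome z) has_field_derivative 2 * of_real pi * \<i>) (at 0)"
    unfolding nome_def by (auto intro!: derivative_eq_intros)
  hence "((\<lambda>z. (nome z - 1) / z) \<longlongrightarrow> 2 * of_real pi * \<i>) (at 0)"
    by (simp add: has_field_derivative_iff)
  from tendsto_mult[OF this G] show ?thesis
    unfolding Phi_factor[OF \<tau>] G_def by (simp add: mult_ac)
qed

lemma lattice_pts_shift:
  assumes "\<omega> \<in> lattice_pts \<tau>"
  shows "z + \<omega> \<in> lattice_pts \<tau> \<longleftrightarrow> z \<in> lattice_pts \<tau>"
proof -
  obtain l m :: int where \<omega>: "\<omega> = of_int l * \<tau> + of_int m" using assms by (auto simp: lattice_pts_def)
  show ?thesis
  proof
    assume "z + \<omega> \<in> lattice_pts \<tau>"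
    then obtain l' m' :: int where "z + \<omega> = of_int l' * \<tau> + of_int m'" by (auto simp: lattice_pts_def)
    hence "z = of_int (l' - l) * \<tau> + of_int (m' - m)" by (simp add: \<omega> algebra_simps)
    thus "z \<in> lattice_pts \<tau>" unfolding lattice_pts_def by blast
  next
    assume "z \<in> lattice_pts \<tau>"
    then obtain l' m' :: int where "z = of_int l' * \<tau> + of_int m'" by (auto simp: lattice_pts_def)
    hence "z + \<omega> = of_int (l' + l) * \<tau> + of_int (m' + m)" by (simp add: \<omega> algebra_simps)
    thus "z + \<omega> \<in> lattice_pts \<tau>" unfolding lattice_pts_def by blast
  qed
qed

lemma one_in_lattice: "1 \<in> lattice_pts \<tau>" and tau_in_lattice: "\<tau> \<in> lattice_pts \<tau>"
  and zero_in_lattice: "0 \<in> lattice_pts \<tau>"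
proof -
  have "1 = of_int 0 * \<tau> + of_int 1" "\<tau> = of_int 1 * \<tau> + of_int 0" "0 = of_int 0 * \<tau> + of_int 0" by simp_all
  thus "1 \<in> lattice_pts \<tau>" "\<tau> \<in> lattice_pts \<tau>" "0 \<in> lattice_pts \<tau>"
    unfolding lattice_pts_def by blast+
qed

lemma half_notin_lattice: "Im \<tau> > 0 \<Longrightarrow> 1 / 2 \<notin> lattice_pts \<tau>"
proof
  assume \<tau>: "Im \<tau> > 0" and "1 / 2 \<in> lattice_pts \<tau>"
  then obtain l m :: int where lm: "1 / 2 = of_int l * \<tau> + of_int m" by (auto simp: lattice_pts_def)
  from arg_cong[OF lm, of Im] \<tau> have "l = 0" by simp
  with lm have "of_int (2 * m) = (of_int 1 :: complex)" by (simp add: field_simps)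
  hence "2 * m = 1" by (simp only: of_int_eq_iff)
  thus False by presburger
qed

text \<open>The ratio f / g extends to an entire elliptic function. Its periodicity is stated by
  cross multiplication, which makes sense at zeros of g as well, and a limit at 0 suffices because
  periodicity carries it to every lattice point.\<close>

lemma elliptic_ratio_constant:
  assumes \<tau>: "Im \<tau> > 0" and f: "f holomorphic_on UNIV" and g: "g holomorphic_on UNIV"
    and zeros: "\<And>z. g z = 0 \<longleftrightarrow> z \<in> lattice_pts \<tau>"
    and per: "\<And>z. f (z + 1) * g z = f z * g (z + 1)" "\<And>z. f (z + \<tau>) * g z = f z * g (z + \<tau>)"
    and lim: "((\<lambda>z. f z / g z) \<longlongrightarrow> L) (at 0)"
  shows "f z = L * g z"
proof -
  \<comment> \<open>Lattice points receive the expected limit, so that h is periodic everywhere and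
    its singularities there are removable.\<close>
  define h where "h = (\<lambda>z. if z \<in> lattice_pts \<tau> then L else f z / g z)"
  have h_per: "h (z + \<omega>) = h z" if "\<omega> = 1 \<or> \<omega> = \<tau>" for z \<omega>
  proof -
    have "z + \<omega> \<in> lattice_pts \<tau> \<longleftrightarrow> z \<in> lattice_pts \<tau>"
      using that one_in_lattice tau_in_lattice by (intro lattice_pts_shift) auto
    moreover have "f (z + \<omega>) * g z = f z * g (z + \<omega>)" using that per by blast
    ultimately show ?thesis by (auto simp: h_def frac_eq_eq zeros)
  qed
  have h_lat: "h (z + \<omega>) = h z" if lat: "\<omega> \<in> lattice_pts \<tau>" for z \<omega>
  proof -
    obtain l m :: int where \<omega>: "\<omega> = of_int l * \<tau> + of_int m" using lat by (auto simp: lattice_pts_def)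
    have "h (z + of_int l * \<tau> + of_int m * 1) = h z"
      by (simp only: periodic_of_int[of h, OF h_per] simp_thms)
    thus ?thesis by (simp add: \<omega> add_ac)
  qed
  have lim0: "(h \<longlongrightarrow> h 0) (at 0)"
  proof (rule tendstoI)
    fix e :: real assume "e > 0"
    from tendstoD[OF lim this] show "\<forall>\<^sub>F x in at 0. dist (h x) (h 0) < e"
      by (rule eventually_mono) (use \<open>e > 0\<close> zero_in_lattice in \<open>auto simp: h_def\<close>)
  qed
  have limL: "(h \<longlongrightarrow> h \<omega>) (at \<omega>)" if "\<omega> \<in> lattice_pts \<tau>" for \<omega>
  proof (rule LIM_offset_zero_cancel)
    show "((\<lambda>u. h (\<omega> + u)) \<longlongrightarrow> h \<omega>) (at 0)"
      using lim0 h_lat[OF that] h_lat[OF that, of 0] by (simp add: add.commute)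
  qed
  have "h field_differentiable at z" for z
  proof (cases "z \<in> lattice_pts \<tau>")
    case False
    have op: "open {z. g z \<noteq> 0}"
      using g holomorphic_on_imp_continuous_on by (intro open_Collect_neq) auto
    have "(\<lambda>z. f z / g z) holomorphic_on {z. g z \<noteq> 0}"
      using f g by (intro holomorphic_intros) (auto intro: holomorphic_on_subset)
    hence "h holomorphic_on {z. g z \<noteq> 0}"
      by (rule holomorphic_transform) (auto simp: h_def zeros)
    thus ?thesis using op False by (intro holomorphic_on_imp_differentiable_at) (auto simp: zeros)
  next
    case True
    \<comment> \<open>The point 1 / 2 lies outside the lattice, so g is not identically zero and its
      zeros are isolated.\<close>
    obtain r where r: "0 < r" "\<And>u. u \<in> ball z r - {z} \<Longrightarrow> g u \<noteq> 0"
      using isolated_zeros[OF g open_UNIV connected_UNIV, of z "1 / 2"] True half_notin_lattice[OF \<tau>] zeros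
      by auto
    have "h holomorphic_on ball z r"
    proof (rule no_isolated_singularity'[where K = "{z}"])
      show "(h \<longlongrightarrow> h x) (at x within ball z r)" if "x \<in> {z}" for x
        using limL True that tendsto_within_subset by blast
      have "(\<lambda>z. f z / g z) holomorphic_on ball z r - {z}"
        using f g r by (intro holomorphic_intros) (auto intro: holomorphic_on_subset)
      thus "h holomorphic_on ball z r - {z}"
        by (rule holomorphic_transform) (use r zeros in \<open>auto simp: h_def\<close>)
    qed auto
    thus ?thesis using r by (intro holomorphic_on_imp_differentiable_at[of h "ball z r"]) auto
  qed
  hence "h holomorphic_on UNIV"
    by (simp add: holomorphic_on_def field_differentiable_at_within)
  hence h_const: "h z = h 0" for z
    using h_per by (intro doubly_periodic_entire_constant[OF \<tau>]) auto
  have off: "f z = L * g z" if "z \<notin> lattice_pts \<tau>" for z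
    using h_const[of z] that zero_in_lattice zeros by (auto simp: h_def field_simps)
  show ?thesis
  proof (cases "z \<in> lattice_pts \<tau>")
    \<comment> \<open>At a lattice point the value follows by continuity, since f - L g vanishes on
      a punctured neighbourhood.\<close>
    case True
    obtain r where r: "0 < r" "\<And>u. u \<in> ball z r - {z} \<Longrightarrow> g u \<noteq> 0"
      using isolated_zeros[OF g open_UNIV connected_UNIV, of z "1 / 2"] True half_notin_lattice[OF \<tau>] zeros
      by auto
    have "f u - L * g u = 0" if "u \<noteq> z" "dist u z < r" for u
      using off[of u] r(2)[of u] that zeros by (auto simp: dist_commute)
    hence "\<forall>\<^sub>F u in at z. f u - L * g u = 0"
      unfolding eventually_at using r(1) by blast
    hence "((\<lambda>u. f u - L * g u) \<longlongrightarrow> 0) (at z)" by (rule tendsto_eventually)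
    moreover have "isCont f z" "isCont g z"
      using f g continuous_on_eq_continuous_at[of UNIV] holomorphic_on_imp_continuous_on by auto
    hence "((\<lambda>u. f u - L * g u) \<longlongrightarrow> f z - L * g z) (at z)"
      unfolding isCont_def by (intro tendsto_intros)
    ultimately have "f z - L * g z = 0" by (metis LIM_unique)
    thus ?thesis by simp
  qed (use off in auto)
qed

lemma powi_minus_one_odd: "odd n \<Longrightarrow> (-1 :: complex) powi n = -1"
  by (simp add: power_int_minus_left)

section \<open>The modular transformation of \<open>Phi\<close>\<close>

lemma moebius_denom_nonzero:
  assumes "Im \<tau> > 0" "a * d - b * c = (1::int)"
  shows "of_int c * \<tau> + of_int d \<noteq> 0"
proof
  assume 0: "of_int c * \<tau> + of_int d = 0"
  from arg_cong[OF 0, of Im] assms(1) have "c = 0" by simp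
  with 0 assms(2) show False by simp
qed

lemma Im_moebius:
  assumes "Im \<tau> > 0" "a * d - b * c = (1::int)"
  shows "Im ((of_int a * \<tau> + of_int b) / (of_int c * \<tau> + of_int d)) > 0"
proof -
  let ?J = "of_int c * \<tau> + of_int d"
  have "Im ((of_int a * \<tau> + of_int b) / ?J)
      = ((of_int a * Im \<tau>) * (of_int c * Re \<tau> + of_int d) - (of_int a * Re \<tau> + of_int b) * (of_int c * Im \<tau>)) / (norm ?J)\<^sup>2"
    by (simp add: Im_divide cmod_power2)
  also have "(of_int a * Im \<tau>) * (of_int c * Re \<tau> + of_int d) - (of_int a * Re \<tau> + of_int b) * (of_int c * Im \<tau>)
      = of_int (a * d - b * c) * Im \<tau>"
    by (simp add: algebra_simps)
  finally show ?thesis using assms moebius_denom_nonzero[OF assms] by simp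
qed

theorem Phi_modular:
  fixes a b c d :: int
  assumes \<tau>: "Im \<tau> > 0" and det: "a * d - b * c = 1"
  defines "J \<equiv> of_int c * \<tau> + of_int d"
  shows "Phi (z / J) ((of_int a * \<tau> + of_int b) / J) = nome (of_int c * z\<^sup>2 / (2 * J)) / J * Phi z \<tau>"
proof -
  define \<tau>' where "\<tau>' = (of_int a * \<tau> + of_int b) / J"
  have J: "J \<noteq> 0" unfolding J_def using moebius_denom_nonzero[OF \<tau> det] .
  have \<tau>': "Im \<tau>' > 0" unfolding \<tau>'_def J_def using Im_moebius[OF \<tau> det] .
  have det': "of_int a * of_int d - of_int b * of_int c = (1::complex)"
    using det by (metis of_int_1 of_int_diff of_int_mult)
  have J\<tau>': "J * \<tau>' = of_int a * \<tau> + of_int b" using J by (simp add: \<tau>'_def)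
  \<comment> \<open>The left side freed of its expected factor, to be identified with
    \<open>Phi z \<tau>\<close>.\<close>
  define f where "f = (\<lambda>z. J * nome (- of_int c * z\<^sup>2 / (2 * J)) * Phi (z / J) \<tau>')"
  \<comment> \<open>These exponents govern the signs for the two periods. The determinant forbids a
    and c, and likewise b and d, from being both even.\<close>
  have odd1: "odd (a - c + a * c)" and odd2: "odd (d - b + b * d)"
    using arg_cong[OF det, of even] by auto
  have "f z = 1 * Phi z \<tau>"
  proof (rule elliptic_ratio_constant[OF \<tau>, where g = "\<lambda>z. Phi z \<tau>"])
    show "f holomorphic_on UNIV" "(\<lambda>z. Phi z \<tau>) holomorphic_on UNIV"
      unfolding f_def using J \<tau> \<tau>' by (intro holomorphic_intros; simp)+
    show "Phi z \<tau> = 0 \<longleftrightarrow> z \<in> lattice_pts \<tau>" for z by (rule Phi_eq_0_iff[OF \<tau>])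
    show "f (z + 1) * Phi z \<tau> = f z * Phi (z + 1) \<tau>" for z
    proof -
      \<comment> \<open>The period 1 of z becomes the vector - c \<tau>' + a of the new
        lattice.\<close>
      have "J * (of_int (- c) * \<tau>' + of_int a) = 1"
      proof -
        have "J * (of_int (- c) * \<tau>' + of_int a) = of_int a * J - of_int c * (J * \<tau>')"
          by (simp add: algebra_simps)
        also have "\<dots> = 1" using det' unfolding J\<tau>' unfolding J_def by algebra
        finally show ?thesis .
      qed
      hence "(z + 1) / J = z / J + of_int (- c) * \<tau>' + of_int a"
        using J by (simp add: field_simps)
      hence "f (z + 1) = J * (nome (- of_int c * (z + 1)\<^sup>2 / (2 * J)) *
           nome (- (of_int (- c) ^ 2 * \<tau>' / 2 + of_int (- c) * (z / J)))) * (-1) powi (a - c) * Phi (z / J) \<tau>'"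
        by (simp only: f_def Phi_lattice_shift[OF \<tau>']) (simp add: mult_ac)
      also have "nome (- of_int c * (z + 1)\<^sup>2 / (2 * J)) * nome (- (of_int (- c) ^ 2 * \<tau>' / 2 + of_int (- c) * (z / J)))
          = nome (- of_int c * z\<^sup>2 / (2 * J)) * nome (of_int (- (a * c)) / 2)"
      proof -
        \<comment> \<open>The terms linear in z cancel; this relation evaluates the remaining
          constant exponent as - a c / 2.\<close>
        have "of_int c + of_int c ^ 2 * (J * \<tau>') = of_int a * of_int c * J"
          using det' unfolding J\<tau>' unfolding J_def by algebra
        hence "of_int c / J + of_int c ^ 2 * \<tau>' = of_int a * of_int c"
          using J by (simp add: field_simps)
        hence e: "of_int (- (a * c)) / 2 = - (of_int c / J + of_int c ^ 2 * \<tau>') / 2" by simp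
        show ?thesis unfolding nome_add[symmetric] e
          by (rule arg_cong[of _ _ nome]) (use J in \<open>simp add: field_simps power2_eq_square\<close>)
      qed
      also have "nome (of_int (- (a * c)) / 2) = (-1) powi (a * c)"
        unfolding nome_half by (simp add: power_int_minus_left)
      finally have "f (z + 1) = f z * ((-1) powi (a - c) * (-1) powi (a * c))"
        by (simp add: f_def mult_ac)
      also have "(-1 :: complex) powi (a - c) * (-1) powi (a * c) = -1"
        using powi_minus_one_odd[OF odd1] by (simp add: power_int_add)
      finally show ?thesis by (simp add: Phi_plus_1)
    qed
    show "f (z + \<tau>) * Phi z \<tau> = f z * Phi (z + \<tau>) \<tau>" for z
    proof -
      \<comment> \<open>The period \<tau> of z becomes the vector d \<tau>' - b of the new
        lattice.\<close>
      have "J * (of_int d * \<tau>' + of_int (- b)) = \<tau>"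
      proof -
        have "J * (of_int d * \<tau>' + of_int (- b)) = of_int d * (J * \<tau>') - of_int b * J"
          by (simp add: algebra_simps)
        also have "\<dots> = \<tau>" using det' unfolding J\<tau>' unfolding J_def by algebra
        finally show ?thesis .
      qed
      hence "(z + \<tau>) / J = z / J + of_int d * \<tau>' + of_int (- b)"
        using J by (simp add: field_simps)
      hence "f (z + \<tau>) = J * (nome (- of_int c * (z + \<tau>)\<^sup>2 / (2 * J)) *
           nome (- (of_int d ^ 2 * \<tau>' / 2 + of_int d * (z / J)))) * (-1) powi (d - b) * Phi (z / J) \<tau>'"
        by (simp only: f_def Phi_lattice_shift[OF \<tau>']) (simp add: mult_ac)
      also have "nome (- of_int c * (z + \<tau>)\<^sup>2 / (2 * J)) * nome (- (of_int d ^ 2 * \<tau>' / 2 + of_int d * (z / J)))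
          = nome (- of_int c * z\<^sup>2 / (2 * J)) * nome (- \<tau> / 2 - z) * nome (of_int (- (b * d)) / 2)"
      proof -
        have "of_int c * \<tau>\<^sup>2 + of_int d ^ 2 * (J * \<tau>') = J * (\<tau> + of_int b * of_int d)"
          using det' unfolding J\<tau>' unfolding J_def by algebra
        moreover have "(of_int c * \<tau> + of_int d) * z = J * z" by (simp add: J_def)
        ultimately have "of_int c * \<tau>\<^sup>2 / J + of_int d ^ 2 * \<tau>' = \<tau> + of_int b * of_int d"
          "of_int c * \<tau> * z / J + of_int d * z / J = z"
          using J by (simp_all add: field_simps)
        hence e: "of_int (- (b * d)) / 2 = - (of_int c * \<tau>\<^sup>2 / J + of_int d ^ 2 * \<tau>' - \<tau>) / 2"
          and e2: "- \<tau> / 2 - z = - \<tau> / 2 - (of_int c * \<tau> * z / J + of_int d * z / J)" by simp_all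
        show ?thesis unfolding nome_add[symmetric] e e2
          by (rule arg_cong[of _ _ nome]) (use J in \<open>simp add: field_simps power2_eq_square\<close>)
      qed
      also have "nome (of_int (- (b * d)) / 2) = (-1) powi (b * d)"
        unfolding nome_half by (simp add: power_int_minus_left)
      finally have "f (z + \<tau>) = f z * nome (- \<tau> / 2 - z) * ((-1) powi (d - b) * (-1) powi (b * d))"
        by (simp add: f_def mult_ac)
      also have "(-1 :: complex) powi (d - b) * (-1) powi (b * d) = -1"
        using powi_minus_one_odd[OF odd2] by (simp add: power_int_add)
      finally show ?thesis by (simp add: Phi_plus_tau[OF \<tau>])
    qed
    \<comment> \<open>Both difference quotients tend to 2 pi i; the factor J in f offsets the
      scaling of z by 1 / J.\<close>
    show "((\<lambda>z. f z / Phi z \<tau>) \<longlongrightarrow> 1) (at 0)"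
    proof -
      have "filterlim (\<lambda>z. z / J) (at 0) (at 0)"
        using J by (intro filterlim_atI tendsto_eq_intros) (auto simp: eventually_at_filter)
      from filterlim_compose[OF Phi_div_tendsto[OF \<tau>'] this]
      have 1: "((\<lambda>z. Phi (z / J) \<tau>' / (z / J)) \<longlongrightarrow> 2 * of_real pi * \<i>) (at 0)" .
      have 2: "((\<lambda>z. nome (- of_int c * z\<^sup>2 / (2 * J))) \<longlongrightarrow> nome (- of_int c * 0\<^sup>2 / (2 * J))) (at 0)"
        unfolding nome_def using J by (intro tendsto_intros) auto
      have "((\<lambda>z. nome (- of_int c * z\<^sup>2 / (2 * J)) * (Phi (z / J) \<tau>' / (z / J)) / (Phi z \<tau> / z))
          \<longlongrightarrow> nome (- of_int c * 0\<^sup>2 / (2 * J)) * (2 * of_real pi * \<i>) / (2 * of_real pi * \<i>)) (at 0)"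
        by (intro tendsto_intros 1 2 Phi_div_tendsto[OF \<tau>]) auto
      moreover have "\<forall>\<^sub>F z in at 0. nome (- of_int c * z\<^sup>2 / (2 * J)) * (Phi (z / J) \<tau>' / (z / J)) / (Phi z \<tau> / z) = f z / Phi z \<tau>"
        unfolding eventually_at_filter using J by (auto intro!: always_eventually simp: f_def)
      ultimately have "((\<lambda>z. f z / Phi z \<tau>)
          \<longlongrightarrow> nome (- of_int c * 0\<^sup>2 / (2 * J)) * (2 * of_real pi * \<i>) / (2 * of_real pi * \<i>)) (at 0)"
        by (rule Lim_transform_eventually)
      thus ?thesis by simp
    qed
  qed
  hence "Phi z \<tau> = J * nome (- of_int c * z\<^sup>2 / (2 * J)) * Phi (z / J) \<tau>'" by (simp add: f_def)
  moreover have "nome (- of_int c * z\<^sup>2 / (2 * J)) = inverse (nome (of_int c * z\<^sup>2 / (2 * J)))"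
    unfolding nome_minus[symmetric] by simp
  ultimately show ?thesis using J unfolding \<tau>'_def[symmetric] by (simp add: field_simps)
qed

section \<open>The eta function and the Klein forms\<close>

lemma nome_power_int: "nome x powi n = nome (of_int n * x)"
  by (simp add: nome_def exp_power_int mult_ac)

lemma dedekind_eta_eq: "dedekind_eta \<tau> = nome (\<tau> / 24) * qinf (nome \<tau>) (nome \<tau>)"
  by (simp add: dedekind_eta_def qinf_def qpow_eq_nome)

lemma dedekind_eta_nonzero: "Im \<tau> > 0 \<Longrightarrow> dedekind_eta \<tau> \<noteq> 0"
  by (simp add: dedekind_eta_eq qinf_self_nonzero)

lemma holomorphic_dedekind_eta: "dedekind_eta holomorphic_on {\<tau>. Im \<tau> > 0}"
proof -
  have "open {\<tau>. Im \<tau> > 0}" by (rule open_halfspace_Im_gt)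
  thus ?thesis
    unfolding dedekind_eta_eq by (intro holomorphic_intros) (auto simp: norm_nome_less_1)
qed

lemma of_int_choose_half: "of_int (k * (k - 1) div 2) = (of_int k * (of_int k - 1) / 2 :: complex)"
proof -
  have "2 * (k * (k - 1) div 2) = k * (k - 1)" by simp
  hence "of_int (2 * (k * (k - 1) div 2)) = (of_int (k * (k - 1)) :: complex)" by (simp only:)
  hence *: "2 * of_int (k * (k - 1) div 2) = (of_int k * (of_int k - 1) :: complex)"
    by (simp only: of_int_mult of_int_numeral of_int_diff of_int_1)
  have "X = Y / 2" if "2 * X = Y" for X Y :: complex using that by auto
  from this[OF *] show ?thesis .
qed

text \<open>The triple product is taken at q w, since k (k - 1) / 2 + k = k (k + 1) / 2; then
  \<open>theta_prod_shift\<close> returns to w.\<close>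

theorem jacobi_theta_eq:
  assumes \<tau>: "Im \<tau> > 0"
  shows "jacobi_theta z \<tau> = Phi z \<tau> * dedekind_eta \<tau> ^ 3"
proof -
  note nq = norm_nome_less_1[OF \<tau>]
  let ?q = "nome \<tau>" and ?w = "nome z"
  have "((\<lambda>k::int. nome (\<tau> / 8 + z / 2) * ((-1) powi k * ?q powi (k * (k - 1) div 2) * (?q * ?w) powi k))
          has_sum nome (\<tau> / 8 + z / 2) * (theta_prod (?q * ?w) ?q * qinf ?q ?q)) UNIV"
    by (intro has_sum_cmult_right jacobi_triple_product nq) auto
  moreover have "nome (\<tau> / 8 + z / 2) * ((-1) powi k * ?q powi (k * (k - 1) div 2) * (?q * ?w) powi k)
      = (-1) powi k * exp (of_real pi * \<i> * (2 * of_int k + 1) * z) * qpow (of_int k * (of_int k + 1) / 2 + 1 / 8) \<tau>" for k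
  proof -
    have "exp (of_real pi * \<i> * (2 * of_int k + 1) * z) = nome ((2 * of_int k + 1) / 2 * z)"
      unfolding nome_def by (rule arg_cong[of _ _ exp]) (simp add: field_simps)
    moreover have "nome (\<tau> / 8 + z / 2) * (nome (of_int (k * (k - 1) div 2) * \<tau>) * nome (of_int k * (\<tau> + z)))
        = nome ((2 * of_int k + 1) / 2 * z) * nome (of_real (of_int k * (of_int k + 1) / 2 + 1 / 8) * \<tau>)"
      unfolding nome_add[symmetric] of_int_choose_half by (rule arg_cong[of _ _ nome]) (simp add: field_simps)
    ultimately show ?thesis
      by (simp add: nome_power_int qpow_eq_nome nome_add[symmetric] del: of_real_add of_real_divide of_real_mult)
  qed
  ultimately have "jacobi_theta z \<tau> = nome (\<tau> / 8 + z / 2) * (theta_prod (?q * ?w) ?q * qinf ?q ?q)"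
    unfolding jacobi_theta_def by (intro infsumI) (simp only:)
  also have "\<dots> = - (nome (\<tau> / 8 + z / 2) / ?w) * theta_prod ?w ?q * qinf ?q ?q"
    by (simp add: theta_prod_shift[OF nq])
  also have "nome (\<tau> / 8 + z / 2) / ?w = nome (- z / 2) * nome (\<tau> / 8)"
    unfolding nome_add[symmetric] nome_diff[symmetric] by (rule arg_cong[of _ _ nome]) (simp add: field_simps)
  also have "nome (\<tau> / 8) = nome (\<tau> / 24) ^ 3"
    by (simp add: nome_power)
  finally show ?thesis
    using qinf_self_nonzero[OF \<tau>] by (simp add: Phi_def dedekind_eta_eq power_mult_distrib power2_eq_square power3_eq_cube)
qed

text \<open>The cube of eta at 3 \<tau> cancels against the one from \<open>jacobi_theta_eq\<close>.
  At the zeros of \<open>Phi\<close> both sides are 0.\<close>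

lemma theta_quotient_eq:
  assumes "Im \<tau> > 0"
  shows "theta_quotient \<alpha> \<tau> = 3 / (dedekind_eta \<tau> * Phi (3 * \<alpha>) (3 * \<tau>))"
proof -
  have "dedekind_eta (3 * \<tau>) \<noteq> 0" using assms by (intro dedekind_eta_nonzero) simp
  thus ?thesis
    using assms by (simp add: theta_quotient_def jacobi_theta_eq field_simps)
qed

section \<open>The product over the half periods and the modularity of eta\<close>

lemma qinf_mult_minus:
  assumes q: "norm q < 1"
  shows "qinf a q * qinf (- a) q = qinf (a\<^sup>2) (q\<^sup>2)"
proof (rule LIMSEQ_unique)
  have q2: "norm (q\<^sup>2) < 1" using q by (simp add: norm_power power_less_one_iff)
  show "(\<lambda>n. qpoch (a\<^sup>2) (q\<^sup>2) n) \<longlonglongrightarrow> qinf (a\<^sup>2) (q\<^sup>2)"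
    by (rule qpoch_tendsto_qinf[OF q2])
  have "qpoch a q n * qpoch (- a) q n = qpoch (a\<^sup>2) (q\<^sup>2) n" for n
    unfolding qpoch_def prod.distrib[symmetric]
    by (intro prod.cong) (simp_all add: algebra_simps power2_eq_square power_mult_distrib)
  moreover have "(\<lambda>n. qpoch a q n * qpoch (- a) q n) \<longlonglongrightarrow> qinf a q * qinf (- a) q"
    by (intro tendsto_intros qpoch_tendsto_qinf q)
  ultimately show "(\<lambda>n. qpoch (a\<^sup>2) (q\<^sup>2) n) \<longlonglongrightarrow> qinf a q * qinf (- a) q"
    by simp
qed

lemma qinf_even_odd:
  assumes q: "norm q < 1"
  shows "qinf a q = qinf a (q\<^sup>2) * qinf (a * q) (q\<^sup>2)"
proof (rule LIMSEQ_unique)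
  have q2: "norm (q\<^sup>2) < 1" using q by (simp add: norm_power power_less_one_iff)
  have "qpoch a q (2 * n) = qpoch a (q\<^sup>2) n * qpoch (a * q) (q\<^sup>2) n" for n
    by (induction n) (simp_all add: qpoch_def power_mult[symmetric] mult_ac)
  moreover have "(\<lambda>n. qpoch a q (2 * n)) \<longlonglongrightarrow> qinf a q"
    using LIMSEQ_subseq_LIMSEQ[OF qpoch_tendsto_qinf[OF q], of "\<lambda>n. 2 * n"] by (simp add: o_def strict_mono_def)
  ultimately show "(\<lambda>n. qpoch a (q\<^sup>2) n * qpoch (a * q) (q\<^sup>2) n) \<longlonglongrightarrow> qinf a q" by simp
  show "(\<lambda>n. qpoch a (q\<^sup>2) n * qpoch (a * q) (q\<^sup>2) n) \<longlonglongrightarrow> qinf a (q\<^sup>2) * qinf (a * q) (q\<^sup>2)"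
    by (intro tendsto_intros qpoch_tendsto_qinf q2)
qed

text \<open>Euler's identity (-q; q) (q; q^2) = 1, with (q; q^2) split as (p; q) (-p; q).\<close>

lemma qinf_half_periods:
  assumes q: "norm q < 1" "q \<noteq> 0" and p: "p\<^sup>2 = q"
  shows "qinf (- q) q * qinf p q * qinf (- p) q = 1"
proof -
  have 1: "qinf q q * qinf (- q) q = qinf (q\<^sup>2) (q\<^sup>2)" "qinf p q * qinf (- p) q = qinf q (q\<^sup>2)"
    using qinf_mult_minus[OF q(1), of q] qinf_mult_minus[OF q(1), of p] by (simp_all add: p)
  have "qinf q q * (qinf (- q) q * qinf p q * qinf (- p) q) = (qinf q q * qinf (- q) q) * (qinf p q * qinf (- p) q)"
    by (simp only: mult_ac)
  also have "\<dots> = qinf q (q\<^sup>2) * qinf (q\<^sup>2) (q\<^sup>2)"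
    unfolding 1 by (simp only: mult_ac)
  also have "\<dots> = qinf q q * 1"
    using qinf_even_odd[OF q(1), of q] by (simp add: power2_eq_square)
  finally have "qinf q q * (qinf (- q) q * qinf p q * qinf (- p) q) = qinf q q * 1" .
  moreover have "qinf q q \<noteq> 0" using q by (intro qinf_nonzero)
  ultimately show ?thesis by (metis mult_cancel_left)
qed

text \<open>With this exponential factor the modular group acts on the characteristic \<open>(r, s)\<close> alone.\<close>

definition klein :: "complex \<Rightarrow> complex \<Rightarrow> complex \<Rightarrow> complex" where
  "klein r s \<tau> = nome (r * (r * \<tau> + s) / 2) * Phi (r * \<tau> + s) \<tau>"

lemma klein_modular:
  fixes a b c d :: int
  assumes \<tau>: "Im \<tau> > 0" and det: "a * d - b * c = 1"
  defines "J \<equiv> of_int c * \<tau> + of_int d"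
  shows "klein r s ((of_int a * \<tau> + of_int b) / J)
           = klein (r * of_int a + s * of_int c) (r * of_int b + s * of_int d) \<tau> / J"
proof -
  define z where "z = (r * of_int a + s * of_int c) * \<tau> + (r * of_int b + s * of_int d)"
  have J: "J \<noteq> 0" unfolding J_def using moebius_denom_nonzero[OF \<tau> det] .
  have det': "of_int a * of_int d - of_int b * of_int c = (1::complex)"
    using det by (metis of_int_1 of_int_diff of_int_mult)
  have z: "r * ((of_int a * \<tau> + of_int b) / J) + s = z / J"
    using J by (simp add: z_def field_simps) (simp add: J_def algebra_simps)
  \<comment> \<open>This lets the exponent in \<open>klein\<close> and the one from
    \<open>Phi_modular\<close> combine into the exponent for the new characteristic, the row (r, s)
    times the matrix.\<close>
  have e: "r + of_int c * z = (r * of_int a + s * of_int c) * J"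
    using det' unfolding z_def J_def by algebra
  have "r * z / (2 * J) + of_int c * z\<^sup>2 / (2 * J) = z * (r + of_int c * z) / (2 * J)"
    by (simp add: algebra_simps power2_eq_square add_divide_distrib)
  also have "\<dots> = (r * of_int a + s * of_int c) * z / 2"
    unfolding e using J by simp
  finally have "r * z / (2 * J) + of_int c * z\<^sup>2 / (2 * J) = (r * of_int a + s * of_int c) * z / 2" .
  hence "nome (r * (z / J) / 2) * nome (of_int c * z\<^sup>2 / (2 * J)) = nome ((r * of_int a + s * of_int c) * z / 2)"
    unfolding nome_add[symmetric] by (intro arg_cong[of _ _ nome]) simp
  moreover have "Phi (z / J) ((of_int a * \<tau> + of_int b) / J) = nome (of_int c * z\<^sup>2 / (2 * J)) / J * Phi z \<tau>"
    unfolding J_def by (rule Phi_modular[OF \<tau> det])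
  ultimately show ?thesis
    unfolding klein_def z z_def[symmetric] by (simp add: mult_ac)
qed

lemma klein_shift:
  assumes \<tau>: "Im \<tau> > 0"
  shows "klein (r + of_int l) (s + of_int m) \<tau>
    = (-1) powi (l + m) * nome ((r * of_int m - of_int l * s + of_int l * of_int m) / 2) * klein r s \<tau>"
proof -
  define z where "z = r * \<tau> + s"
  have e: "(r + of_int l) * \<tau> + (s + of_int m) = z + of_int l * \<tau> + of_int m"
    by (simp add: z_def algebra_simps)
  have "nome ((r + of_int l) * (z + of_int l * \<tau> + of_int m) / 2) * nome (- (of_int l ^ 2 * \<tau> / 2 + of_int l * z))
      = nome ((r * of_int m - of_int l * s + of_int l * of_int m) / 2) * nome (r * z / 2)"
    unfolding nome_add[symmetric]
    by (rule arg_cong[of _ _ nome]) (simp add: z_def field_simps power2_eq_square)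
  thus ?thesis unfolding klein_def e Phi_lattice_shift[OF \<tau>] z_def[symmetric] by (simp add: mult_ac)
qed

text \<open>The fourth power removes the roots of unity of \<open>klein_shift\<close> at the half periods.\<close>

definition half_klein :: "int \<Rightarrow> int \<Rightarrow> complex \<Rightarrow> complex" where
  "half_klein x y \<tau> = klein (of_int x / 2) (of_int y / 2) \<tau> ^ 4"

lemma half_klein_parity:
  assumes \<tau>: "Im \<tau> > 0"
  shows "half_klein x y \<tau> = half_klein (x mod 2) (y mod 2) \<tau>"
proof -
  define l m where "l = x div 2" and "m = y div 2"
  have xy: "x = x mod 2 + 2 * l" "y = y mod 2 + 2 * m" by (simp_all add: l_def m_def)
  have "of_int x / 2 = of_int (x mod 2) / 2 + (of_int l :: complex)" "of_int y / 2 = of_int (y mod 2) / 2 + (of_int m :: complex)"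
    by (subst xy(1), simp add: add_divide_distrib) (subst xy(2), simp add: add_divide_distrib)
  hence "half_klein x y \<tau> = ((-1) powi (l + m)) ^ 4 *
      nome ((of_int (x mod 2) / 2 * of_int m - of_int l * (of_int (y mod 2) / 2) + of_int l * of_int m) / 2) ^ 4
      * half_klein (x mod 2) (y mod 2) \<tau>"
    by (simp only: half_klein_def klein_shift[OF \<tau>] power_mult_distrib)
  also have "nome ((of_int (x mod 2) / 2 * of_int m - of_int l * (of_int (y mod 2) / 2) + of_int l * of_int m) / 2) ^ 4
      = nome (of_int (x mod 2 * m - l * (y mod 2) + 2 * l * m))"
    unfolding nome_power by (rule arg_cong[of _ _ nome]) (simp add: field_simps)
  also have "((-1 :: complex) powi (l + m)) ^ 4 = 1"
    by (cases "even (l + m)") (simp_all add: power_int_minus_left)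
  finally show ?thesis by (simp only: nome_of_int mult_1 mult_1_right)
qed

text \<open>The theta factors cancel by \<open>qinf_half_periods\<close>. The constant is 2^4, where
  2 = 1 - (-1) stems from the half period 1/2, times nome (-3/2) = -1.\<close>

lemma half_klein_product:
  assumes \<tau>: "Im \<tau> > 0"
  shows "half_klein 0 1 \<tau> * half_klein 1 0 \<tau> * half_klein 1 1 \<tau> * dedekind_eta \<tau> ^ 24 = - 16"
proof -
  let ?q = "nome \<tau>" and ?p = "nome (\<tau> / 2)"
  note nq = norm_nome_less_1[OF \<tau>]
  define T where "T = qinf ?q ?q"
  have T: "T \<noteq> 0" using qinf_self_nonzero[OF \<tau>] by (simp add: T_def)
  have half: "nome (1 / 2) = -1" using nome_half[of 1] by simp
  have p: "?p\<^sup>2 = ?q" by (simp add: nome_power)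
  have p': "?q / ?p = ?p" "?q / (- ?p) = - ?p" using p by (simp_all add: field_simps power2_eq_square)
  have qm: "qinf (-1) ?q = 2 * qinf (- ?q) ?q" using qinf_rec[OF nq, of "-1"] by simp
  have k1: "klein 0 (1 / 2) \<tau> = - nome (- 1 / 4) * (2 * qinf (- ?q) ?q ^ 2) / T\<^sup>2"
    by (simp add: klein_def Phi_def half theta_prod_def qm T_def power2_eq_square)
  have k2: "klein (1 / 2) 0 \<tau> = - (nome (\<tau> / 8) * nome (- \<tau> / 4)) * qinf ?p ?q ^ 2 / T\<^sup>2"
    by (simp add: klein_def Phi_def theta_prod_def p' T_def power2_eq_square)
  have "1 / 2 * \<tau> + 1 / 2 = \<tau> / 2 + 1 / 2" by simp
  hence k3: "klein (1 / 2) (1 / 2) \<tau> = - (nome ((\<tau> / 2 + 1 / 2) / 4) * nome (- (\<tau> / 2 + 1 / 2) / 2)) * qinf (- ?p) ?q ^ 2 / T\<^sup>2"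
    using p' by (simp only: klein_def Phi_def theta_prod_def T_def nome_add half) (simp add: power2_eq_square)
  have "klein 0 (1 / 2) \<tau> * klein (1 / 2) 0 \<tau> * klein (1 / 2) (1 / 2) \<tau>
      = - 2 * (nome (- 1 / 4) * (nome (\<tau> / 8) * nome (- \<tau> / 4)) * (nome ((\<tau> / 2 + 1 / 2) / 4) * nome (- (\<tau> / 2 + 1 / 2) / 2)))
          * (qinf (- ?q) ?q * qinf ?p ?q * qinf (- ?p) ?q)\<^sup>2 / T ^ 6"
    unfolding k1 k2 k3 using T by (simp add: field_simps power2_eq_square eval_nat_numeral)
  also have "nome (- 1 / 4) * (nome (\<tau> / 8) * nome (- \<tau> / 4)) * (nome ((\<tau> / 2 + 1 / 2) / 4) * nome (- (\<tau> / 2 + 1 / 2) / 2))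
      = nome (- \<tau> / 4 - 3 / 8)"
    unfolding nome_add[symmetric] by (rule arg_cong[of _ _ nome]) (simp add: field_simps)
  also have "qinf (- ?q) ?q * qinf ?p ?q * qinf (- ?p) ?q = 1"
    by (intro qinf_half_periods nq p) auto
  finally have *: "klein 0 (1 / 2) \<tau> * klein (1 / 2) 0 \<tau> * klein (1 / 2) (1 / 2) \<tau> = - 2 * nome (- \<tau> / 4 - 3 / 8) / T ^ 6"
    by simp
  have "half_klein 0 1 \<tau> * half_klein 1 0 \<tau> * half_klein 1 1 \<tau>
      = (klein 0 (1 / 2) \<tau> * klein (1 / 2) 0 \<tau> * klein (1 / 2) (1 / 2) \<tau>) ^ 4"
    by (simp add: half_klein_def power_mult_distrib)
  also have "\<dots> = 2 ^ 4 * nome (- \<tau> / 4 - 3 / 8) ^ 4 / T ^ 24"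
    unfolding * by (simp add: power_divide power_mult_distrib flip: power_mult)
  also have "nome (- \<tau> / 4 - 3 / 8) ^ 4 = nome (- \<tau>) * nome (of_int (-3) / 2)"
    unfolding nome_power nome_add[symmetric] by (rule arg_cong[of _ _ nome]) (simp add: field_simps)
  finally have "half_klein 0 1 \<tau> * half_klein 1 0 \<tau> * half_klein 1 1 \<tau> = - (2 ^ 4 * nome (- \<tau>) / T ^ 24)"
    unfolding nome_half by (simp add: power_int_minus_left)
  moreover have "dedekind_eta \<tau> ^ 24 = nome \<tau> * T ^ 24"
    by (simp add: dedekind_eta_eq power_mult_distrib nome_power T_def)
  ultimately show ?thesis using T by (simp add: nome_minus)
qed

lemma half_klein_modular:
  fixes a b c d :: int
  assumes \<tau>: "Im \<tau> > 0" and det: "a * d - b * c = 1"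
  defines "J \<equiv> of_int c * \<tau> + of_int d"
  shows "half_klein x y ((of_int a * \<tau> + of_int b) / J) = half_klein (x * a + y * c) (x * b + y * d) \<tau> / J ^ 4"
proof -
  have "of_int x / 2 * of_int a + of_int y / 2 * of_int c = (of_int (x * a + y * c) / 2 :: complex)"
    "of_int x / 2 * of_int b + of_int y / 2 * of_int d = (of_int (x * b + y * d) / 2 :: complex)"
    by (simp_all add: field_simps)
  thus ?thesis
    using klein_modular[OF \<tau> det, of "of_int x / 2" "of_int y / 2"]
    by (simp only: half_klein_def J_def power_divide)
qed

text \<open>Modulo 2 the matrix permutes the three nonzero half characteristics, so their product K
  changes only by the factor J^(-12).\<close>

lemma dedekind_eta_power_24_modular:
  fixes a b c d :: int
  assumes \<tau>: "Im \<tau> > 0" and det: "a * d - b * c = 1"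
  defines "J \<equiv> of_int c * \<tau> + of_int d"
  shows "dedekind_eta ((of_int a * \<tau> + of_int b) / J) ^ 24 = J ^ 12 * dedekind_eta \<tau> ^ 24"
proof -
  define \<tau>' where "\<tau>' = (of_int a * \<tau> + of_int b) / J"
  have J: "J \<noteq> 0" unfolding J_def using moebius_denom_nonzero[OF \<tau> det] .
  have \<tau>': "Im \<tau>' > 0" unfolding \<tau>'_def J_def using Im_moebius[OF \<tau> det] .
  define K where "K = half_klein 0 1 \<tau> * half_klein 1 0 \<tau> * half_klein 1 1 \<tau>"
  have "half_klein 0 1 \<tau>' * half_klein 1 0 \<tau>' * half_klein 1 1 \<tau>'
      = half_klein c d \<tau> * half_klein a b \<tau> * half_klein (a + c) (b + d) \<tau> / J ^ 12"
    unfolding \<tau>'_def J_def half_klein_modular[OF \<tau> det] by (simp add: power_add[symmetric])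
  also have "half_klein c d \<tau> * half_klein a b \<tau> * half_klein (a + c) (b + d) \<tau>
      = half_klein (c mod 2) (d mod 2) \<tau> * half_klein (a mod 2) (b mod 2) \<tau> * half_klein ((a + c) mod 2) ((b + d) mod 2) \<tau>"
    by (subst (1 2 3) half_klein_parity[OF \<tau>]) (rule refl)
  also have "\<dots> = K"
  proof -
    define A B C D where "A = a mod 2" and "B = b mod 2" and "C = c mod 2" and "D = d mod 2"
    have sums: "(a + c) mod 2 = (A + C) mod 2" "(b + d) mod 2 = (B + D) mod 2"
      by (simp_all add: A_def B_def C_def D_def mod_add_eq)
    have "even (A * D - B * C) \<longleftrightarrow> even (a * d - b * c)"
      by (simp add: A_def B_def C_def D_def)
    hence par: "odd (A * D - B * C)" using det by simp
    \<comment> \<open>A check of the residue patterns modulo 2; those with even determinant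
      contradict \<open>par\<close>.\<close>
    have "A = 0 \<or> A = 1" "B = 0 \<or> B = 1" "C = 0 \<or> C = 1" "D = 0 \<or> D = 1"
      by (auto simp: A_def B_def C_def D_def)
    thus ?thesis unfolding K_def sums A_def[symmetric] B_def[symmetric] C_def[symmetric] D_def[symmetric]
      using par by (elim disjE) (simp_all add: mult_ac)
  qed
  finally have "half_klein 0 1 \<tau>' * half_klein 1 0 \<tau>' * half_klein 1 1 \<tau>' = K / J ^ 12" .
  hence "K / J ^ 12 * dedekind_eta \<tau>' ^ 24 = K * dedekind_eta \<tau> ^ 24"
    using half_klein_product[OF \<tau>] half_klein_product[OF \<tau>'] by (simp add: K_def)
  moreover have "K \<noteq> 0" using half_klein_product[OF \<tau>] by (auto simp: K_def)
  ultimately show ?thesis using J by (simp add: \<tau>'_def field_simps)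
qed

text \<open>For c nonzero the denominator is never real on the half plane, so the branch cut is
  avoided; for c = 0 it is constant.\<close>

lemma moebius_denom_powr_continuous:
  fixes c d :: int
  shows "continuous_on {\<tau>. Im \<tau> > 0} (\<lambda>\<tau>. (of_int c * \<tau> + of_int d) powr z)"
proof (cases "c = 0")
  case False
  thus ?thesis
    by (intro continuous_on_powr_complex continuous_intros) (auto simp: complex_eq_iff)
qed simp

lemma powr_half_power_24: "z \<noteq> 0 \<Longrightarrow> (z powr of_real (1 / 2)) ^ 24 = z ^ 12" for z :: complex
proof -
  assume z: "z \<noteq> 0"
  have "(z powr of_real (1 / 2))\<^sup>2 = z"
    using z by (simp add: power2_eq_square powr_add[symmetric])
  hence "((z powr of_real (1 / 2))\<^sup>2) ^ 12 = z ^ 12" by (simp only:)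
  thus ?thesis by (simp flip: power_mult)
qed

text \<open>By the law for the 24th power, the ratio g takes values among the 24th roots of unity;
  being continuous on a connected set it is constant. So one root of unity serves all \<tau>
  together with the principal square root.\<close>

lemma dedekind_eta_modular:
  fixes a b c d :: int
  assumes det: "a * d - b * c = 1"
  shows "\<exists>\<epsilon>. \<epsilon> ^ 24 = 1 \<and> (\<forall>\<tau>. Im \<tau> > 0 \<longrightarrow>
      dedekind_eta ((of_int a * \<tau> + of_int b) / (of_int c * \<tau> + of_int d))
        = \<epsilon> * (of_int c * \<tau> + of_int d) powr of_real (1 / 2) * dedekind_eta \<tau>)"
proof -
  define H where "H = {\<tau>. Im \<tau> > 0}"
  define J where "J = (\<lambda>\<tau>::complex. of_int c * \<tau> + of_int d)"
  define g where "g = (\<lambda>\<tau>. dedekind_eta ((of_int a * \<tau> + of_int b) / J \<tau>) / (J \<tau> powr of_real (1 / 2) * dedekind_eta \<tau>))"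
  have J: "J \<tau> \<noteq> 0" if "\<tau> \<in> H" for \<tau>
    unfolding J_def using moebius_denom_nonzero[OF _ det] that by (simp add: H_def)
  have g24: "g \<tau> ^ 24 = 1" if "\<tau> \<in> H" for \<tau>
  proof -
    have \<tau>: "Im \<tau> > 0" using that by (simp add: H_def)
    show ?thesis
      using dedekind_eta_power_24_modular[OF \<tau> det] powr_half_power_24[OF J[OF that]] J[OF that] dedekind_eta_nonzero[OF \<tau>]
      by (simp add: g_def J_def power_divide power_mult_distrib)
  qed
  have "g constant_on H"
  proof (rule continuous_finite_range_constant)
    show "connected H" unfolding H_def by (intro convex_connected convex_halfspace_Im_gt)
    have cont: "continuous_on H dedekind_eta"
      using holomorphic_dedekind_eta holomorphic_on_imp_continuous_on by (simp add: H_def)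
    have "continuous_on H (\<lambda>\<tau>. dedekind_eta ((of_int a * \<tau> + of_int b) / J \<tau>))"
    proof (rule continuous_on_compose2[OF cont])
      show "continuous_on H (\<lambda>\<tau>. (of_int a * \<tau> + of_int b) / J \<tau>)"
        using J by (auto simp: J_def intro!: continuous_intros)
      show "(\<lambda>\<tau>. (of_int a * \<tau> + of_int b) / J \<tau>) ` H \<subseteq> H"
        using Im_moebius[OF _ det] by (auto simp: H_def J_def)
    qed
    moreover have "continuous_on H (\<lambda>\<tau>. J \<tau> powr of_real (1 / 2))"
      using moebius_denom_powr_continuous by (simp only: H_def J_def)
    ultimately show "continuous_on H g"
      unfolding g_def using cont J dedekind_eta_nonzero
      by (intro continuous_on_divide continuous_on_mult) (auto simp: H_def)
    have "finite {z::complex. z ^ 24 = 1}" by (rule finite_roots_unity) simp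
    moreover have "g ` H \<subseteq> {z. z ^ 24 = 1}" using g24 by auto
    ultimately show "finite (g ` H)" by (rule finite_subset[rotated])
  qed
  then obtain \<epsilon> where \<epsilon>: "\<And>\<tau>. \<tau> \<in> H \<Longrightarrow> g \<tau> = \<epsilon>" by (auto simp: constant_on_def)
  have "\<i> \<in> H" by (simp add: H_def)
  with \<epsilon> g24 have "\<epsilon> ^ 24 = 1" by metis
  moreover have "dedekind_eta ((of_int a * \<tau> + of_int b) / J \<tau>) = \<epsilon> * J \<tau> powr of_real (1 / 2) * dedekind_eta \<tau>"
    if "Im \<tau> > 0" for \<tau>
    using \<epsilon>[of \<tau>] that J[of \<tau>] dedekind_eta_nonzero[OF that] by (auto simp: g_def H_def field_simps)
  ultimately show ?thesis unfolding J_def by blast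
qed

text \<open>Stands in for \<open>meromorphic_at_ii_inf\<close>: with a holomorphic function on the
  whole disc in place of a series, closure under products and substitutions is a matter of
  composition. The rational l absorbs leading powers such as -1/24.\<close>

definition cusp_expansion :: "(complex \<Rightarrow> complex) \<Rightarrow> bool" where
  "cusp_expansion F \<longleftrightarrow> (\<exists>(N::nat) (l::real) g. N > 0 \<and> l \<in> \<rat> \<and> g holomorphic_on ball 0 1 \<and>
     (\<forall>\<tau>. Im \<tau> > 0 \<longrightarrow> F \<tau> = qpow l \<tau> * g (nome (\<tau> / of_nat N))))"

section \<open>Expansions at the cusps\<close>

lemma Rats_nat_denominator:
  assumes "(x :: real) \<in> \<rat>"
  obtains p :: int and N :: nat where "N > 0" "x = of_int p / of_nat N"
proof -
  obtain a b :: int where "b > 0" "x = of_int a / of_int b"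
    using Rats_cases'[OF assms] by metis
  thus ?thesis using that[of "nat b" a] by simp
qed

lemma norm_nome_div_less_1: "Im \<tau> > 0 \<Longrightarrow> N > 0 \<Longrightarrow> norm (nome (\<tau> / of_nat N)) < 1"
  by (intro norm_nome_less_1) simp

lemma nome_div_power: "N > 0 \<Longrightarrow> nome (\<tau> / of_nat (N * M)) ^ N = nome (\<tau> / of_nat M)"
  unfolding nome_power by (rule arg_cong[of _ _ nome]) simp

lemma norm_power_less_1: "norm (z :: complex) < 1 \<Longrightarrow> n > 0 \<Longrightarrow> norm (z ^ n) < 1"
  by (simp add: norm_power power_less_one_iff)

lemma holomorphic_compose_disc:
  assumes "g holomorphic_on ball 0 1" "u holomorphic_on ball 0 1" "\<And>t. norm t < 1 \<Longrightarrow> norm (u t) < 1"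
  shows "(\<lambda>t. g (u t)) holomorphic_on ball 0 1"
proof -
  have "g \<circ> u holomorphic_on ball 0 1"
    using assms(3) by (intro holomorphic_on_compose_gen[OF assms(2,1)]) auto
  thus ?thesis by (simp add: o_def)
qed

lemma cusp_expansion_cong:
  assumes "cusp_expansion F" "\<And>\<tau>. Im \<tau> > 0 \<Longrightarrow> G \<tau> = F \<tau>"
  shows "cusp_expansion G"
  using assms unfolding cusp_expansion_def by metis

lemma cusp_expansion_const: "cusp_expansion (\<lambda>_. c)"
  unfolding cusp_expansion_def
  by (intro exI[of _ 1] exI[of _ 0] exI[of _ "\<lambda>_. c"]) (auto simp: qpow_eq_nome)

text \<open>Both local parameters are powers of nome (\<tau> / (N M)).\<close>

lemma cusp_expansion_mult:
  assumes "cusp_expansion F" "cusp_expansion G"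
  shows "cusp_expansion (\<lambda>\<tau>. F \<tau> * G \<tau>)"
proof -
  obtain N l g where F: "N > 0" "l \<in> \<rat>" "g holomorphic_on ball 0 1"
    "\<And>\<tau>. Im \<tau> > 0 \<Longrightarrow> F \<tau> = qpow l \<tau> * g (nome (\<tau> / of_nat N))"
    using assms(1) unfolding cusp_expansion_def by blast
  obtain M k h where G: "M > 0" "k \<in> \<rat>" "h holomorphic_on ball 0 1"
    "\<And>\<tau>. Im \<tau> > 0 \<Longrightarrow> G \<tau> = qpow k \<tau> * h (nome (\<tau> / of_nat M))"
    using assms(2) unfolding cusp_expansion_def by blast
  have comp: "(\<lambda>t. f (t ^ n)) holomorphic_on ball 0 1" if "f holomorphic_on ball 0 1" "n > 0" for f n
    by (rule holomorphic_compose_disc[OF that(1)]) (auto intro!: holomorphic_intros norm_power_less_1 that)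
  have "(\<lambda>t. g (t ^ M) * h (t ^ N)) holomorphic_on ball 0 1"
    by (rule holomorphic_on_mult[OF comp[OF F(3) G(1)] comp[OF G(3) F(1)]])
  moreover have "F \<tau> * G \<tau> = qpow (l + k) \<tau> * (g (nome (\<tau> / of_nat (N * M)) ^ M) * h (nome (\<tau> / of_nat (N * M)) ^ N))"
    if "Im \<tau> > 0" for \<tau>
    using F(4)[OF that] G(4)[OF that] nome_div_power[OF F(1), of \<tau> M] nome_div_power[OF G(1), of \<tau> N]
    by (simp add: qpow_eq_nome ring_distribs nome_add mult_ac)
  ultimately show ?thesis
    unfolding cusp_expansion_def using F(1,2) G(1,2)
    by (intro exI[of _ "N * M"] exI[of _ "l + k"] exI[of _ "\<lambda>t. g (t ^ M) * h (t ^ N)"]) (auto intro: Rats_add)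
qed

lemma cusp_expansion_moebius:
  fixes a d :: nat and b :: int
  assumes "cusp_expansion F" "a > 0" "d > 0"
  shows "cusp_expansion (\<lambda>\<tau>. F ((of_nat a * \<tau> + of_int b) / of_nat d))"
proof -
  obtain N l g where F: "N > 0" "l \<in> \<rat>" "g holomorphic_on ball 0 1"
    "\<And>\<tau>. Im \<tau> > 0 \<Longrightarrow> F \<tau> = qpow l \<tau> * g (nome (\<tau> / of_nat N))"
    using assms(1) unfolding cusp_expansion_def by blast
  \<comment> \<open>The translation part becomes a factor of norm 1, so t -> c t^a maps the disc
    into itself.\<close>
  define c where "c = nome (of_int b / (of_nat d * of_nat N))"
  have "norm c = 1" by (simp add: c_def nome_def)
  hence c: "norm (c * t ^ a) < 1" if "norm t < 1" for t
    using norm_power_less_1[OF that assms(2)] by (simp add: norm_mult)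
  define k where "k = nome (of_real l * (of_int b / of_nat d))"
  have "(\<lambda>t. k * g (c * t ^ a)) holomorphic_on ball 0 1"
    by (rule holomorphic_on_mult[OF holomorphic_on_const holomorphic_compose_disc[OF F(3) _ c]])
       (auto intro!: holomorphic_intros)
  moreover have "F ((of_nat a * \<tau> + of_int b) / of_nat d)
      = qpow (l * of_nat a / of_nat d) \<tau> * (k * g (c * nome (\<tau> / of_nat (d * N)) ^ a))" if "Im \<tau> > 0" for \<tau>
  proof -
    have "Im ((of_nat a * \<tau> + of_int b) / of_nat d) > 0" using that assms by simp
    from F(4)[OF this] have "F ((of_nat a * \<tau> + of_int b) / of_nat d) =
      nome (of_real l * ((of_nat a * \<tau> + of_int b) / of_nat d)) * g (nome ((of_nat a * \<tau> + of_int b) / of_nat d / of_nat N))"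
      by (simp add: qpow_eq_nome)
    also have "nome ((of_nat a * \<tau> + of_int b) / of_nat d / of_nat N) = c * nome (\<tau> / of_nat (d * N)) ^ a"
      unfolding c_def nome_power nome_add[symmetric]
      by (rule arg_cong[of _ _ nome]) (simp add: add_divide_distrib)
    also have "nome (of_real l * ((of_nat a * \<tau> + of_int b) / of_nat d)) = nome (of_real (l * of_nat a / of_nat d) * \<tau>) * k"
      unfolding k_def nome_add[symmetric]
      by (rule arg_cong[of _ _ nome]) (simp add: add_divide_distrib ring_distribs)
    finally show ?thesis by (simp add: qpow_eq_nome)
  qed
  ultimately show ?thesis
    unfolding cusp_expansion_def using F(1,2) assms
    by (intro exI[of _ "d * N"] exI[of _ "l * of_nat a / of_nat d"] exI[of _ "\<lambda>t. k * g (c * t ^ a)"])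
       (auto intro!: Rats_divide Rats_mult)
qed

lemma cusp_expansion_imp_meromorphic:
  assumes "cusp_expansion F"
  shows "meromorphic_at_ii_inf F"
proof -
  obtain N l g where F: "N > 0" "l \<in> \<rat>" "g holomorphic_on ball 0 1"
    "\<And>\<tau>. Im \<tau> > 0 \<Longrightarrow> F \<tau> = qpow l \<tau> * g (nome (\<tau> / of_nat N))"
    using assms unfolding cusp_expansion_def by blast
  obtain p :: int and M :: nat where M: "M > 0" and l: "l = of_int p / of_nat M"
    using Rats_nat_denominator[OF F(2)] .
  \<comment> \<open>In the finer parameter nome (\<tau> / (M N)) the prefactor has the integral
    exponent p N.\<close>
  define h where "h = (\<lambda>t. g (t ^ M))"
  have h: "h holomorphic_on ball 0 1"
    unfolding h_def
    by (rule holomorphic_compose_disc[OF F(3)]) (auto intro!: holomorphic_intros norm_power_less_1 M)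
  define a where "a = (\<lambda>n. (deriv ^^ n) h 0 / fact n)"
  have "(\<lambda>n. a n * qpow ((of_int (p * int N) + of_nat n) / of_nat (M * N)) \<tau>) sums F \<tau>" if \<tau>: "Im \<tau> > 0" for \<tau>
  proof -
    define t where "t = nome (\<tau> / of_nat (M * N))"
    have "t \<in> ball 0 1" using norm_nome_div_less_1[OF \<tau>, of "M * N"] M F(1) by (simp add: t_def)
    from holomorphic_power_series[OF h this] have "(\<lambda>n. a n * t ^ n) sums h t" by (simp add: a_def)
    hence "(\<lambda>n. qpow l \<tau> * (a n * t ^ n)) sums (qpow l \<tau> * h t)" by (rule sums_mult)
    moreover have "qpow l \<tau> * h t = F \<tau>"
      using F(4)[OF \<tau>] nome_div_power[OF M, of \<tau> N] by (simp add: h_def t_def)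
    moreover have "qpow l \<tau> * (a n * t ^ n) = a n * qpow ((of_int (p * int N) + of_nat n) / of_nat (M * N)) \<tau>" for n
    proof -
      have "nome (of_real l * \<tau>) * t ^ n = nome (of_real ((of_int (p * int N) + of_nat n) / of_nat (M * N)) * \<tau>)"
        unfolding t_def nome_power nome_add[symmetric] l
        by (rule arg_cong[of _ _ nome]) (use M F(1) in \<open>simp add: field_simps\<close>)
      thus ?thesis by (simp add: qpow_eq_nome del: of_real_divide of_real_add)
    qed
    ultimately show ?thesis by simp
  qed
  thus ?thesis unfolding meromorphic_at_ii_inf_def upper_half_plane_def using M F(1)
    by (intro exI[of _ "M * N"] exI[of _ "p * int N"] exI[of _ a] exI[of _ 0]) auto
qed

lemma cusp_expansion_inverse_eta: "cusp_expansion (\<lambda>\<tau>. 1 / dedekind_eta \<tau>)"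
proof -
  have "(\<lambda>t. 1 / qinf t t) holomorphic_on ball 0 1"
    by (intro holomorphic_intros) (use qinf_nonzero in auto)
  moreover have "1 / dedekind_eta \<tau> = qpow (- 1 / 24) \<tau> * (1 / qinf (nome (\<tau> / of_nat 1)) (nome (\<tau> / of_nat 1)))" for \<tau>
  proof -
    have e: "nome (of_real (- 1 / 24) * \<tau>) = inverse (nome (\<tau> / 24))"
      unfolding nome_minus[symmetric] by (rule arg_cong[of _ _ nome]) simp
    show ?thesis
      unfolding dedekind_eta_eq qpow_eq_nome e
      by (simp only: of_nat_1 div_by_1 inverse_eq_divide times_divide_times_eq mult_1)
  qed
  ultimately show ?thesis
    unfolding cusp_expansion_def
    by (intro exI[of _ 1] exI[of _ "- 1 / 24"] exI[of _ "\<lambda>t. 1 / qinf t t"]) auto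
qed

text \<open>With r = p / N in [0, 1), both w and q / w are constants of norm 1 times nonnegative
  powers of t = nome (\<tau> / N). The theta product then has no zero in the whole disc, t = 0
  included.\<close>

lemma cusp_expansion_inverse_klein_reduced:
  fixes r s :: real
  assumes r: "r \<in> \<rat>" "0 \<le> r" "r < 1" and rs: "r > 0 \<or> s \<notin> \<int>"
  shows "cusp_expansion (\<lambda>\<tau>. 1 / klein (of_real r) (of_real s) \<tau>)"
proof -
  obtain p0 :: int and N :: nat where N: "N > 0" and r0: "r = of_int p0 / of_nat N"
    using Rats_nat_denominator[OF r(1)] .
  define p where "p = nat p0"
  have "p0 \<ge> 0" using r(2) N by (simp add: r0 zero_le_divide_iff)
  hence rp: "r = of_nat p / of_nat N" by (simp add: r0 p_def)
  have pN: "p < N" using r(3) N by (simp add: rp field_simps)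
  define c where "c = nome (of_real s)"
  have nc: "norm c = 1" by (simp add: c_def nome_def)
  hence c0: "c \<noteq> 0" by auto
  define th where "th = (\<lambda>t. qinf (c * t ^ p) (t ^ N) * qinf (inverse c * t ^ (N - p)) (t ^ N))"
  define k where "k = - nome (of_real ((r * s - s) / 2))"
  have k: "k \<noteq> 0" by (simp add: k_def)
  have tN: "norm (t ^ N) < 1" if "norm t < 1" for t :: complex using norm_power_less_1[OF that N] .
  have "th t \<noteq> 0" if t: "norm t < 1" for t
  proof -
    have "norm (inverse c * t ^ (N - p)) < 1"
      using norm_power_less_1[OF t, of "N - p"] pN by (simp add: norm_mult norm_inverse nc)
    hence "qinf (inverse c * t ^ (N - p)) (t ^ N) \<noteq> 0" by (intro qinf_nonzero tN t)
    moreover have "qinf (c * t ^ p) (t ^ N) \<noteq> 0"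
    proof (cases "p = 0")
      case False
      hence "norm (c * t ^ p) < 1" using norm_power_less_1[OF t, of p] by (simp add: norm_mult nc)
      thus ?thesis by (intro qinf_nonzero tN t)
    next
      \<comment> \<open>For r = 0 a zero could only come from j = 0 and c = 1, that is, from an
        integer s.\<close>
      case True
      hence "s \<notin> \<int>" using rs by (simp add: rp)
      have "c * (t ^ N) ^ j \<noteq> 1" for j
      proof
        assume 1: "c * (t ^ N) ^ j = 1"
        hence "norm (t ^ N) ^ j = 1" by (metis nc norm_mult norm_one norm_power mult_1)
        hence "j = 0" using tN[OF t] by (metis norm_ge_zero not_gr0 order_less_irrefl power_less_one_iff)
        with 1 obtain n :: int where "of_real s = (of_int n :: complex)" by (auto simp: c_def nome_eq_1_iff)
        hence "s = of_int n" by (metis of_real_eq_iff of_real_of_int_eq)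
        thus False using \<open>s \<notin> \<int>\<close> by simp
      qed
      thus ?thesis using tN[OF t] by (simp add: True qinf_eq_0_iff)
    qed
    ultimately show ?thesis by (simp add: th_def)
  qed
  hence "(\<lambda>t. (qinf (t ^ N) (t ^ N))\<^sup>2 / (k * th t)) holomorphic_on ball 0 1"
    using k tN unfolding th_def by (intro holomorphic_intros) auto
  moreover have "1 / klein (of_real r) (of_real s) \<tau> = qpow ((r - r\<^sup>2) / 2) \<tau> *
      ((qinf (nome (\<tau> / of_nat N) ^ N) (nome (\<tau> / of_nat N) ^ N))\<^sup>2 / (k * th (nome (\<tau> / of_nat N))))" if \<tau>: "Im \<tau> > 0" for \<tau>
  proof -
    define t where "t = nome (\<tau> / of_nat N)"
    have q: "t ^ N = nome \<tau>" using N by (simp add: t_def nome_power)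
    have w: "nome (of_real r * \<tau> + of_real s) = c * t ^ p"
      unfolding t_def c_def nome_power nome_add[symmetric] by (rule arg_cong[of _ _ nome]) (simp add: rp)
    have "t \<noteq> 0" by (simp add: t_def)
    hence w': "nome \<tau> / nome (of_real r * \<tau> + of_real s) = inverse c * t ^ (N - p)"
      unfolding w q[symmetric] using pN by (simp add: divide_inverse power_diff)
    have "nome (of_real r * (of_real r * \<tau> + of_real s) / 2) * nome (- (of_real r * \<tau> + of_real s) / 2)
        = nome (- (of_real ((r - r\<^sup>2) / 2) * \<tau>)) * nome (of_real ((r * s - s) / 2))"
      unfolding nome_add[symmetric]
      by (rule arg_cong[of _ _ nome]) (simp add: field_simps power2_eq_square)
    hence kl: "klein (of_real r) (of_real s) \<tau> = nome (- (of_real ((r - r\<^sup>2) / 2) * \<tau>)) * k * th t / (qinf (t ^ N) (t ^ N))\<^sup>2"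
      unfolding klein_def Phi_def theta_prod_def w' unfolding w q[symmetric] th_def k_def
      by (simp only: mult_minus_left mult_minus_right minus_divide_left[symmetric] times_divide_eq_right
          mult.assoc[symmetric])
    have inv: "1 / (inverse X * k' * h / T) = X * (T / (k' * h))" for X k' h T :: complex
      by (simp add: divide_inverse mult_ac)
    show ?thesis
      unfolding kl t_def[symmetric] qpow_eq_nome nome_minus by (rule inv)
  qed
  ultimately show ?thesis
    unfolding cusp_expansion_def using N r(1)
    by (intro exI[of _ N] exI[of _ "(r - r\<^sup>2) / 2"] exI[of _ "\<lambda>t. (qinf (t ^ N) (t ^ N))\<^sup>2 / (k * th t)"])
       (auto intro!: Rats_divide Rats_diff Rats_power)
qed

lemma cusp_expansion_inverse_klein:
  fixes r s :: real
  assumes r: "r \<in> \<rat>"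
  shows "cusp_expansion (\<lambda>\<tau>. 1 / klein (of_real r) (of_real s) \<tau>)"
proof (cases "r \<in> \<int> \<and> s \<in> \<int>")
  case True
  then obtain l m :: int where lm: "r = of_int l" "s = of_int m" by (auto elim!: Ints_cases)
  \<comment> \<open>Here the Klein form vanishes identically, and 1 / 0 = 0.\<close>
  have "1 / klein (of_real r) (of_real s) \<tau> = 0" if "Im \<tau> > 0" for \<tau>
  proof -
    have "of_real r * \<tau> + of_real s \<in> lattice_pts \<tau>" by (auto simp: lm lattice_pts_def)
    thus ?thesis using Phi_eq_0_iff[OF that] by (simp add: klein_def)
  qed
  thus ?thesis by (intro cusp_expansion_cong[OF cusp_expansion_const[of 0]])
next
  case False
  \<comment> \<open>Only r has to be reduced modulo 1; the shift costs a constant factor.\<close>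
  define r0 l where "r0 = frac r" and "l = \<lfloor>r\<rfloor>"
  have r0: "of_real r = of_real r0 + (of_int l :: complex)" by (simp add: r0_def l_def frac_def)
  have "r0 \<in> \<rat>" using r by (simp add: r0_def frac_def Rats_diff)
  moreover have "0 \<le> r0" "r0 < 1" by (auto simp: r0_def frac_lt_1)
  moreover have "r0 > 0 \<or> s \<notin> \<int>" using False by (auto simp: r0_def frac_gt_0_iff)
  ultimately have "cusp_expansion (\<lambda>\<tau>. 1 / klein (of_real r0) (of_real s) \<tau>)"
    by (rule cusp_expansion_inverse_klein_reduced)
  hence "cusp_expansion (\<lambda>\<tau>. 1 / ((-1) powi l * nome (- (of_int l * of_real s) / 2)) * (1 / klein (of_real r0) (of_real s) \<tau>))"
    by (rule cusp_expansion_mult[OF cusp_expansion_const])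
  thus ?thesis
    by (rule cusp_expansion_cong)
       (use klein_shift[of _ "of_real r0" l "of_real s" 0] in \<open>simp add: r0\<close>)
qed

text \<open>Up to a constant and an exponential factor this is \<open>theta_quotient\<close> at z =
  r \<tau> + s / 3, see \<open>theta_quotient_torsion\<close>.\<close>

definition eta_klein_quotient :: "complex \<Rightarrow> complex \<Rightarrow> complex \<Rightarrow> complex" where
  "eta_klein_quotient r s \<tau> = 1 / (dedekind_eta \<tau> * klein r s (3 * \<tau>))"

text \<open>The matrix of \<open>\<tau> \<mapsto> 3 (a \<tau> + b) / (c \<tau> + d)\<close> as a unimodular times an upper triangular one.\<close>

lemma triple_decomposition:
  fixes a b c d :: int
  assumes det: "a * d - b * c = 1"
  obtains \<alpha> \<beta> \<gamma> \<delta> b' :: int and a' d' :: nat where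
    "\<alpha> * \<delta> - \<beta> * \<gamma> = 1" "a' > 0" "d' > 0"
    "3 * a = \<alpha> * int a'" "3 * b = \<alpha> * b' + \<beta> * int d'" "c = \<gamma> * int a'" "d = \<gamma> * b' + \<delta> * int d'"
proof (cases "3 dvd c")
  case True
  \<comment> \<open>If 3 divides c, the matrix diag(3, 1) splits off on the right.\<close>
  then obtain k where "c = 3 * k" by blast
  thus ?thesis using det by (intro that[of a d "3 * b" k 3 1 0]) auto
next
  case False
  hence "3 dvd 1 - c * c"
  proof -
    have "c mod 3 = 1 \<or> c mod 3 = 2" using False by (auto simp: dvd_eq_mod_eq_0)
    hence "(c * c) mod 3 = 1"
      by (elim disjE) (simp_all add: mod_mult_eq[of c 3 c, symmetric])
    thus ?thesis by (simp add: mod_eq_dvd_iff[symmetric])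
  qed
  then obtain k where k: "1 - c * c = 3 * k" by blast
  \<comment> \<open>As c^2 is 1 modulo 3, the choice b' = c d makes c b' congruent to d modulo 3;
    the triangular factor then has diagonal 1, 3.\<close>
  have d: "d = c * (c * d) + k * d * 3"
    using arg_cong[OF k, of "\<lambda>x. x * d"] by (simp add: algebra_simps)
  have "3 * a * (k * d) - (b - a * (c * d)) * c = a * (c * (c * d) + k * d * 3) - b * c"
    by (simp add: algebra_simps)
  also have "\<dots> = 1" unfolding d[symmetric] by (rule det)
  finally show ?thesis
    using d by (intro that[of "3 * a" "k * d" "b - a * (c * d)" c 1 3 "c * d"]) (auto simp: algebra_simps)
qed

text \<open>Eta transforms under the matrix itself, the Klein form at 3 \<tau> under the unimodular
  factor of \<open>triple_decomposition\<close>. What remains is a triangular substitution, covered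
  by \<open>cusp_expansion_moebius\<close>.\<close>

theorem cusp_expansion_eta_klein_slash:
  fixes a b c d :: int and r s :: real
  assumes det: "a * d - b * c = 1" and rs: "r \<in> \<rat>" "s \<in> \<rat>"
  shows "cusp_expansion (\<lambda>\<tau>. (of_int c * \<tau> + of_int d) powr (- of_real (1 / 2)) *
      eta_klein_quotient (of_real r) (of_real s) ((of_int a * \<tau> + of_int b) / (of_int c * \<tau> + of_int d)))"
proof -
  obtain \<alpha> \<beta> \<gamma> \<delta> b' :: int and a' d' :: nat where dec: "\<alpha> * \<delta> - \<beta> * \<gamma> = 1" "a' > 0" "d' > 0"
    "3 * a = \<alpha> * int a'" "3 * b = \<alpha> * b' + \<beta> * int d'" "c = \<gamma> * int a'" "d = \<gamma> * b' + \<delta> * int d'"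
    using triple_decomposition[OF det] .
  have decc: "3 * of_int a = (of_int \<alpha> * of_nat a' :: complex)" "3 * of_int b = (of_int \<alpha> * of_int b' + of_int \<beta> * of_nat d' :: complex)"
      "of_int c = (of_int \<gamma> * of_nat a' :: complex)" "of_int d = (of_int \<gamma> * of_int b' + of_int \<delta> * of_nat d' :: complex)"
    using arg_cong[OF dec(4), of "of_int :: _ \<Rightarrow> complex"] arg_cong[OF dec(5), of "of_int :: _ \<Rightarrow> complex"]
      arg_cong[OF dec(6), of "of_int :: _ \<Rightarrow> complex"] arg_cong[OF dec(7), of "of_int :: _ \<Rightarrow> complex"] by simp_all
  define r1 s1 where "r1 = r * of_int \<alpha> + s * of_int \<gamma>" and "s1 = r * of_int \<beta> + s * of_int \<delta>"
  obtain \<epsilon> where \<epsilon>: "\<epsilon> ^ 24 = 1" "\<And>\<tau>. Im \<tau> > 0 \<Longrightarrow>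
      dedekind_eta ((of_int a * \<tau> + of_int b) / (of_int c * \<tau> + of_int d))
        = \<epsilon> * (of_int c * \<tau> + of_int d) powr of_real (1 / 2) * dedekind_eta \<tau>"
    using dedekind_eta_modular[OF det] by blast
  have \<epsilon>0: "\<epsilon> \<noteq> 0" using \<epsilon>(1) by auto
  have "r1 \<in> \<rat>" using rs by (auto simp: r1_def intro!: Rats_add Rats_mult)
  hence "cusp_expansion (\<lambda>\<tau>. 1 / klein (of_real r1) (of_real s1) ((of_nat a' * \<tau> + of_int b') / of_nat d'))"
    by (intro cusp_expansion_moebius cusp_expansion_inverse_klein dec)
  hence "cusp_expansion (\<lambda>\<tau>. 1 / (of_nat d' * \<epsilon>) * (1 / dedekind_eta \<tau> *
      (1 / klein (of_real r1) (of_real s1) ((of_nat a' * \<tau> + of_int b') / of_nat d'))))"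
    by (intro cusp_expansion_mult cusp_expansion_const cusp_expansion_inverse_eta)
  thus ?thesis
  proof (rule cusp_expansion_cong)
    fix \<tau> :: complex assume \<tau>: "Im \<tau> > 0"
    define J where "J = of_int c * \<tau> + of_int d"
    define \<tau>' where "\<tau>' = (of_nat a' * \<tau> + of_int b') / of_nat d'"
    have J: "J \<noteq> 0" unfolding J_def using moebius_denom_nonzero[OF \<tau> det] .
    have \<tau>': "Im \<tau>' > 0" using \<tau> dec by (simp add: \<tau>'_def)
    have d': "of_nat d' \<noteq> (0 :: complex)" using dec by simp
    have den: "of_int \<gamma> * \<tau>' + of_int \<delta> = J / of_nat d'"
      unfolding J_def \<tau>'_def decc using d' by (simp add: field_simps)
    have num: "of_int \<alpha> * \<tau>' + of_int \<beta> = 3 * (of_int a * \<tau> + of_int b) / of_nat d'"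
    proof -
      have "3 * (of_int a * \<tau> + of_int b) = of_int \<alpha> * of_nat a' * \<tau> + (of_int \<alpha> * of_int b' + of_int \<beta> * of_nat d')"
        unfolding decc[symmetric] by (simp add: algebra_simps)
      thus ?thesis unfolding \<tau>'_def using d' by (simp add: field_simps)
    qed
    have e: "3 * ((of_int a * \<tau> + of_int b) / J) = (of_int \<alpha> * \<tau>' + of_int \<beta>) / (of_int \<gamma> * \<tau>' + of_int \<delta>)"
      unfolding den num using d' J by simp
    have k: "klein (of_real r) (of_real s) (3 * ((of_int a * \<tau> + of_int b) / J)) = klein (of_real r1) (of_real s1) \<tau>' / (J / of_nat d')"
      unfolding e klein_modular[OF \<tau>' dec(1)] unfolding den r1_def s1_def
      by (simp only: of_real_add of_real_mult of_real_of_int_eq)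
    \<comment> \<open>The slash factor, the weight -1/2 of 1 / eta and the weight 1 of 1 /
      \<open>klein\<close> cancel.\<close>
    have "J powr (- of_real (1 / 2)) * (J / J powr of_real (1 / 2)) = 1"
    proof -
      have "J powr of_real (1 / 2) * J powr of_real (1 / 2) = J"
        using J by (simp add: powr_add[symmetric])
      thus ?thesis using J by (simp add: powr_minus divide_simps)
    qed
    moreover have "J powr (- of_real (1 / 2)) * eta_klein_quotient (of_real r) (of_real s) ((of_int a * \<tau> + of_int b) / J)
      = (J powr (- of_real (1 / 2)) * (J / J powr of_real (1 / 2))) * (1 / (of_nat d' * \<epsilon>) * (1 / dedekind_eta \<tau> *
        (1 / klein (of_real r1) (of_real s1) \<tau>')))"
    proof -
      have rearrange: "m * (1 / (e * p * h * (K / (j / n)))) = (m * (j / p)) * (1 / (n * e) * (1 / h * (1 / K)))"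
        for m e p h K j n :: complex
        by (simp add: divide_inverse mult_ac)
      show ?thesis
        unfolding eta_klein_quotient_def k \<epsilon>(2)[OF \<tau>, folded J_def] by (rule rearrange)
    qed
    ultimately show "(of_int c * \<tau> + of_int d) powr (- of_real (1 / 2)) *
        eta_klein_quotient (of_real r) (of_real s) ((of_int a * \<tau> + of_int b) / (of_int c * \<tau> + of_int d))
      = 1 / (of_nat d' * \<epsilon>) * (1 / dedekind_eta \<tau> *
        (1 / klein (of_real r1) (of_real s1) ((of_nat a' * \<tau> + of_int b') / of_nat d')))"
      by (simp add: J_def[symmetric] \<tau>'_def)
  qed
qed

section \<open>Holomorphy in two variables\<close>

text \<open>Cauchy's inequality on a circle, applied to the difference of two translates of f;
  uniform continuity on a compact polydisc makes that difference small.\<close>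

lemma continuous_deriv_snd:
  fixes f :: "complex \<Rightarrow> complex \<Rightarrow> complex"
  assumes U: "open U" and V: "open V" and p: "z0 \<in> U" "t0 \<in> V"
    and cont: "continuous_on (U \<times> V) (\<lambda>(z, t). f z t)"
    and hol: "\<And>z. z \<in> U \<Longrightarrow> (\<lambda>t. f z t) holomorphic_on V"
  shows "isCont (\<lambda>(z, t). deriv (f z) t) (z0, t0)"
  unfolding continuous_at_eps_delta
proof (intro allI impI)
  fix e :: real assume e: "e > 0"
  obtain r1 where r1: "r1 > 0" "cball z0 r1 \<subseteq> U" using U p open_contains_cball by blast
  obtain r2 where r2: "r2 > 0" "cball t0 r2 \<subseteq> V" using V p open_contains_cball by blast
  \<comment> \<open>Half the radius, so that circles of radius r around points t near t0 still lie
    in the compact disc.\<close>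
  define r where "r = r2 / 2"
  define K where "K = cball z0 r1 \<times> cball t0 r2"
  have "uniformly_continuous_on K (\<lambda>(z, t). f z t)"
    unfolding K_def using r1 r2
    by (intro compact_uniformly_continuous compact_Times compact_cball continuous_on_subset[OF cont]) auto
  then obtain d0 where d0: "d0 > 0"
    "\<And>x x'. x \<in> K \<Longrightarrow> x' \<in> K \<Longrightarrow> dist x' x < d0 \<Longrightarrow> dist ((\<lambda>(z, t). f z t) x') ((\<lambda>(z, t). f z t) x) < e * r / 2"
    unfolding uniformly_continuous_on_def using e r2 by (metis half_gt_zero mult_pos_pos r_def)
  define d where "d = min d0 (min r1 r)"
  have r: "r > 0" using r2 by (simp add: r_def)
  have d: "d > 0" using d0 r1 r by (simp add: d_def)
  have "dist ((\<lambda>(z, t). deriv (f z) t) x') ((\<lambda>(z, t). deriv (f z) t) (z0, t0)) < e"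
    if x': "dist x' (z0, t0) < d" for x'
  proof -
    obtain z t where zt: "x' = (z, t)" by force
    have dz: "dist z z0 < d" "dist t t0 < d"
      using x' dist_fst_le[of x' "(z0, t0)"] dist_snd_le[of x' "(z0, t0)"] by (simp_all add: zt)
    have zU: "z \<in> U" using dz r1 by (auto simp: d_def dist_commute subset_iff)
    have tu: "t + u \<in> cball t0 r2" "t0 + u \<in> cball t0 r2" if "norm u \<le> r" for u
    proof -
      have "dist t0 (t + u) \<le> dist t0 t + norm u"
        using norm_triangle_ineq4[of "t0 - t" u] by (simp add: dist_norm algebra_simps)
      thus "t + u \<in> cball t0 r2" using that dz by (simp add: d_def dist_commute r_def)
      show "t0 + u \<in> cball t0 r2" using that r2 by (simp add: dist_norm r_def)
    qed
    define h where "h = (\<lambda>u. f z (t + u) - f z0 (t0 + u))"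
    have shift: "(\<lambda>u. g (x + u)) holomorphic_on cball 0 r"
      if "g holomorphic_on V" "\<And>u. norm u \<le> r \<Longrightarrow> x + u \<in> V" for g x
    proof -
      have "g \<circ> (\<lambda>u. x + u) holomorphic_on cball 0 r"
      proof (rule holomorphic_on_compose_gen[OF _ that(1)])
        show "(\<lambda>u. x + u) holomorphic_on cball 0 r" by (intro holomorphic_intros)
        show "(\<lambda>u. x + u) ` cball 0 r \<subseteq> V" by (rule image_subsetI) (simp add: that(2))
      qed
      thus ?thesis by (simp add: o_def)
    qed
    have hol1: "(\<lambda>u. f z (t + u)) holomorphic_on cball 0 r"
      using tu(1) r2(2) by (intro shift hol zU) blast
    have hol2: "(\<lambda>u. f z0 (t0 + u)) holomorphic_on cball 0 r"
      using tu(2) r2(2) by (intro shift hol p) blast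
    have hol_h: "h holomorphic_on cball 0 r" unfolding h_def by (intro holomorphic_intros hol1 hol2)
    have "norm ((deriv ^^ 1) h 0) \<le> fact 1 * (e * r / 2) / r ^ 1"
    proof (rule Cauchy_inequality)
      show "h holomorphic_on ball 0 r" using hol_h holomorphic_on_subset by force
      show "continuous_on (cball 0 r) h" using hol_h by (rule holomorphic_on_imp_continuous_on)
      fix u :: complex assume "norm (0 - u) = r"
      hence u: "norm u \<le> r" by simp
      have "dist (z, t + u) (z0, t0 + u) = dist x' (z0, t0)" by (simp add: zt dist_Pair_Pair)
      moreover have "(z, t + u) \<in> K" "(z0, t0 + u) \<in> K"
        using tu[OF u] dz r1 by (auto simp: K_def d_def dist_commute)
      ultimately show "norm (h u) \<le> e * r / 2"
        using d0(2)[of "(z0, t0 + u)" "(z, t + u)"] x' by (simp add: h_def dist_norm d_def)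
    qed (use r in auto)
    hence "norm (deriv h 0) \<le> e / 2" using r by simp
    moreover have "deriv h 0 = deriv (f z) t - deriv (f z0) t0"
    proof -
      have tV: "t \<in> V" using tu(1)[of 0] r r2 by auto
      have "((\<lambda>u. f z (u + t)) has_field_derivative deriv (f z) t) (at 0)"
        unfolding DERIV_shift[symmetric] using holomorphic_derivI[OF hol[OF zU] V tV] by simp
      moreover have "((\<lambda>u. f z0 (u + t0)) has_field_derivative deriv (f z0) t0) (at 0)"
        unfolding DERIV_shift[symmetric] using holomorphic_derivI[OF hol[OF p(1)] V p(2)] by simp
      ultimately have "(h has_field_derivative deriv (f z) t - deriv (f z0) t0) (at 0)"
        unfolding h_def add.commute[of t] add.commute[of t0] by (rule DERIV_diff)
      thus ?thesis by (rule DERIV_imp_deriv)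
    qed
    ultimately show ?thesis using e by (simp add: zt dist_norm)
  qed
  thus "\<exists>d>0. \<forall>x'. dist x' (z0, t0) < d \<longrightarrow>
      dist ((\<lambda>(z, t). deriv (f z) t) x') ((\<lambda>(z, t). deriv (f z) t) (z0, t0)) < e"
    using d by blast
qed

text \<open>Osgood's lemma.\<close>

lemma holomorphic2_on_if_separately:
  fixes f :: "complex \<Rightarrow> complex \<Rightarrow> complex"
  assumes U: "open U" and V: "open V"
    and cont: "continuous_on (U \<times> V) (\<lambda>(z, t). f z t)"
    and hol1: "\<And>t. t \<in> V \<Longrightarrow> (\<lambda>z. f z t) holomorphic_on U"
    and hol2: "\<And>z. z \<in> U \<Longrightarrow> (\<lambda>t. f z t) holomorphic_on V"
  shows "holomorphic2_on (\<lambda>(z, t). f z t) (U \<times> V)"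
  unfolding holomorphic2_on_def
proof
  fix p assume "p \<in> U \<times> V"
  then obtain z0 t0 where p: "p = (z0, t0)" "z0 \<in> U" "t0 \<in> V" by auto
  obtain r where r: "r > 0" "ball t0 r \<subseteq> V" using V p open_contains_ball by blast
  define A where "A = deriv (\<lambda>z. f z t0) z0"
  \<comment> \<open>Total differentiability follows from one partial derivative at the point and the
    other near it, continuous at the point; the ball supplies convexity in t.\<close>
  have "((\<lambda>(z, t). f z t) has_derivative (\<lambda>(u, v). A * u + blinfun_mult_right (deriv (f z0) t0) v)) (at (z0, t0) within U \<times> ball t0 r)"
  proof (rule has_derivative_partialsI)
    have "((\<lambda>z. f z t0) has_field_derivative A) (at z0)"
      unfolding A_def using holomorphic_derivI[OF hol1[OF p(3)] U p(2)] .
    thus "((\<lambda>z. f z t0) has_derivative (\<lambda>u. A * u)) (at z0 within U)"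
      using has_derivative_at_withinI has_field_derivative_def by blast
    show "(f z has_derivative blinfun_apply (blinfun_mult_right (deriv (f z) t))) (at t within ball t0 r)"
      if "z \<in> U" "t \<in> ball t0 r" for z t
    proof -
      have "(f z has_field_derivative deriv (f z) t) (at t)"
        using holomorphic_derivI[OF hol2[OF that(1)] V] that r by auto
      thus ?thesis
        by (simp add: has_field_derivative_def has_derivative_at_withinI)
    qed
    have "isCont (\<lambda>(z, t). deriv (f z) t) (z0, t0)"
      using continuous_deriv_snd[OF U V p(2,3) cont hol2] .
    hence "isCont (\<lambda>x. blinfun_mult_right ((\<lambda>(z, t). deriv (f z) t) x)) (z0, t0)"
      by (intro bounded_linear.isCont[OF bounded_linear_blinfun_mult_right])
    hence "isCont (\<lambda>(z, t). blinfun_mult_right (deriv (f z) t)) (z0, t0)"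
      by (simp add: case_prod_unfold)
    thus "continuous (at (z0, t0) within U \<times> ball t0 r) (\<lambda>(z, t). blinfun_mult_right (deriv (f z) t))"
      by (rule continuous_at_imp_continuous_at_within)
  qed (use r in auto)
  moreover have "at (z0, t0) within U \<times> ball t0 r = at (z0, t0)"
    using U p r by (intro at_within_open) (auto simp: open_Times)
  ultimately have "((\<lambda>(z, t). f z t) has_derivative (\<lambda>(u, v). A * u + deriv (f z0) t0 * v)) (at p)"
    by (simp add: p(1))
  thus "\<exists>a b. ((\<lambda>(z, t). f z t) has_derivative (\<lambda>(u, v). a * u + b * v)) (at p)" by blast
qed

lemma holomorphic2_on_imp_continuous_on:
  assumes "holomorphic2_on f U" shows "continuous_on U f"
  using assms unfolding holomorphic2_on_def
  by (meson continuous_at_imp_continuous_on has_derivative_continuous)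

lemma continuous_on_Phi:
  fixes u v :: "'a :: heine_borel \<Rightarrow> complex"
  assumes D: "open D" and u: "continuous_on D u" and v: "continuous_on D v" and v0: "\<And>x. x \<in> D \<Longrightarrow> Im (v x) > 0"
  shows "continuous_on D (\<lambda>x. Phi (u x) (v x))"
proof -
  have n: "continuous_on D (\<lambda>x. nome (g x))" if "continuous_on D g" for g :: "'a \<Rightarrow> complex"
    unfolding nome_def using that by (intro continuous_intros)
  note T = continuous_on_qinf[OF D _ n[OF v]]
  show ?thesis
    unfolding Phi_def theta_prod_def using v0
    by (intro continuous_intros n T u v norm_nome_less_1) (auto simp: qinf_self_nonzero)
qed

section \<open>Meromorphy of the theta quotient\<close>

definition theta_denominator :: "complex \<Rightarrow> complex \<Rightarrow> complex" where
  "theta_denominator z \<tau> = dedekind_eta \<tau> * Phi (3 * z) (3 * \<tau>)"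

lemma holomorphic2_theta_denominator:
  "holomorphic2_on (\<lambda>(z, \<tau>). theta_denominator z \<tau>) (UNIV \<times> {\<tau>. Im \<tau> > 0})"
proof (rule holomorphic2_on_if_separately)
  let ?H = "{\<tau>. Im \<tau> > 0}"
  have H: "open ?H" by (rule open_halfspace_Im_gt)
  show "open ?H" by (rule H)
  have "continuous_on (UNIV \<times> ?H) (\<lambda>x. dedekind_eta (snd x))"
    using holomorphic_on_imp_continuous_on[OF holomorphic_dedekind_eta]
    by (rule continuous_on_compose2) (auto intro!: continuous_intros)
  moreover have "continuous_on (UNIV \<times> ?H) (\<lambda>x. Phi (3 * fst x) (3 * snd x))"
    by (intro continuous_on_Phi continuous_intros open_Times H) auto
  ultimately show "continuous_on (UNIV \<times> ?H) (\<lambda>(z, \<tau>). theta_denominator z \<tau>)"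
    unfolding theta_denominator_def case_prod_unfold by (rule continuous_on_mult)
  show "(\<lambda>z. theta_denominator z \<tau>) holomorphic_on UNIV" if "\<tau> \<in> ?H" for \<tau>
    unfolding theta_denominator_def using that by (intro holomorphic_intros) auto
  show "(\<lambda>\<tau>. theta_denominator z \<tau>) holomorphic_on ?H" for z
    unfolding theta_denominator_def by (intro holomorphic_intros holomorphic_dedekind_eta H) auto
qed auto

text \<open>A single representation 3 / h with h holomorphic works on the whole domain. Zeros of h
  carry the value 0 by the convention for division, as the definition of meromorphy asks.\<close>

lemma meromorphic2_theta_quotient:
  "meromorphic2_on (\<lambda>(z, \<tau>). theta_quotient z \<tau>) (UNIV \<times> upper_half_plane)"
  unfolding meromorphic2_on_def
proof
  fix p assume p: "p \<in> (UNIV :: complex set) \<times> upper_half_plane"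
  let ?V = "(UNIV :: complex set) \<times> upper_half_plane"
  let ?h = "\<lambda>(z, \<tau>). theta_denominator z \<tau>"
  have V: "open ?V" unfolding upper_half_plane_def by (intro open_Times open_halfspace_Im_gt open_UNIV)
  have h: "holomorphic2_on ?h ?V"
    using holomorphic2_theta_denominator by (simp only: upper_half_plane_def)
  have c: "holomorphic2_on (\<lambda>_. 3) ?V"
    unfolding holomorphic2_on_def by (auto intro!: exI[of _ 0] simp: case_prod_unfold)
  have q: "theta_quotient z \<tau> = 3 / theta_denominator z \<tau>" if "\<tau> \<in> upper_half_plane" for z \<tau>
    using theta_quotient_eq that by (simp add: theta_denominator_def upper_half_plane_def)
  have dense: "\<exists>x\<in>W. ?h x \<noteq> 0" if W: "open W" "W \<subseteq> ?V" "W \<noteq> {}" for W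
  proof (rule ccontr)
    assume "\<not> (\<exists>x\<in>W. ?h x \<noteq> 0)"
    hence 0: "theta_denominator z \<tau> = 0" if "(z, \<tau>) \<in> W" for z \<tau> using that by auto
    obtain z0 \<tau>0 where w: "(z0, \<tau>0) \<in> W" using W by auto
    obtain A B where AB0: "open A" "open B" "(z0, \<tau>0) \<in> A \<times> B" "A \<times> B \<subseteq> W"
      by (rule open_prod_elim[OF W(1) w])
    hence AB: "open A" "z0 \<in> A" "\<And>z. z \<in> A \<Longrightarrow> (z, \<tau>0) \<in> W" by blast+
    have \<tau>0: "Im \<tau>0 > 0" using w W by (auto simp: upper_half_plane_def)
    have "Phi (3 * z) (3 * \<tau>0) = 0" if "z \<in> A" for z
      using 0[OF AB(3)[OF that]] dedekind_eta_nonzero[OF \<tau>0] by (simp add: theta_denominator_def)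
    moreover have "(\<lambda>z. Phi (3 * z) (3 * \<tau>0)) holomorphic_on UNIV"
      using \<tau>0 by (intro holomorphic_intros) auto
    moreover have "z0 islimpt A" using AB by (intro interior_limit_point) (auto simp: interior_open)
    \<comment> \<open>Vanishing on an open set would make a whole slice in z vanish; z = 1/6 is
      chosen because 3 z is then the half period 1/2, which is no zero.\<close>
    ultimately have "Phi (3 * (1 / 6)) (3 * \<tau>0) = 0"
      using analytic_continuation[of "\<lambda>z. Phi (3 * z) (3 * \<tau>0)" UNIV A z0 "1 / 6"] by auto
    hence "1 / 2 \<in> lattice_pts (3 * \<tau>0)" using Phi_eq_0_iff[of "3 * \<tau>0"] \<tau>0 by simp
    thus False using half_notin_lattice[of "3 * \<tau>0"] \<tau>0 by simp
  qed
  have "\<exists>V g h. open V \<and> p \<in> V \<and> V \<subseteq> ?V \<and> holomorphic2_on g V \<and> holomorphic2_on h V \<and>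
           (\<forall>W. open W \<and> W \<subseteq> V \<and> W \<noteq> {} \<longrightarrow> (\<exists>x\<in>W. h x \<noteq> 0)) \<and>
           (\<forall>x\<in>V. h x \<noteq> 0 \<longrightarrow> (\<lambda>(z, \<tau>). theta_quotient z \<tau>) x = g x / h x)"
  proof (rule exI[of _ ?V], rule exI[of _ "\<lambda>_. 3"], rule exI[of _ ?h], intro conjI)
    show "open ?V" "p \<in> ?V" "holomorphic2_on (\<lambda>_. 3) ?V" "holomorphic2_on ?h ?V"
      by (fact V p c h)+
    show "\<forall>W. open W \<and> W \<subseteq> ?V \<and> W \<noteq> {} \<longrightarrow> (\<exists>x\<in>W. ?h x \<noteq> 0)"
      using dense by blast
    show "\<forall>x\<in>?V. ?h x \<noteq> 0 \<longrightarrow> (\<lambda>(z, \<tau>). theta_quotient z \<tau>) x = 3 / ?h x"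
      using q by auto
  qed simp
  moreover have "(\<exists>V. open V \<and> p \<in> V \<and> holomorphic2_on (\<lambda>(z, \<tau>). theta_quotient z \<tau>) V)
      \<or> (\<lambda>(z, \<tau>). theta_quotient z \<tau>) p = 0"
  proof (cases "?h p = 0")
    case True
    thus ?thesis using q p by auto
  next
    case False
    define V where "V = {x \<in> ?V. ?h x \<noteq> 0}"
    have "open V"
    proof -
      have "V = ?V \<inter> ?h -` (- {0})" by (auto simp: V_def)
      thus ?thesis
        using continuous_open_preimage[OF holomorphic2_on_imp_continuous_on[OF h] V, of "- {0}"] by (simp add: open_Compl)
    qed
    moreover have "holomorphic2_on (\<lambda>(z, \<tau>). theta_quotient z \<tau>) V"
      unfolding holomorphic2_on_def
    proof
      fix x assume x: "x \<in> V"
      then obtain a b where ab: "(?h has_derivative (\<lambda>(u, v). a * u + b * v)) (at x)"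
        using h unfolding holomorphic2_on_def V_def by blast
      have "((\<lambda>x. 3 * inverse (?h x)) has_derivative
          (\<lambda>y. 3 * - (inverse (?h x) * (\<lambda>(u, v). a * u + b * v) y * inverse (?h x)))) (at x)"
        by (intro has_derivative_mult_right Deriv.has_derivative_inverse ab) (use x in \<open>simp add: V_def\<close>)
      hence "((\<lambda>x. 3 / ?h x) has_derivative (\<lambda>(u, v). (- 3 * a * (inverse (?h x))\<^sup>2) * u + (- 3 * b * (inverse (?h x))\<^sup>2) * v)) (at x)"
        unfolding divide_inverse
        by (rule has_derivative_eq_rhs) (auto simp: algebra_simps power2_eq_square case_prod_unfold)
      hence "((\<lambda>(z, \<tau>). theta_quotient z \<tau>) has_derivative
          (\<lambda>(u, v). (- 3 * a * (inverse (?h x))\<^sup>2) * u + (- 3 * b * (inverse (?h x))\<^sup>2) * v)) (at x)"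
        by (rule has_derivative_transform_within_open[OF _ \<open>open V\<close> x]) (auto simp: V_def q)
      thus "\<exists>a b. ((\<lambda>(z, \<tau>). theta_quotient z \<tau>) has_derivative (\<lambda>(u, v). a * u + b * v)) (at x)"
        by blast
    qed
    moreover have "p \<in> V" using p False by (simp add: V_def)
    ultimately show ?thesis by blast
  qed
  ultimately show "(\<exists>V g h. open V \<and> p \<in> V \<and> V \<subseteq> ?V \<and> holomorphic2_on g V \<and> holomorphic2_on h V \<and>
           (\<forall>W. open W \<and> W \<subseteq> V \<and> W \<noteq> {} \<longrightarrow> (\<exists>x\<in>W. h x \<noteq> 0)) \<and>
           (\<forall>x\<in>V. h x \<noteq> 0 \<longrightarrow> (\<lambda>(z, \<tau>). theta_quotient z \<tau>) x = g x / h x)) \<and>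
        ((\<exists>V. open V \<and> p \<in> V \<and> holomorphic2_on (\<lambda>(z, \<tau>). theta_quotient z \<tau>) V)
          \<or> (\<lambda>(z, \<tau>). theta_quotient z \<tau>) p = 0)" by blast
qed

section \<open>Principal congruence subgroups\<close>

definition principal_congruence :: "int \<Rightarrow> (int ^ 2 ^ 2) set" where
  "principal_congruence M = {A. det A = 1 \<and> M dvd A $ 1 $ 1 - 1 \<and> M dvd A $ 1 $ 2 \<and>
     M dvd A $ 2 $ 1 \<and> M dvd A $ 2 $ 2 - 1}"

definition adjugate2 :: "int ^ 2 ^ 2 \<Rightarrow> int ^ 2 ^ 2" where
  "adjugate2 A = (\<chi> i j. if i = 1 then (if j = 1 then A $ 2 $ 2 else - A $ 1 $ 2)
                 else (if j = 1 then - A $ 2 $ 1 else A $ 1 $ 1))"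

lemma adjugate2_entries [simp]:
  "adjugate2 A $ 1 $ 1 = A $ 2 $ 2" "adjugate2 A $ 1 $ 2 = - A $ 1 $ 2"
  "adjugate2 A $ 2 $ 1 = - A $ 2 $ 1" "adjugate2 A $ 2 $ 2 = A $ 1 $ 1"
  by (simp_all add: adjugate2_def)

lemma matrix_mult_2_entries:
  fixes A B :: "int ^ 2 ^ 2"
  shows "(A ** B) $ i $ j = A $ i $ 1 * B $ 1 $ j + A $ i $ 2 * B $ 2 $ j"
  by (simp add: matrix_matrix_mult_def sum_2)

lemma inv_SL2Z:
  assumes "A \<in> carrier SL2Z"
  shows "inv\<^bsub>SL2Z\<^esub> A = adjugate2 A"
proof -
  have "A $ 1 $ 1 * A $ 2 $ 2 - A $ 1 $ 2 * A $ 2 $ 1 = 1"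
    using assms by (simp add: SL2Z_def det_2)
  hence "adjugate2 A ** A = mat 1" "det (adjugate2 A) = 1"
    by (simp_all add: vec_eq_iff forall_2 matrix_mult_2_entries mat_def det_2 algebra_simps)
  thus ?thesis
    using assms by (intro group.inv_equality[OF group_SL2Z]) (simp_all add: SL2Z_def)
qed

lemma subgroup_principal_congruence: "subgroup (principal_congruence M) SL2Z"
proof (rule group.subgroupI[OF group_SL2Z])
  show "principal_congruence M \<subseteq> carrier SL2Z"
    by (auto simp: principal_congruence_def SL2Z_def)
  have "mat 1 \<in> principal_congruence M"
    by (simp add: principal_congruence_def mat_def det_2)
  thus "principal_congruence M \<noteq> {}" by blast
next
  fix A assume A: "A \<in> principal_congruence M"
  hence "A \<in> carrier SL2Z" by (auto simp: principal_congruence_def SL2Z_def)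
  thus "inv\<^bsub>SL2Z\<^esub> A \<in> principal_congruence M"
    using A by (simp add: inv_SL2Z principal_congruence_def det_2 mult_ac)
next
  fix A B assume A: "A \<in> principal_congruence M" and B: "B \<in> principal_congruence M"
  obtain a b c d where a: "A $ 1 $ 1 = 1 + M * a" "A $ 1 $ 2 = M * b" "A $ 2 $ 1 = M * c" "A $ 2 $ 2 = 1 + M * d"
    using A by (auto simp: principal_congruence_def elim!: dvdE) (metis add.commute diff_add_cancel)
  obtain a' b' c' d' where b: "B $ 1 $ 1 = 1 + M * a'" "B $ 1 $ 2 = M * b'" "B $ 2 $ 1 = M * c'" "B $ 2 $ 2 = 1 + M * d'"
    using B by (auto simp: principal_congruence_def elim!: dvdE) (metis add.commute diff_add_cancel)
  have "det (A ** B) = 1" using A B by (simp add: principal_congruence_def det_mul)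
  moreover have "M dvd (A ** B) $ 1 $ 1 - 1" "M dvd (A ** B) $ 1 $ 2" "M dvd (A ** B) $ 2 $ 1" "M dvd (A ** B) $ 2 $ 2 - 1"
    unfolding matrix_mult_2_entries a b by (simp_all add: algebra_simps)
  ultimately show "A \<otimes>\<^bsub>SL2Z\<^esub> B \<in> principal_congruence M"
    by (simp add: principal_congruence_def SL2Z_def)
qed

lemma finite_image_if_factors:
  assumes "finite (\<rho> ` C)" "\<And>a b. a \<in> C \<Longrightarrow> b \<in> C \<Longrightarrow> \<rho> a = \<rho> b \<Longrightarrow> f a = f b"
  shows "finite (f ` C)"
proof -
  have "f ` C \<subseteq> (\<lambda>y. f (inv_into C \<rho> y)) ` (\<rho> ` C)"
  proof safe
    fix a assume a: "a \<in> C"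
    have "f a = f (inv_into C \<rho> (\<rho> a))"
      using a by (intro assms(2)) (auto intro: inv_into_into f_inv_into_f[symmetric])
    thus "f a \<in> (\<lambda>y. f (inv_into C \<rho> y)) ` (\<rho> ` C)" using a by blast
  qed
  thus ?thesis using assms(1) finite_surj by blast
qed

text \<open>The coset of A depends only on the entries modulo M: if B is congruent to A, then B
  A^(-1) lies in the subgroup.\<close>

lemma finite_index_principal_congruence:
  assumes M: "M > 0"
  shows "finite_index_subgroup (principal_congruence M)"
  unfolding finite_index_subgroup_def
proof
  let ?H = "principal_congruence M"
  show sub: "subgroup ?H SL2Z" by (rule subgroup_principal_congruence)
  define \<rho> where "\<rho> = (\<lambda>A :: int ^ 2 ^ 2. (A $ 1 $ 1 mod M, A $ 1 $ 2 mod M, A $ 2 $ 1 mod M, A $ 2 $ 2 mod M))"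
  have "rcosets\<^bsub>SL2Z\<^esub> ?H = (\<lambda>a. ?H #>\<^bsub>SL2Z\<^esub> a) ` carrier SL2Z"
    by (auto simp: RCOSETS_def)
  also have "finite \<dots>"
  proof (rule finite_image_if_factors[where \<rho> = \<rho>])
    have "\<rho> ` carrier SL2Z \<subseteq> {0..<M} \<times> {0..<M} \<times> {0..<M} \<times> {0..<M}"
      using M by (auto simp: \<rho>_def)
    thus "finite (\<rho> ` carrier SL2Z)" by (rule finite_subset) auto
    fix A B assume A: "A \<in> carrier SL2Z" and B: "B \<in> carrier SL2Z" and eq: "\<rho> A = \<rho> B"
    have "M dvd B $ i $ j - A $ i $ j" for i j
      using eq exhaust_2[of i] exhaust_2[of j] by (auto simp: \<rho>_def mod_eq_dvd_iff dvd_diff_commute)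
    then obtain k where k: "\<And>i j. B $ i $ j = A $ i $ j + M * k i j"
      unfolding dvd_def by (metis add.commute diff_add_cancel)
    have dA: "A $ 1 $ 1 * A $ 2 $ 2 - A $ 1 $ 2 * A $ 2 $ 1 = 1"
      using A by (simp add: SL2Z_def det_2)
    have "B ** adjugate2 A \<in> ?H"
    proof -
      have "det (B ** adjugate2 A) = 1"
        using A B by (simp add: SL2Z_def det_mul) (simp add: det_2 mult_ac)
      moreover have "(B ** adjugate2 A) $ 1 $ 1 - 1 = M * (k 1 1 * A $ 2 $ 2 - k 1 2 * A $ 2 $ 1)"
        "(B ** adjugate2 A) $ 1 $ 2 = M * (k 1 2 * A $ 1 $ 1 - k 1 1 * A $ 1 $ 2)"
        "(B ** adjugate2 A) $ 2 $ 1 = M * (k 2 1 * A $ 2 $ 2 - k 2 2 * A $ 2 $ 1)"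
        "(B ** adjugate2 A) $ 2 $ 2 - 1 = M * (k 2 2 * A $ 1 $ 1 - k 2 1 * A $ 1 $ 2)"
        using dA by (simp_all add: matrix_mult_2_entries k algebra_simps)
      ultimately show ?thesis by (simp add: principal_congruence_def)
    qed
    moreover have "(B ** adjugate2 A) \<otimes>\<^bsub>SL2Z\<^esub> A = B"
    proof -
      have "adjugate2 A ** A = mat 1"
        using dA by (simp add: vec_eq_iff forall_2 matrix_mult_2_entries mat_def algebra_simps)
      thus ?thesis by (simp add: SL2Z_def matrix_mul_assoc[symmetric])
    qed
    ultimately have "B \<in> ?H #>\<^bsub>SL2Z\<^esub> A" by (force simp: r_coset_def)
    from group.repr_independence[OF group_SL2Z this A sub]
    show "?H #>\<^bsub>SL2Z\<^esub> A = ?H #>\<^bsub>SL2Z\<^esub> B" .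
  qed
  finally show "finite (rcosets\<^bsub>SL2Z\<^esub> ?H)" .
qed

section \<open>Modularity\<close>

text \<open>With the exponentials collected in X and Y this is \<open>g3_trisum_product\<close>; the
  sign stems from the minus sign in \<open>Phi\<close>.\<close>

lemma g3_trisum_eq_theta_quotient:
  assumes \<tau>: "Im \<tau> > 0" and \<alpha>: "3 * \<alpha> \<notin> lattice_pts (3 * \<tau>)"
  shows "g3_trisum \<alpha> \<tau> = - theta_quotient \<alpha> \<tau>"
proof -
  define w q where "w = nome \<alpha>" and "q = nome \<tau>"
  define \<Theta> T1 T3 where "\<Theta> = theta_prod (w ^ 3) (q ^ 3)" and "T1 = qinf q q" and "T3 = qinf (q ^ 3) (q ^ 3)"
  have 3: "Im (3 * \<tau>) > 0" using \<tau> by simp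
  have w3: "w ^ 3 = nome (3 * \<alpha>)" and q3: "q ^ 3 = nome (3 * \<tau>)" by (simp_all add: w_def q_def nome_power)
  have T: "T1 \<noteq> 0" "T3 \<noteq> 0"
    using qinf_self_nonzero[OF \<tau>] qinf_self_nonzero[OF 3] by (simp_all add: T1_def T3_def q_def[symmetric] q3)
  have \<Phi>: "Phi (3 * \<alpha>) (3 * \<tau>) = - nome (- (3 * \<alpha>) / 2) * \<Theta> / T3\<^sup>2"
    unfolding Phi_def \<Theta>_def T3_def w3 q3 ..
  moreover have "Phi (3 * \<alpha>) (3 * \<tau>) \<noteq> 0" using \<alpha> Phi_eq_0_iff[OF 3] by simp
  ultimately have \<Theta>: "\<Theta> \<noteq> 0" by auto
  have "(g3 w q + g3 (zeta3 * w) q + g3 (zeta3\<^sup>2 * w) q) * (\<Theta> * T1) = 3 * T3\<^sup>2"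
    unfolding \<Theta>_def T1_def T3_def using \<Theta>
    by (intro g3_trisum_product[OF \<tau>]) (simp_all add: q_def nome_def w_def \<Theta>_def)
  hence S: "g3 w q + g3 (zeta3 * w) q + g3 (zeta3\<^sup>2 * w) q = 3 * T3\<^sup>2 / (\<Theta> * T1)"
    using \<Theta> T by (simp add: field_simps)
  have e1: "exp (3 * of_real pi * \<i> * \<alpha>) = nome (3 * \<alpha> / 2)"
    unfolding nome_def by (rule arg_cong[of _ _ exp]) simp
  have e2: "exp (2 * of_real pi * \<i> * \<alpha>) = w" "qpow 1 \<tau> = q" by (simp_all add: w_def nome_def qpow_eq_nome q_def)
  have e3: "nome (- (3 * \<alpha>) / 2) = inverse (nome (3 * \<alpha> / 2))" unfolding nome_minus[symmetric] by simp
  have e4: "qpow (- 1 / 24) \<tau> = inverse (nome (\<tau> / 24))"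
    unfolding nome_minus[symmetric] qpow_eq_nome by (rule arg_cong[of _ _ nome]) simp
  define X Y where "X = nome (3 * \<alpha> / 2)" and "Y = nome (\<tau> / 24)"
  have XY: "X \<noteq> 0" "Y \<noteq> 0" by (simp_all add: X_def Y_def)
  have L: "g3_trisum \<alpha> \<tau> = X * inverse Y * (3 * T3\<^sup>2 / (\<Theta> * T1))"
    unfolding g3_trisum_def Let_def e1 e2 S e4 X_def Y_def ..
  have R: "theta_quotient \<alpha> \<tau> = 3 / (Y * T1 * (- inverse X * \<Theta> / T3\<^sup>2))"
    unfolding theta_quotient_eq[OF \<tau>] \<Phi> dedekind_eta_eq e3 X_def Y_def T1_def q_def ..
  show ?thesis unfolding L R using XY T \<Theta> by (simp add: field_simps)
qed

text \<open>At these points the identity is replaced by poles on both sides. Near them, but not at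
  them, the sum equals - 3 / D, and D tends to 0 through nonzero values.\<close>

lemma theta_poles:
  assumes \<tau>: "Im \<tau> > 0" and \<alpha>: "3 * \<alpha> \<in> lattice_pts (3 * \<tau>)"
  shows "is_pole (\<lambda>z. theta_quotient z \<tau>) \<alpha>" "is_pole (\<lambda>z. g3_trisum z \<tau>) \<alpha>"
proof -
  have 3: "Im (3 * \<tau>) > 0" using \<tau> by simp
  define D where "D = (\<lambda>z. dedekind_eta \<tau> * Phi (3 * z) (3 * \<tau>))"
  have D0: "D z = 0 \<longleftrightarrow> 3 * z \<in> lattice_pts (3 * \<tau>)" for z
    using dedekind_eta_nonzero[OF \<tau>] Phi_eq_0_iff[OF 3] by (simp add: D_def)
  have hol: "D holomorphic_on UNIV"
    unfolding D_def using 3 by (intro holomorphic_intros) auto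
  obtain r where r: "r > 0" "\<And>z. z \<in> ball \<alpha> r - {\<alpha>} \<Longrightarrow> D z \<noteq> 0"
    using isolated_zeros[OF hol open_UNIV connected_UNIV, of \<alpha> "1 / 6"] \<alpha> half_notin_lattice[OF 3] D0 by auto
  have ev: "\<forall>\<^sub>F z in at \<alpha>. D z \<noteq> 0"
    unfolding eventually_at using r by (intro exI[of _ r]) (auto simp: dist_commute)
  have "isCont D \<alpha>"
    using hol continuous_on_eq_continuous_at[of UNIV] holomorphic_on_imp_continuous_on by auto
  hence "filterlim D (at 0) (at \<alpha>)"
    using ev D0[of \<alpha>] \<alpha> unfolding isCont_def by (intro filterlim_atI) auto
  hence pole: "is_pole (\<lambda>z. c / D z) \<alpha>" if "c \<noteq> 0" for c
    using that by (intro is_pole_divide) auto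
  have q: "theta_quotient z \<tau> = 3 / D z" for z
    by (simp add: theta_quotient_eq[OF \<tau>] D_def)
  show "is_pole (\<lambda>z. theta_quotient z \<tau>) \<alpha>"
    unfolding q by (rule pole) simp
  have "\<forall>\<^sub>F z in at \<alpha>. - 3 / D z = g3_trisum z \<tau>"
    using ev by (rule eventually_mono) (simp add: g3_trisum_eq_theta_quotient[OF \<tau>] q D0)
  thus "is_pole (\<lambda>z. g3_trisum z \<tau>) \<alpha>"
    using pole[of "-3"] is_pole_cong[OF _ refl] by fastforce
qed

section \<open>Automorphy factors and multipliers\<close>

lemma SL2Z_det: "A \<in> carrier SL2Z \<Longrightarrow> A $ 1 $ 1 * A $ 2 $ 2 - A $ 1 $ 2 * A $ 2 $ 1 = 1"
  by (simp add: SL2Z_def det_2)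

lemma aut_denom_nonzero: "A \<in> carrier SL2Z \<Longrightarrow> Im \<tau> > 0 \<Longrightarrow> aut_denom A \<tau> \<noteq> 0"
  unfolding aut_denom_def by (rule moebius_denom_nonzero[OF _ SL2Z_det])

lemma Im_mob: "A \<in> carrier SL2Z \<Longrightarrow> Im \<tau> > 0 \<Longrightarrow> Im (mob A \<tau>) > 0"
  unfolding aut_denom_def mob_def by (rule Im_moebius[OF _ SL2Z_det])

lemma aut_denom_mult:
  assumes "B \<in> carrier SL2Z" "Im \<tau> > 0"
  shows "aut_denom (A ** B) \<tau> = aut_denom A (mob B \<tau>) * aut_denom B \<tau>"
  using aut_denom_nonzero[OF assms]
  by (simp add: aut_denom_def mob_def matrix_mult_2_entries field_simps)

lemma mob_mult:
  assumes "A \<in> carrier SL2Z" "B \<in> carrier SL2Z" "Im \<tau> > 0"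
  shows "mob (A ** B) \<tau> = mob A (mob B \<tau>)"
proof -
  have num: "mob B \<tau> * aut_denom B \<tau> = of_int (B $ 1 $ 1) * \<tau> + of_int (B $ 1 $ 2)"
    using aut_denom_nonzero[OF assms(2,3)] by (simp add: mob_def)
  have "(of_int (A $ 1 $ 1) * mob B \<tau> + of_int (A $ 1 $ 2)) * aut_denom B \<tau>
      = of_int (A $ 1 $ 1) * (mob B \<tau> * aut_denom B \<tau>) + of_int (A $ 1 $ 2) * aut_denom B \<tau>"
    by (simp add: algebra_simps)
  also have "\<dots> = of_int ((A ** B) $ 1 $ 1) * \<tau> + of_int ((A ** B) $ 1 $ 2)"
    unfolding num by (simp add: aut_denom_def matrix_mult_2_entries algebra_simps)
  finally have "of_int ((A ** B) $ 1 $ 1) * \<tau> + of_int ((A ** B) $ 1 $ 2)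
      = (of_int (A $ 1 $ 1) * mob B \<tau> + of_int (A $ 1 $ 2)) * aut_denom B \<tau>" ..
  thus ?thesis
    using aut_denom_nonzero[OF assms(2,3)]
    unfolding mob_def[of "A ** B"] aut_denom_mult[OF assms(2,3)] by (simp add: mob_def[of A])
qed

text \<open>Evaluating f at the image under \<open>A ** B\<close> in two ways and cancelling its
  nonzero value gives the cocycle relation. The auxiliary cocycle g allows f to have a weight other
  than k.\<close>

lemma multiplier_systemI:
  assumes \<Gamma>: "\<Gamma> \<subseteq> carrier SL2Z" and N: "(N::nat) > 0" "\<And>A. A \<in> \<Gamma> \<Longrightarrow> \<nu> A ^ N = 1"
    and closed: "\<And>A B. A \<in> \<Gamma> \<Longrightarrow> B \<in> \<Gamma> \<Longrightarrow> A ** B \<in> \<Gamma>"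
    and f: "\<And>\<tau>. Im \<tau> > 0 \<Longrightarrow> f \<tau> \<noteq> 0"
    and j: "\<And>A \<tau>. A \<in> \<Gamma> \<Longrightarrow> Im \<tau> > 0 \<Longrightarrow> f (mob A \<tau>) = g A \<tau> * (\<nu> A * aut_denom A \<tau> powr of_real k) * f \<tau>"
    and g: "\<And>A B \<tau>. A \<in> \<Gamma> \<Longrightarrow> B \<in> \<Gamma> \<Longrightarrow> Im \<tau> > 0 \<Longrightarrow> g (A ** B) \<tau> = g A (mob B \<tau>) * g B \<tau>"
    and g0: "\<And>A \<tau>. A \<in> \<Gamma> \<Longrightarrow> Im \<tau> > 0 \<Longrightarrow> g A \<tau> \<noteq> 0"
  shows "multiplier_system k \<Gamma> \<nu>"
  unfolding multiplier_system_def
proof (intro conjI ballI)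
  show "\<exists>N::nat. N > 0 \<and> (\<forall>A\<in>\<Gamma>. \<nu> A ^ N = 1)" using N by blast
  fix A B \<tau> assume AB: "A \<in> \<Gamma>" "B \<in> \<Gamma>" and "\<tau> \<in> upper_half_plane"
  hence \<tau>: "Im \<tau> > 0" by (simp add: upper_half_plane_def)
  have c: "A \<in> carrier SL2Z" "B \<in> carrier SL2Z" using AB \<Gamma> by auto
  note B\<tau> = Im_mob[OF c(2) \<tau>]
  let ?j = "\<lambda>A \<tau>. \<nu> A * aut_denom A \<tau> powr of_real k"
  have "g (A ** B) \<tau> * ?j (A ** B) \<tau> * f \<tau> = g A (mob B \<tau>) * ?j A (mob B \<tau>) * (g B \<tau> * ?j B \<tau> * f \<tau>)"
    unfolding j[OF closed[OF AB] \<tau>, symmetric] j[OF AB(2) \<tau>, symmetric] j[OF AB(1) B\<tau>, symmetric]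
      mob_mult[OF c \<tau>] ..
  hence "(g A (mob B \<tau>) * g B \<tau> * f \<tau>) * ?j (A ** B) \<tau> = (g A (mob B \<tau>) * g B \<tau> * f \<tau>) * (?j A (mob B \<tau>) * ?j B \<tau>)"
    unfolding g[OF AB \<tau>] by (simp only: mult_ac)
  thus "?j (A ** B) \<tau> = ?j A (mob B \<tau>) * ?j B \<tau>"
    using g0[OF AB(1) B\<tau>] g0[OF AB(2) \<tau>] f[OF \<tau>] by (simp only: mult_cancel_left) simp
qed

definition eta_multiplier :: "int ^ 2 ^ 2 \<Rightarrow> complex" where
  "eta_multiplier A = (SOME \<epsilon>. \<epsilon> ^ 24 = 1 \<and> (\<forall>\<tau>. Im \<tau> > 0 \<longrightarrow>
      dedekind_eta (mob A \<tau>) = \<epsilon> * aut_denom A \<tau> powr of_real (1 / 2) * dedekind_eta \<tau>))"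

lemma eta_multiplier:
  assumes "A \<in> carrier SL2Z"
  shows "eta_multiplier A ^ 24 = 1"
    and "Im \<tau> > 0 \<Longrightarrow> dedekind_eta (mob A \<tau>) = eta_multiplier A * aut_denom A \<tau> powr of_real (1 / 2) * dedekind_eta \<tau>"
  using someI_ex[OF dedekind_eta_modular[OF SL2Z_det[OF assms], folded aut_denom_def, folded mob_def]]
  unfolding eta_multiplier_def by blast+

text \<open>Combines the weights -1/2 of 1 / eta and 1 of 1 / \<open>Phi\<close> into 1/2 while
  staying with principal values.\<close>

lemma powr_half_quotient: "(J::complex) \<noteq> 0 \<Longrightarrow> J / J powr of_real (1 / 2) = J powr of_real (1 / 2)"
proof -
  assume J: "J \<noteq> 0"
  have "J powr of_real (1 / 2) * J powr of_real (1 / 2) = J"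
    using J by (simp add: powr_add[symmetric])
  thus ?thesis using J by (simp add: divide_eq_eq)
qed

lemma principal_congruence_SL2Z: "principal_congruence M \<subseteq> carrier SL2Z"
  by (auto simp: principal_congruence_def SL2Z_def)

lemma principal_congruence_mult:
  "A \<in> principal_congruence M \<Longrightarrow> B \<in> principal_congruence M \<Longrightarrow> A ** B \<in> principal_congruence M"
  using subgroup.m_closed[OF subgroup_principal_congruence, of A M B] by (simp add: SL2Z_def)

text \<open>The weight of 1 / eta is -1/2, one less than the weight in question; the factor 1 /
  \<open>aut_denom\<close> makes up the difference.\<close>

lemma multiplier_system_inverse_eta:
  "multiplier_system (1 / 2) (principal_congruence M) (\<lambda>A. 1 / eta_multiplier A)"
proof (rule multiplier_systemI[where N = 24 and f = "\<lambda>\<tau>. 1 / dedekind_eta \<tau>" and g = "\<lambda>A \<tau>. 1 / aut_denom A \<tau>"])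
  fix A \<tau> assume "A \<in> principal_congruence M" and \<tau>: "Im \<tau> > 0"
  hence A: "A \<in> carrier SL2Z" using principal_congruence_SL2Z by auto
  note J = aut_denom_nonzero[OF A \<tau>]
  have "1 / aut_denom A \<tau> * (1 / eta_multiplier A * aut_denom A \<tau> powr of_real (1 / 2)) * (1 / dedekind_eta \<tau>)
      = 1 / eta_multiplier A * (aut_denom A \<tau> powr of_real (1 / 2) / aut_denom A \<tau>) / dedekind_eta \<tau>" by simp
  also have "aut_denom A \<tau> powr of_real (1 / 2) / aut_denom A \<tau> = 1 / aut_denom A \<tau> powr of_real (1 / 2)"
    using powr_half_quotient[OF J] J by (simp add: divide_eq_eq eq_divide_eq mult.commute)
  finally show "1 / dedekind_eta (mob A \<tau>) = 1 / aut_denom A \<tau> * (1 / eta_multiplier A * aut_denom A \<tau> powr of_real (1 / 2)) * (1 / dedekind_eta \<tau>)"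
    unfolding eta_multiplier(2)[OF A \<tau>] by simp
  show "1 / aut_denom A \<tau> \<noteq> 0" using J by simp
next
  fix A B \<tau> assume "B \<in> principal_congruence M" and \<tau>: "Im \<tau> > 0"
  hence B: "B \<in> carrier SL2Z" using principal_congruence_SL2Z by auto
  show "1 / aut_denom (A ** B) \<tau> = 1 / aut_denom A (mob B \<tau>) * (1 / aut_denom B \<tau>)"
    unfolding aut_denom_mult[OF B \<tau>] by simp
next
  fix A assume "A \<in> principal_congruence M"
  hence "A \<in> carrier SL2Z" using principal_congruence_SL2Z by auto
  thus "(1 / eta_multiplier A) ^ 24 = 1" by (simp add: power_divide eta_multiplier)
qed (use principal_congruence_SL2Z principal_congruence_mult dedekind_eta_nonzero in auto)

section \<open>The theta quotient as a Jacobi form\<close>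

lemma triple_mob:
  fixes A :: "int ^ 2 ^ 2"
  assumes "A $ 2 $ 1 = 3 * c"
  shows "3 * mob A \<tau> = (of_int (A $ 1 $ 1) * (3 * \<tau>) + of_int (3 * A $ 1 $ 2)) / (of_int c * (3 * \<tau>) + of_int (A $ 2 $ 2))"
    and "aut_denom A \<tau> = of_int c * (3 * \<tau>) + of_int (A $ 2 $ 2)"
  by (simp_all add: mob_def aut_denom_def assms algebra_simps)

text \<open>Divisibility of the level by 3 makes the conjugate (a, 3 b; c / 3, d) of A by diag(3, 1)
  integral, and this is the matrix that acts on 3 \<tau>.\<close>

lemma principal_congruence_3_entry:
  fixes A :: "int ^ 2 ^ 2"
  assumes "A \<in> principal_congruence M" "3 dvd M"
  obtains c where "A $ 2 $ 1 = 3 * c" "A $ 1 $ 1 * A $ 2 $ 2 - 3 * A $ 1 $ 2 * c = 1"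
proof -
  have "3 dvd A $ 2 $ 1" using assms by (auto simp: principal_congruence_def intro: dvd_trans)
  then obtain c where c: "A $ 2 $ 1 = 3 * c" by blast
  have "A \<in> carrier SL2Z" using assms principal_congruence_SL2Z by auto
  from SL2Z_det[OF this] show ?thesis by (intro that[of c] c) (simp add: c)
qed

lemma theta_quotient_modular:
  fixes A :: "int ^ 2 ^ 2"
  assumes A: "A \<in> principal_congruence M" "3 dvd M" and \<tau>: "Im \<tau> > 0"
  shows "theta_quotient (z / aut_denom A \<tau>) (mob A \<tau>) =
    1 / eta_multiplier A * aut_denom A \<tau> powr of_real (1 / 2) *
      nome (of_real (- 3 / 2) * of_int (A $ 2 $ 1) * z\<^sup>2 / aut_denom A \<tau>) * theta_quotient z \<tau>"
proof -
  have S: "A \<in> carrier SL2Z" using A principal_congruence_SL2Z by auto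
  obtain c where c: "A $ 2 $ 1 = 3 * c" "A $ 1 $ 1 * A $ 2 $ 2 - 3 * A $ 1 $ 2 * c = 1"
    using principal_congruence_3_entry[OF A] .
  define J where "J = aut_denom A \<tau>"
  have J: "J \<noteq> 0" unfolding J_def by (rule aut_denom_nonzero[OF S \<tau>])
  have 3: "Im (3 * \<tau>) > 0" using \<tau> by simp
  have "Phi (3 * (z / J)) (3 * mob A \<tau>) = nome (of_int c * (3 * z)\<^sup>2 / (2 * J)) / J * Phi (3 * z) (3 * \<tau>)"
    unfolding times_divide_eq_right J_def triple_mob[OF c(1)] by (rule Phi_modular[OF 3 c(2)])
  \<comment> \<open>The index arises here: c (3 z)^2 / 2 is 3/2 times (3 c) z^2.\<close>
  moreover have "nome (of_real (- 3 / 2) * of_int (A $ 2 $ 1) * z\<^sup>2 / J) = inverse (nome (of_int c * (3 * z)\<^sup>2 / (2 * J)))"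
    unfolding nome_minus[symmetric] c(1) by (rule arg_cong[of _ _ nome]) (simp add: field_simps power2_eq_square)
  moreover have "3 / (e * J powr of_real (1 / 2) * h * (n / J * P)) = 1 / e * J powr of_real (1 / 2) * inverse n * (3 / (h * P))"
    for e h n P :: complex
  proof -
    have "3 / (e * p * h * (n / J * P)) = 1 / e * (J / p) * inverse n * (3 / (h * P))" for p
      by (simp add: divide_inverse mult_ac)
    thus ?thesis by (simp only: powr_half_quotient[OF J])
  qed
  ultimately show ?thesis
    unfolding theta_quotient_eq[OF \<tau>] theta_quotient_eq[OF Im_mob[OF S \<tau>]] eta_multiplier(2)[OF S \<tau>] J_def[symmetric]
    by (simp only:)
qed

text \<open>Shifting z by l \<tau> + m shifts 3 z by l (3 \<tau>) + 3 m, a vector of the lattice of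
  3 \<tau>.\<close>

lemma theta_quotient_elliptic:
  assumes \<tau>: "Im \<tau> > 0"
  shows "theta_quotient (z + of_int l * \<tau> + of_int m) \<tau> =
    (-1) powi (l + 3 * m) * nome (3 / 2 * (of_int l ^ 2 * \<tau> + 2 * of_int l * z)) * theta_quotient z \<tau>"
proof -
  have 3: "Im (3 * \<tau>) > 0" using \<tau> by simp
  have e: "3 * (z + of_int l * \<tau> + of_int m) = 3 * z + of_int l * (3 * \<tau>) + of_int (3 * m)"
    by (simp add: algebra_simps)
  have n: "nome (- (of_int l ^ 2 * (3 * \<tau>) / 2 + of_int l * (3 * z))) = inverse (nome (3 / 2 * (of_int l ^ 2 * \<tau> + 2 * of_int l * z)))"
    unfolding nome_minus[symmetric] by (rule arg_cong[of _ _ nome]) (simp add: field_simps)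
  have s: "inverse ((-1 :: complex) powi (l + 3 * m)) = (-1) powi (l + 3 * m)"
    by (cases "even (l + 3 * m)") (simp_all add: power_int_minus_left)
  have "3 / (h * (s * inverse n * P)) = inverse s * n * (3 / (h * P))" for h s n P :: complex
    by (simp add: divide_inverse mult_ac)
  thus ?thesis
    unfolding theta_quotient_eq[OF \<tau>] e Phi_lattice_shift[OF 3] n by (simp only: s)
qed

text \<open>Inserting the exponential factor of \<open>klein\<close> separates off the part on which
  the modular group acts through the characteristic.\<close>

lemma theta_quotient_torsion:
  assumes "Im \<tau> > 0"
  shows "theta_quotient (r * \<tau> + s) \<tau> = 3 * nome (3 * r * (r * \<tau> + s) / 2) * eta_klein_quotient r (3 * s) \<tau>"
proof -
  have e: "3 * (r * \<tau> + s) = r * (3 * \<tau>) + 3 * s" "r * (r * (3 * \<tau>) + 3 * s) / 2 = 3 * r * (r * \<tau> + s) / 2"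
    by (simp_all add: algebra_simps)
  have "3 / (h * P) = 3 * n * (1 / (h * (n * P)))" if "n \<noteq> 0" for h n P :: complex
    using that by simp
  thus ?thesis
    unfolding theta_quotient_eq[OF assms] eta_klein_quotient_def klein_def e by simp
qed

text \<open>The matrix carries a torsion section to another one, and the prefactor in q absorbs all
  exponentials up to a constant. The claim is thereby reduced to
  \<open>cusp_expansion_eta_klein_slash\<close>.\<close>

lemma theta_quotient_cusp:
  fixes A :: "int ^ 2 ^ 2"
  assumes A: "A \<in> carrier SL2Z" and rs: "r \<in> \<rat>" "s \<in> \<rat>"
  shows "meromorphic_at_ii_inf
      (\<lambda>\<tau>. qpow (- 3 / 2 * r\<^sup>2) \<tau> * jacobi_slash (1 / 2) (- 3 / 2) A theta_quotient (of_real r * \<tau> + of_real s) \<tau>)"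
proof (rule cusp_expansion_imp_meromorphic, rule cusp_expansion_cong)
  define a b c d where "a = A $ 1 $ 1" and "b = A $ 1 $ 2" and "c = A $ 2 $ 1" and "d = A $ 2 $ 2"
  have det: "a * d - b * c = 1" using SL2Z_det[OF A] by (simp add: a_def b_def c_def d_def)
  \<comment> \<open>The row (r, s) times the inverse matrix, so that z / J = r' X + s'.\<close>
  define r' s' where "r' = r * of_int d - s * of_int c" and "s' = s * of_int a - r * of_int b"
  have rs': "r' \<in> \<rat>" "3 * s' \<in> \<rat>" using rs by (auto simp: r'_def s'_def intro!: Rats_mult Rats_diff)
  let ?E = "\<lambda>\<tau>. (of_int c * \<tau> + of_int d) powr (- of_real (1 / 2)) *
      eta_klein_quotient (of_real r') (of_real (3 * s')) ((of_int a * \<tau> + of_int b) / (of_int c * \<tau> + of_int d))"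
  show "cusp_expansion (\<lambda>\<tau>. 3 * nome (of_real (3 * r * s / 2)) * ?E \<tau>)"
    by (intro cusp_expansion_mult[OF cusp_expansion_const] cusp_expansion_eta_klein_slash det rs')
  fix \<tau> :: complex assume \<tau>: "Im \<tau> > 0"
  define J z X where "J = of_int c * \<tau> + of_int d" and "z = of_real r * \<tau> + of_real s"
    and "X = (of_int a * \<tau> + of_int b) / J"
  have J: "J \<noteq> 0" unfolding J_def using moebius_denom_nonzero[OF \<tau> det] .
  have X: "Im X > 0" unfolding X_def J_def using Im_moebius[OF \<tau> det] .
  have det': "of_int a * of_int d - of_int b * of_int c = (1::complex)"
    using det by (metis of_int_1 of_int_diff of_int_mult)
  have JX: "aut_denom A \<tau> = J" "mob A \<tau> = X"
    by (simp_all add: aut_denom_def mob_def J_def X_def a_def b_def c_def d_def)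
  have "of_real r' * (J * X) + of_real s' * J = z"
  proof -
    have JX': "J * X = of_int a * \<tau> + of_int b" using J by (simp add: X_def)
    have "of_real r' = (of_real r * of_int d - of_real s * of_int c :: complex)"
      "of_real s' = (of_real s * of_int a - of_real r * of_int b :: complex)" by (simp_all add: r'_def s'_def)
    thus ?thesis unfolding JX' unfolding J_def z_def using det' by algebra
  qed
  hence zJ: "z / J = of_real r' * X + of_real s'" using J by (simp add: field_simps)
  have cz: "of_int c * z + of_real r' = of_real r * J"
    by (simp add: z_def r'_def J_def algebra_simps)
  have "z * (of_int c * z + of_real r') / J = of_real r * z" unfolding cz using J by simp
  hence rz: "of_int c * z\<^sup>2 / J + of_real r' * (z / J) = of_real r * z"
    by (simp add: add_divide_distrib ring_distribs power2_eq_square mult_ac)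
  have ex: "exp (- 2 * of_real pi * \<i> * of_real (- 3 / 2) * of_int c * z\<^sup>2 / J) = nome (3 / 2 * (of_int c * z\<^sup>2 / J))"
    unfolding nome_def by (rule arg_cong[of _ _ exp]) simp
  have "nome (of_real (- 3 / 2 * r\<^sup>2) * \<tau>) * (nome (3 / 2 * (of_int c * z\<^sup>2 / J)) * nome (3 * of_real r' * (z / J) / 2))
      = nome (of_real (3 * r * s / 2))"
  proof -
    have "of_real (- 3 / 2 * r\<^sup>2) * \<tau> + (3 / 2 * (of_int c * z\<^sup>2 / J) + 3 * of_real r' * (z / J) / 2)
        = 3 / 2 * (- (of_real r ^ 2) * \<tau> + (of_int c * z\<^sup>2 / J + of_real r' * (z / J)))"
      by (simp add: algebra_simps)
    also have "\<dots> = of_real (3 * r * s / 2)"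
      unfolding rz by (simp add: z_def ring_distribs power2_eq_square)
    finally show ?thesis unfolding nome_add[symmetric] by (rule arg_cong)
  qed
  moreover have "q * (p * n * (3 * m * g)) = 3 * (q * (n * m)) * (p * g)" for q p n m g :: complex
    by (simp only: mult_ac)
  ultimately show "qpow (- 3 / 2 * r\<^sup>2) \<tau> * jacobi_slash (1 / 2) (- 3 / 2) A theta_quotient (of_real r * \<tau> + of_real s) \<tau>
      = 3 * nome (of_real (3 * r * s / 2)) * ?E \<tau>"
    unfolding jacobi_slash_def JX z_def[symmetric] c_def[symmetric] ex J_def[symmetric] X_def[symmetric]
      zJ theta_quotient_torsion[OF X] qpow_eq_nome of_real_mult[of 3 s'] of_real_numeral
    by (simp only: mult_ac)
qed

text \<open>The multiplier is that of 1 / eta alone, because \<open>Phi\<close> transforms without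
  one.\<close>

theorem theta_quotient_jacobi_form:
  "meromorphic_jacobi_form (1 / 2) (- 3 / 2) (principal_congruence 3) theta_quotient"
  unfolding meromorphic_jacobi_form_def
proof (intro conjI)
  let ?\<nu> = "\<lambda>A. 1 / eta_multiplier A"
  show "meromorphic2_on (\<lambda>(z, \<tau>). theta_quotient z \<tau>) (UNIV \<times> upper_half_plane)"
    by (rule meromorphic2_theta_quotient)
  have "theta_quotient (z / aut_denom A \<tau>) (mob A \<tau>) =
             ?\<nu> A * aut_denom A \<tau> powr of_real (1 / 2)
               * exp (2 * of_real pi * \<i> * of_real (- 3 / 2) * of_int (A $ 2 $ 1) * z\<^sup>2 / aut_denom A \<tau>)
               * theta_quotient z \<tau>" if "A \<in> principal_congruence 3" "\<tau> \<in> upper_half_plane" for A z \<tau>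
  proof -
    have "exp (2 * of_real pi * \<i> * of_real (- 3 / 2) * of_int (A $ 2 $ 1) * z\<^sup>2 / aut_denom A \<tau>)
        = nome (of_real (- 3 / 2) * of_int (A $ 2 $ 1) * z\<^sup>2 / aut_denom A \<tau>)"
      unfolding nome_def by (rule arg_cong[of _ _ exp]) simp
    thus ?thesis
      using theta_quotient_modular[OF that(1)] that(2) by (simp only: upper_half_plane_def mem_Collect_eq dvd_refl)
  qed
  thus "\<exists>\<nu>. multiplier_system (1 / 2) (principal_congruence 3) \<nu> \<and>
        (\<forall>A\<in>principal_congruence 3. \<forall>z. \<forall>\<tau>\<in>upper_half_plane.
           theta_quotient (z / aut_denom A \<tau>) (mob A \<tau>) =
             \<nu> A * aut_denom A \<tau> powr of_real (1 / 2)
               * exp (2 * of_real pi * \<i> * of_real (- 3 / 2) * of_int (A $ 2 $ 1) * z\<^sup>2 / aut_denom A \<tau>)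
               * theta_quotient z \<tau>)"
    using multiplier_system_inverse_eta[of 3] by (intro exI[of _ ?\<nu>] conjI ballI allI)
  show "\<exists>\<psi> :: int \<Rightarrow> int \<Rightarrow> complex.
        (\<exists>N::nat. N > 0 \<and> (\<forall>l \<mu>. \<psi> l \<mu> ^ N = 1)) \<and>
        (\<forall>l \<mu> z. \<forall>\<tau>\<in>upper_half_plane.
           theta_quotient (z + of_int l * \<tau> + of_int \<mu>) \<tau> =
             \<psi> l \<mu> * exp (- 2 * of_real pi * \<i> * of_real (- 3 / 2) * ((of_int l)\<^sup>2 * \<tau> + 2 * of_int l * z))
               * theta_quotient z \<tau>)"
  proof (intro exI[of _ "\<lambda>l \<mu>. (-1) powi (l + 3 * \<mu>)"] conjI allI ballI)
    have "((-1 :: complex) powi n) ^ 2 = 1" for n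
      by (cases "even n") (simp_all add: power_int_minus_left)
    thus "\<exists>N::nat. N > 0 \<and> (\<forall>l \<mu>. ((-1 :: complex) powi (l + 3 * \<mu>)) ^ N = 1)"
      by (intro exI[of _ 2]) simp
    fix l \<mu> :: int and z \<tau> :: complex assume "\<tau> \<in> upper_half_plane"
    hence \<tau>: "Im \<tau> > 0" by (simp add: upper_half_plane_def)
    have e: "exp (- 2 * of_real pi * \<i> * of_real (- 3 / 2) * ((of_int l)\<^sup>2 * \<tau> + 2 * of_int l * z))
        = nome (3 / 2 * (of_int l ^ 2 * \<tau> + 2 * of_int l * z))"
      unfolding nome_def by (rule arg_cong[of _ _ exp]) simp
    show "theta_quotient (z + of_int l * \<tau> + of_int \<mu>) \<tau> =
             (-1) powi (l + 3 * \<mu>) * exp (- 2 * of_real pi * \<i> * of_real (- 3 / 2) * ((of_int l)\<^sup>2 * \<tau> + 2 * of_int l * z))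
               * theta_quotient z \<tau>"
      unfolding e by (rule theta_quotient_elliptic[OF \<tau>])
  qed
  show "\<forall>A\<in>carrier SL2Z. \<forall>r\<in>\<rat>. \<forall>s\<in>\<rat>.
        meromorphic_at_ii_inf
          (\<lambda>\<tau>. qpow (- 3 / 2 * r\<^sup>2) \<tau> * jacobi_slash (1 / 2) (- 3 / 2) A theta_quotient (of_real r * \<tau> + of_real s) \<tau>)"
    using theta_quotient_cusp by blast
qed

text \<open>For A congruent to the identity modulo 3 N the characteristic (r, 3 s) changes by an
  integral vector, so the Klein form reproduces itself up to the root of unity in
  \<open>klein_shift\<close>.\<close>

lemma klein_congruence_shift:
  fixes A :: "int ^ 2 ^ 2" and r s :: real
  assumes A: "A \<in> principal_congruence (3 * int N)" and N: "N > 0"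
    and rs: "of_nat N * r \<in> \<int>" "of_nat N * s \<in> \<int>"
  obtains \<kappa> where "\<kappa> ^ (2 * N) = 1"
    "\<And>\<tau>. Im \<tau> > 0 \<Longrightarrow> klein (of_real r) (of_real (3 * s)) (3 * mob A \<tau>)
        = \<kappa> * klein (of_real r) (of_real (3 * s)) (3 * \<tau>) / aut_denom A \<tau>"
proof -
  obtain c where c: "A $ 2 $ 1 = 3 * c" "A $ 1 $ 1 * A $ 2 $ 2 - 3 * A $ 1 $ 2 * c = 1"
    using principal_congruence_3_entry[OF A] by auto
  obtain p1 p2 where p: "of_nat N * r = of_int p1" "of_nat N * s = of_int p2"
    using rs by (auto elim!: Ints_cases)
  have "3 * int N dvd A $ 1 $ 1 - 1" "3 * int N dvd A $ 1 $ 2" "3 * int N dvd A $ 2 $ 1" "3 * int N dvd A $ 2 $ 2 - 1"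
    using A by (auto simp: principal_congruence_def)
  then obtain k1 k2 k3 k4 where k: "A $ 1 $ 1 - 1 = 3 * int N * k1" "A $ 1 $ 2 = 3 * int N * k2"
      "A $ 2 $ 1 = 3 * int N * k3" "A $ 2 $ 2 - 1 = 3 * int N * k4"
    unfolding dvd_def by blast
  have k': "A $ 1 $ 1 = 1 + 3 * int N * k1" "c = int N * k3" "A $ 2 $ 2 = 1 + 3 * int N * k4"
    using k c by auto
  define l m where "l = 3 * p1 * k1 + 3 * p2 * k3" and "m = 9 * p1 * k2 + 9 * p2 * k4"
  have rl: "r * of_int (A $ 1 $ 1) + 3 * s * of_int c = r + of_int l"
  proof -
    have "r * of_int (A $ 1 $ 1) + 3 * s * of_int c = r + 3 * (of_nat N * r) * of_int k1 + 3 * (of_nat N * s) * of_int k3"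
      unfolding k' by (simp add: algebra_simps)
    thus ?thesis unfolding p by (simp add: l_def)
  qed
  have sm: "r * of_int (3 * A $ 1 $ 2) + 3 * s * of_int (A $ 2 $ 2) = 3 * s + of_int m"
  proof -
    have "r * of_int (3 * A $ 1 $ 2) + 3 * s * of_int (A $ 2 $ 2) = 3 * s + 9 * (of_nat N * r) * of_int k2 + 9 * (of_nat N * s) * of_int k4"
      unfolding k' k(2) by (simp add: algebra_simps)
    thus ?thesis unfolding p by (simp add: m_def)
  qed
  define x where "x = (of_real r * of_int m - of_int l * of_real (3 * s) + of_int l * of_int m) / (2 :: complex)"
  \<comment> \<open>N clears the denominators of r and s, and 2 undoes the halving in
    \<open>klein_shift\<close>.\<close>
  have "nome x ^ (2 * N) = 1"
  proof -
    have "of_nat (2 * N) * x = of_real (of_nat N * r) * of_int m - 3 * of_int l * of_real (of_nat N * s) + of_nat N * of_int l * of_int m"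
      by (simp add: x_def field_simps)
    also have "\<dots> = of_int (p1 * m - 3 * l * p2 + int N * l * m)"
      unfolding p by simp
    finally show ?thesis unfolding nome_power by (simp only: nome_of_int)
  qed
  moreover have "((-1 :: complex) powi (l + m)) ^ (2 * N) = 1"
    by (cases "even (l + m)") (simp_all add: power_int_minus_left)
  ultimately have "((-1) powi (l + m) * nome x) ^ (2 * N) = 1" by (simp add: power_mult_distrib)
  moreover have "klein (of_real r) (of_real (3 * s)) (3 * mob A \<tau>)
        = (-1) powi (l + m) * nome x * klein (of_real r) (of_real (3 * s)) (3 * \<tau>) / aut_denom A \<tau>"
    if \<tau>: "Im \<tau> > 0" for \<tau>
  proof -
    have 3: "Im (3 * \<tau>) > 0" using \<tau> by simp
    have "klein (of_real r) (of_real (3 * s)) (3 * mob A \<tau>)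
        = klein (of_real r * of_int (A $ 1 $ 1) + of_real (3 * s) * of_int c)
            (of_real r * of_int (3 * A $ 1 $ 2) + of_real (3 * s) * of_int (A $ 2 $ 2)) (3 * \<tau>) / aut_denom A \<tau>"
      unfolding triple_mob[OF c(1)] by (rule klein_modular[OF 3 c(2)])
    also have "of_real r * of_int (A $ 1 $ 1) + of_real (3 * s) * of_int c = (of_real r + of_int l :: complex)"
      using arg_cong[OF rl, of complex_of_real] by simp
    also have "of_real r * of_int (3 * A $ 1 $ 2) + of_real (3 * s) * of_int (A $ 2 $ 2) = (of_real (3 * s) + of_int m :: complex)"
      using arg_cong[OF sm, of complex_of_real] by simp
    finally show ?thesis unfolding klein_shift[OF 3] x_def .
  qed
  ultimately show ?thesis by (rule that)
qed

lemma klein_nonzero: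
  fixes r s :: real
  assumes \<tau>: "Im \<tau> > 0" and "\<not> (r \<in> \<int> \<and> 3 * s \<in> \<int>)"
  shows "klein (of_real r) (of_real (3 * s)) (3 * \<tau>) \<noteq> 0"
    and "3 * (of_real r * \<tau> + of_real s) \<notin> lattice_pts (3 * \<tau>)"
proof -
  have 3: "Im (3 * \<tau>) > 0" using \<tau> by simp
  show *: "3 * (of_real r * \<tau> + of_real s) \<notin> lattice_pts (3 * \<tau>)"
  proof
    assume "3 * (of_real r * \<tau> + of_real s) \<in> lattice_pts (3 * \<tau>)"
    then obtain l m :: int where lm: "3 * (of_real r * \<tau> + of_real s) = of_int l * (3 * \<tau>) + of_int m"
      by (auto simp: lattice_pts_def)
    from arg_cong[OF lm, of Im] \<tau> have r: "r = of_int l" by simp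
    with arg_cong[OF lm, of Re] have "3 * s = of_int m" by simp
    with r assms(2) show False by auto
  qed
  moreover have "of_real r * (3 * \<tau>) + of_real (3 * s) = 3 * (of_real r * \<tau> + of_real s)" by (simp add: algebra_simps)
  ultimately show "klein (of_real r) (of_real (3 * s)) (3 * \<tau>) \<noteq> 0"
    unfolding klein_def by (simp only: mult_eq_0_iff nome_nonzero Phi_eq_0_iff[OF 3]) simp
qed

text \<open>Up to a constant, f is \<open>eta_klein_quotient\<close>, which has no zeros on the half
  plane; this allows \<open>multiplier_systemI\<close> to be applied to f itself with trivial
  g.\<close>

theorem g3_trisum_torsion_modular:
  fixes r s :: real
  assumes rs: "r \<in> \<rat>" "s \<in> \<rat>" and nl: "\<not> (r \<in> \<int> \<and> 3 * s \<in> \<int>)"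
  shows "\<exists>\<Gamma>. finite_index_subgroup \<Gamma> \<and> weakly_holomorphic_modular_form (1 / 2) \<Gamma>
                 (\<lambda>\<tau>. qpow (- 3 * r\<^sup>2 / 2) \<tau> * g3_trisum (of_real r * \<tau> + of_real s) \<tau>)"
proof -
  obtain N1 p1 where N1: "(N1::nat) > 0" "r = of_int p1 / of_nat N1" using Rats_nat_denominator[OF rs(1)] by metis
  obtain N2 p2 where N2: "(N2::nat) > 0" "s = of_int p2 / of_nat N2" using Rats_nat_denominator[OF rs(2)] by metis
  define N where "N = N1 * N2"
  have N: "N > 0" using N1 N2 by (simp add: N_def)
  have "of_nat N * r = of_int (int N2 * p1)" "of_nat N * s = of_int (int N1 * p2)"
    using N1 N2 by (simp_all add: N_def)
  hence Nrs: "of_nat N * r \<in> \<int>" "of_nat N * s \<in> \<int>" by (metis Ints_of_int)+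
  define \<Gamma> where "\<Gamma> = principal_congruence (3 * int N)"
  have \<Gamma>: "\<Gamma> \<subseteq> carrier SL2Z" unfolding \<Gamma>_def by (rule principal_congruence_SL2Z)
  define G where "G = eta_klein_quotient (of_real r) (of_real (3 * s))"
  define C where "C = - 3 * nome (of_real (3 * r * s / 2))"
  define f where "f = (\<lambda>\<tau>. qpow (- 3 * r\<^sup>2 / 2) \<tau> * g3_trisum (of_real r * \<tau> + of_real s) \<tau>)"
  have C: "C \<noteq> 0" by (simp add: C_def)
  have f: "f \<tau> = C * G \<tau>" if \<tau>: "Im \<tau> > 0" for \<tau>
  proof -
    \<comment> \<open>The power of q cancels the part of the exponential that depends on
      \<tau>.\<close>
    have "nome (of_real (- 3 * r\<^sup>2 / 2) * \<tau>) * nome (3 * of_real r * (of_real r * \<tau> + of_real s) / 2) = nome (of_real (3 * r * s / 2))"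
      unfolding nome_add[symmetric] by (rule arg_cong[of _ _ nome]) (simp add: field_simps power2_eq_square)
    moreover have "n * - (3 * m * g) = - 3 * (n * m) * g" for n m g :: complex by simp
    ultimately show ?thesis
      unfolding f_def C_def G_def g3_trisum_eq_theta_quotient[OF \<tau> klein_nonzero(2)[OF \<tau> nl]]
        theta_quotient_torsion[OF \<tau>] qpow_eq_nome by simp
  qed
  have G0: "G \<tau> \<noteq> 0" if "Im \<tau> > 0" for \<tau>
    using klein_nonzero(1)[OF that nl] dedekind_eta_nonzero[OF that] by (simp add: G_def eta_klein_quotient_def)
  have "\<exists>\<kappa>. \<kappa> ^ (2 * N) = 1 \<and> (\<forall>\<tau>. Im \<tau> > 0 \<longrightarrow> klein (of_real r) (of_real (3 * s)) (3 * mob A \<tau>)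
        = \<kappa> * klein (of_real r) (of_real (3 * s)) (3 * \<tau>) / aut_denom A \<tau>)" if "A \<in> \<Gamma>" for A
    using klein_congruence_shift[OF that[unfolded \<Gamma>_def] N Nrs] by metis
  then obtain \<kappa> where \<kappa>: "\<And>A. A \<in> \<Gamma> \<Longrightarrow> \<kappa> A ^ (2 * N) = 1"
    "\<And>A \<tau>. A \<in> \<Gamma> \<Longrightarrow> Im \<tau> > 0 \<Longrightarrow> klein (of_real r) (of_real (3 * s)) (3 * mob A \<tau>)
        = \<kappa> A * klein (of_real r) (of_real (3 * s)) (3 * \<tau>) / aut_denom A \<tau>"
    by metis
  define \<nu> where "\<nu> = (\<lambda>A. 1 / (eta_multiplier A * \<kappa> A))"
  have G_mod: "G (mob A \<tau>) = \<nu> A * aut_denom A \<tau> powr of_real (1 / 2) * G \<tau>" if A: "A \<in> \<Gamma>" and \<tau>: "Im \<tau> > 0" for A \<tau>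
  proof -
    have S: "A \<in> carrier SL2Z" using A \<Gamma> by auto
    have "1 / (e * p * h * (k * P / J)) = 1 / (e * k) * (J / p) * (1 / (h * P))" for e p h k P J :: complex
      by (simp add: divide_inverse mult_ac)
    thus ?thesis
      unfolding G_def eta_klein_quotient_def eta_multiplier(2)[OF S \<tau>] \<kappa>(2)[OF A \<tau>] \<nu>_def
      by (simp only: powr_half_quotient[OF aut_denom_nonzero[OF S \<tau>]])
  qed
  have f_mod: "f (mob A \<tau>) = \<nu> A * aut_denom A \<tau> powr of_real (1 / 2) * f \<tau>" if "A \<in> \<Gamma>" and \<tau>: "Im \<tau> > 0" for A \<tau>
  proof -
    have "Im (mob A \<tau>) > 0" using that \<Gamma> by (intro Im_mob) auto
    thus ?thesis using G_mod[OF that] by (simp add: f \<tau>)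
  qed
  \<comment> \<open>The exponent 24 removes the multiplier of eta, and 2 N removes the root of unity
    of the Klein form.\<close>
  have \<nu>: "\<nu> A ^ (24 * (2 * N)) = 1" if A: "A \<in> \<Gamma>" for A
  proof -
    have S: "A \<in> carrier SL2Z" using A \<Gamma> by auto
    have "eta_multiplier A ^ (24 * (2 * N)) = 1" unfolding power_mult[of _ 24] eta_multiplier(1)[OF S] by simp
    moreover have "\<kappa> A ^ ((2 * N) * 24) = 1" unfolding power_mult[of _ "2 * N"] \<kappa>(1)[OF A] by simp
    ultimately show ?thesis by (simp add: \<nu>_def power_divide power_mult_distrib mult_ac)
  qed
  have "multiplier_system (1 / 2) \<Gamma> \<nu>"
  proof (rule multiplier_systemI[where N = "24 * (2 * N)" and f = f and g = "\<lambda>_ _. 1"])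
    show "A ** B \<in> \<Gamma>" if "A \<in> \<Gamma>" "B \<in> \<Gamma>" for A B
      using that principal_congruence_mult unfolding \<Gamma>_def by blast
    show "f \<tau> \<noteq> 0" if "Im \<tau> > 0" for \<tau> using f[OF that] G0[OF that] C by simp
    show "f (mob A \<tau>) = 1 * (\<nu> A * aut_denom A \<tau> powr of_real (1 / 2)) * f \<tau>" if "A \<in> \<Gamma>" "Im \<tau> > 0" for A \<tau>
      using f_mod[OF that] by simp
  qed (use \<Gamma> \<nu> N in auto)
  moreover have "f holomorphic_on upper_half_plane"
  proof -
    let ?H = "{\<tau>. Im \<tau> > 0}"
    have H: "open ?H" by (rule open_halfspace_Im_gt)
    have "(\<lambda>\<tau>. Phi (of_real r * (3 * \<tau>) + of_real (3 * s)) (3 * \<tau>)) holomorphic_on ?H"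
      by (intro holomorphic_Phi H holomorphic_intros) auto
    moreover have "(\<lambda>\<tau>. nome (of_real r * (of_real r * (3 * \<tau>) + of_real (3 * s)) / 2)) holomorphic_on ?H"
      by (intro holomorphic_intros) auto
    ultimately have "(\<lambda>\<tau>. klein (of_real r) (of_real (3 * s)) (3 * \<tau>)) holomorphic_on ?H"
      unfolding klein_def by (rule holomorphic_on_mult[rotated])
    hence "(\<lambda>\<tau>. C * G \<tau>) holomorphic_on ?H"
      unfolding G_def eta_klein_quotient_def
      using klein_nonzero(1)[OF _ nl] dedekind_eta_nonzero holomorphic_dedekind_eta
      by (intro holomorphic_on_mult holomorphic_on_const holomorphic_on_divide) auto
    hence "f holomorphic_on ?H" by (rule holomorphic_transform) (simp add: f)
    thus ?thesis by (simp add: upper_half_plane_def)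
  qed
  moreover have "meromorphic_at_ii_inf (modular_slash (1 / 2) A f)" if A: "A \<in> carrier SL2Z" for A
  proof (rule cusp_expansion_imp_meromorphic, rule cusp_expansion_cong)
    have "3 * s \<in> \<rat>" using rs by (intro Rats_mult) auto
    thus "cusp_expansion (\<lambda>\<tau>. C * ((of_int (A $ 2 $ 1) * \<tau> + of_int (A $ 2 $ 2)) powr (- of_real (1 / 2)) *
        eta_klein_quotient (of_real r) (of_real (3 * s)) ((of_int (A $ 1 $ 1) * \<tau> + of_int (A $ 1 $ 2)) / (of_int (A $ 2 $ 1) * \<tau> + of_int (A $ 2 $ 2)))))"
      by (intro cusp_expansion_mult[OF cusp_expansion_const] cusp_expansion_eta_klein_slash SL2Z_det A rs)
    fix \<tau> :: complex assume \<tau>: "Im \<tau> > 0"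
    show "modular_slash (1 / 2) A f \<tau> = C * ((of_int (A $ 2 $ 1) * \<tau> + of_int (A $ 2 $ 2)) powr (- of_real (1 / 2)) *
        eta_klein_quotient (of_real r) (of_real (3 * s)) ((of_int (A $ 1 $ 1) * \<tau> + of_int (A $ 1 $ 2)) / (of_int (A $ 2 $ 1) * \<tau> + of_int (A $ 2 $ 2))))"
      unfolding modular_slash_def f[OF Im_mob[OF A \<tau>]] aut_denom_def[symmetric] mob_def[symmetric] G_def
      by (simp only: mult_ac)
  qed
  ultimately have "weakly_holomorphic_modular_form (1 / 2) \<Gamma> f"
    unfolding weakly_holomorphic_modular_form_def using f_mod by (auto simp: upper_half_plane_def)
  moreover have "finite_index_subgroup \<Gamma>"
    unfolding \<Gamma>_def using N by (intro finite_index_principal_congruence) simp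
  ultimately show ?thesis unfolding f_def by blast
qed

theorem theorem1p3:
  shows "(\<forall>\<tau> \<alpha> :: complex. Im \<tau> > 0 \<and> (\<forall>m n :: int. \<alpha> \<noteq> 3 * of_int n * \<tau> + of_int m) \<longrightarrow>
            (if \<forall>m n :: int. 3 * \<alpha> \<noteq> 3 * of_int n * \<tau> + of_int m
             then g3_trisum \<alpha> \<tau> = - theta_quotient \<alpha> \<tau>
             else is_pole (\<lambda>z. g3_trisum z \<tau>) \<alpha> \<and> is_pole (\<lambda>z. theta_quotient z \<tau>) \<alpha>))
       \<and> (\<exists>\<Gamma>. finite_index_subgroup \<Gamma> \<and>
            meromorphic_jacobi_form (1 / 2) (- 3 / 2) \<Gamma> theta_quotient)
       \<and> (\<forall>r s :: real. r \<in> \<rat> \<and> s \<in> \<rat> \<and> \<not> (r \<in> \<int> \<and> 3 * s \<in> \<int>) \<longrightarrow>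
            (\<exists>\<Gamma>. finite_index_subgroup \<Gamma> \<and>
               weakly_holomorphic_modular_form (1 / 2) \<Gamma>
                 (\<lambda>\<tau>. qpow (- 3 * r\<^sup>2 / 2) \<tau> * g3_trisum (of_real r * \<tau> + of_real s) \<tau>)))"
proof (intro conjI)
  \<comment> \<open>Puts the condition in terms of the zeros of \<open>Phi\<close> at (3 \<alpha>, 3
    \<tau>).\<close>
  have lattice: "(\<forall>m n :: int. 3 * \<alpha> \<noteq> 3 * of_int n * \<tau> + of_int m) \<longleftrightarrow> 3 * \<alpha> \<notin> lattice_pts (3 * \<tau>)" for \<alpha> \<tau>
    by (auto simp: lattice_pts_def mult_ac)
  show "\<forall>\<tau> \<alpha> :: complex. Im \<tau> > 0 \<and> (\<forall>m n :: int. \<alpha> \<noteq> 3 * of_int n * \<tau> + of_int m) \<longrightarrow>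
            (if \<forall>m n :: int. 3 * \<alpha> \<noteq> 3 * of_int n * \<tau> + of_int m
             then g3_trisum \<alpha> \<tau> = - theta_quotient \<alpha> \<tau>
             else is_pole (\<lambda>z. g3_trisum z \<tau>) \<alpha> \<and> is_pole (\<lambda>z. theta_quotient z \<tau>) \<alpha>)"
    unfolding lattice using g3_trisum_eq_theta_quotient theta_poles by simp
  show "\<exists>\<Gamma>. finite_index_subgroup \<Gamma> \<and> meromorphic_jacobi_form (1 / 2) (- 3 / 2) \<Gamma> theta_quotient"
    using theta_quotient_jacobi_form finite_index_principal_congruence[of 3] by auto
qed (use g3_trisum_torsion_modular in blast)

end
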